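(* Let $\Gamma$ be a symmetric tree with global dimension $d$. Assume that either $1<d\le2$ and $0\le a<d-1$, or else that $d>2$ and $0\le a\le1$. Then for any $\gamma\ge\frac{1-a}2$ there is a constant $K(a,d,\gamma)$ such that for every potential $V:\Gamma\to[0,\infty)$ decaying at infinity $$\operatorname{tr}\left(-\Delta_\Gamma^N-V\right)_-^\gamma\le K(a,d,\gamma)\int_\Gamma V(x)^{\gamma+\frac{a+1}2}\,g_0(|x|)^{\frac a{d-1}}\,dx .$$
   Context: A rooted metric tree $\Gamma$ is a connected metric graph (edges are intervals, possibly half-lines) in which any two points are joined by a unique path, with a distinguished vertex $o$, the root; $|x|$ is the distance from $x$ to $o$. The generation of a vertex $v$ is the number of vertices on the path joining $v$ with $o$, counting $o$ but not $v$. $\Gamma$ is symmetric if all vertices at the same distance from the root have equal branching numbers and all edges emanating from these vertices have equal length. For a vertex of generation $l$, $b_l$ is its (finite, forward) branching number and $r_l$ its distance to the root; $b_0=1$, $r_0=0$, and $b_l\ge2$ for all $l\ge1$ (if there are no vertices of generation $l+1$, put $r_{l+1}=\infty$). It is assumed that $\sup_{x\in\Gamma}|x|=\infty$. The branching function is $g_0(r)=\#\{x\in\Gamma:|x|=r\}$, i.e. $g_0(0)=1$ and $g_0(r)=b_0b_1\cdots b_l$ for $r_l<r\le r_{l+1}$, $l\in\mathbb N_0$. $\Gamma$ has global dimension $d\ge1$ if $0<\inf_{r\ge0}\frac{g_0(r)}{(1+r)^{d-1}}\le\sup_{r\ge0}\frac{g_0(r)}{(1+r)^{d-1}}<\infty$.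 $H^1(\Gamma)$ consists of all continuous functions $\varphi$ on $\Gamma$ with $\varphi\in H^1(e)$ on each edge $e$ and $\int_\Gamma(|\varphi'|^2+|\varphi|^2)\,dx<\infty$. $-\Delta_\Gamma^N$ is the non-negative self-adjoint operator in $L_2(\Gamma)$ associated with the closed quadratic form $\int_\Gamma|\varphi'|^2\,dx$, $\varphi\in H^1(\Gamma)$. The Schrödinger operator $-\Delta_\Gamma^N-V$ in $L_2(\Gamma)$ is understood in the sense of quadratic forms. $\operatorname{tr}(H)_-^\gamma$ is the sum of $|\lambda|^\gamma$ over the negative eigenvalues $\lambda$ of $H$ counted with multiplicity; for $\gamma=0$ it is the number of negative eigenvalues. The tree $\Gamma$ is fixed, so the constant may depend on $\Gamma$, but it does not depend on $V$. The inequality is nontrivial only when the right side is finite. *)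

theory Defs
  imports "HOL-Analysis.Analysis" "HOL-Library.Function_Algebras"
begin

section \<open>Rooted metric trees\<close>

text \<open>
  An edge \<open>e\<close> is a copy of the interval from \<open>0\<close> to \<open>len e\<close>; its point \<open>0\<close> is the vertex \<open>src e\<close>
  and, if \<open>len e\<close> is finite, its point \<open>len e\<close> is the vertex \<open>tgt e\<close>. If \<open>len e = \<infinity>\<close> the edge is a
  half-line and \<open>tgt e\<close> has no meaning.
\<close>

record ('v, 'e) rooted_graph =
  verts :: "'v set"
  edges :: "'e set"
  src :: "'e \<Rightarrow> 'v"
  tgt :: "'e \<Rightarrow> 'v"
  len :: "'e \<Rightarrow> ereal"
  root :: 'v

text \<open>Edges may be traversed in both directions; half-lines lead to no vertex.\<close>

fun walk :: "('v, 'e) rooted_graph \<Rightarrow> 'v \<Rightarrow> 'e list \<Rightarrow> 'v \<Rightarrow> bool" where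
  "walk G u [] v \<longleftrightarrow> u \<in> verts G \<and> u = v"
| "walk G u (e # p) v \<longleftrightarrow> e \<in> edges G \<and> len G e < \<infinity> \<and>
     (src G e = u \<and> walk G (tgt G e) p v \<or> tgt G e = u \<and> walk G (src G e) p v)"

text \<open>No edge is used twice, but vertices may repeat: uniqueness of such paths also excludes loops.\<close>

definition is_path :: "('v, 'e) rooted_graph \<Rightarrow> 'v \<Rightarrow> 'e list \<Rightarrow> 'v \<Rightarrow> bool" where
  "is_path G u p v \<longleftrightarrow> walk G u p v \<and> distinct p"

definition vertex_dist :: "('v, 'e) rooted_graph \<Rightarrow> 'v \<Rightarrow> real" where
  "vertex_dist G v = (\<Sum>e\<leftarrow>(THE p. is_path G (root G) p v). real_of_ereal (len G e))"

definition out_edges :: "('v, 'e) rooted_graph \<Rightarrow> 'v \<Rightarrow> 'e set" where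
  "out_edges G v = {e \<in> edges G. src G e = v}"

text \<open>
  The condition \<open>outward\<close> only fixes the parametrization of the edges: \<open>src e\<close> is the end nearer to
  the root, so that the forward branching number of \<open>v\<close> is \<open>card (out_edges G v)\<close>. Two arbitrary
  points are joined by a unique path as soon as two vertices are.
\<close>

locale rooted_metric_tree =
  fixes G :: "('v, 'e) rooted_graph"
  assumes root_in: "root G \<in> verts G"
    and src_in: "e \<in> edges G \<Longrightarrow> src G e \<in> verts G"
    and tgt_in: "e \<in> edges G \<Longrightarrow> len G e < \<infinity> \<Longrightarrow> tgt G e \<in> verts G"
    and len_pos: "e \<in> edges G \<Longrightarrow> 0 < len G e"
    and unique_path: "u \<in> verts G \<Longrightarrow> v \<in> verts G \<Longrightarrow> \<exists>!p. is_path G u p v"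
    and outward: "e \<in> edges G \<Longrightarrow> len G e < \<infinity> \<Longrightarrow> vertex_dist G (src G e) < vertex_dist G (tgt G e)"

datatype ('v, 'e) point = Vertex 'v | Inner 'e real

definition points :: "('v, 'e) rooted_graph \<Rightarrow> ('v, 'e) point set" where
  "points G = Vertex ` verts G \<union> {Inner e t | e t. e \<in> edges G \<and> 0 < t \<and> ereal t < len G e}"

definition edge_point :: "('v, 'e) rooted_graph \<Rightarrow> 'e \<Rightarrow> real \<Rightarrow> ('v, 'e) point" where
  "edge_point G e t =
     (if t \<le> 0 then Vertex (src G e) else if ereal t < len G e then Inner e t else Vertex (tgt G e))"

fun root_dist :: "('v, 'e) rooted_graph \<Rightarrow> ('v, 'e) point \<Rightarrow> real" where
  "root_dist G (Vertex v) = vertex_dist G v"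
| "root_dist G (Inner e t) = vertex_dist G (src G e) + t"

locale symmetric_tree = rooted_metric_tree G for G :: "('v, 'e) rooted_graph" +
  assumes finite_branching: "v \<in> verts G \<Longrightarrow> finite (out_edges G v)"
    and root_branching: "card (out_edges G (root G)) = 1"
    and branching_ge_2: "v \<in> verts G \<Longrightarrow> v \<noteq> root G \<Longrightarrow> 2 \<le> card (out_edges G v)"
    and unbounded: "\<not> bdd_above (root_dist G ` points G)"
    and symmetric_branching:
      "u \<in> verts G \<Longrightarrow> v \<in> verts G \<Longrightarrow> vertex_dist G u = vertex_dist G v \<Longrightarrow>
        card (out_edges G u) = card (out_edges G v)"
    and symmetric_len:
      "u \<in> verts G \<Longrightarrow> v \<in> verts G \<Longrightarrow> vertex_dist G u = vertex_dist G v \<Longrightarrow>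
        e \<in> out_edges G u \<Longrightarrow> e' \<in> out_edges G v \<Longrightarrow> len G e = len G e'"

definition g0 :: "('v, 'e) rooted_graph \<Rightarrow> real \<Rightarrow> nat" where
  "g0 G r = card {x \<in> points G. root_dist G x = r}"

definition global_dimension :: "('v, 'e) rooted_graph \<Rightarrow> real \<Rightarrow> bool" where
  "global_dimension G d \<longleftrightarrow> 1 \<le> d \<and>
     0 < (INF r\<in>{0..}. ereal (real (g0 G r) / (1 + r) powr (d - 1))) \<and>
     (SUP r\<in>{0..}. ereal (real (g0 G r) / (1 + r) powr (d - 1))) < \<infinity>"

section \<open>Function spaces\<close>

definition edge_slice :: "('v, 'e) rooted_graph \<Rightarrow> 'e \<Rightarrow> ('v, 'e) point set \<Rightarrow> real set" where
  "edge_slice G e A = {t. 0 < t \<and> ereal t < len G e \<and> Inner e t \<in> A}"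

text \<open>Lebesgue measure \<open>dx\<close>; vertices are null sets.\<close>

definition tree_measure :: "('v, 'e) rooted_graph \<Rightarrow> ('v, 'e) point measure" where
  "tree_measure G =
     measure_of (points G) {A. A \<subseteq> points G \<and> (\<forall>e\<in>edges G. edge_slice G e A \<in> sets lebesgue)}
       (\<lambda>A. \<integral>\<^sup>+e. emeasure lebesgue (edge_slice G e A) \<partial>count_space (edges G))"

lemma edge_slice_points_lebesgue: "edge_slice G e (points G) \<in> sets lebesgue"
proof -
  have "edge_slice G e (points G) = (if e \<in> edges G then {0<..} \<inter> {t. ereal t < len G e} else {})"
    by (auto simp: edge_slice_def points_def)
  moreover have "open {t. ereal t < len G e}"
    by (intro open_Collect_less continuous_intros)
  ultimately show ?thesis
    by (auto intro: borel_open open_Int)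
qed

lemma sigma_algebra_tree:
  "sigma_algebra (points G) {A. A \<subseteq> points G \<and> (\<forall>e\<in>edges G. edge_slice G e A \<in> sets lebesgue)}"
proof -
  have compl: "edge_slice G e (points G - A) = edge_slice G e (points G) - edge_slice G e A" for e A
    by (auto simp: edge_slice_def)
  have un: "edge_slice G e (\<Union> (range A)) = (\<Union>i. edge_slice G e (A i))" for e and A :: "nat \<Rightarrow> _"
    by (auto simp: edge_slice_def)
  have "edge_slice G e {} = {}" for e
    by (auto simp: edge_slice_def)
  then show ?thesis
    unfolding sigma_algebra_iff2
    using edge_slice_points_lebesgue[of G] by (auto simp: compl un image_subset_iff)
qed

lemma space_tree_measure: "space (tree_measure G) = points G"
  unfolding tree_measure_def by (rule space_measure_of) auto

lemma sets_tree_measure: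
  "sets (tree_measure G) =
     {A. A \<subseteq> points G \<and> (\<forall>e\<in>edges G. edge_slice G e A \<in> sets lebesgue)}"
  unfolding tree_measure_def by (rule sigma_algebra.sets_measure_of_eq[OF sigma_algebra_tree])

lemma emeasure_tree_measure:
  assumes "A \<in> sets (tree_measure G)"
  shows "emeasure (tree_measure G) A =
     (\<integral>\<^sup>+e. emeasure lebesgue (edge_slice G e A) \<partial>count_space (edges G))"
proof (rule emeasure_measure_of[OF tree_measure_def _ _ _ assms])
  show "{A. A \<subseteq> points G \<and> (\<forall>e\<in>edges G. edge_slice G e A \<in> sets lebesgue)} \<subseteq> Pow (points G)"
    by auto
  show "positive (sets (tree_measure G))
      (\<lambda>A. \<integral>\<^sup>+e. emeasure lebesgue (edge_slice G e A) \<partial>count_space (edges G))"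
    by (simp add: positive_def edge_slice_def)
  show "countably_additive (sets (tree_measure G))
      (\<lambda>A. \<integral>\<^sup>+e. emeasure lebesgue (edge_slice G e A) \<partial>count_space (edges G))"
  proof (rule countably_additiveI)
    fix A :: "nat \<Rightarrow> ('a, 'b) point set"
    assume A: "range A \<subseteq> sets (tree_measure G)" "disjoint_family A"
    have un: "edge_slice G e (\<Union> (range A)) = (\<Union>i. edge_slice G e (A i))" for e
      by (auto simp: edge_slice_def)
    have disj: "disjoint_family (\<lambda>i. edge_slice G e (A i))" for e
      using A(2) unfolding disjoint_family_on_def edge_slice_def by blast
    have ms: "edge_slice G e (A i) \<in> sets lebesgue" if "e \<in> edges G" for e i
      using A(1) that unfolding sets_tree_measure by blast
    have "(\<Sum>i. \<integral>\<^sup>+e. emeasure lebesgue (edge_slice G e (A i)) \<partial>count_space (edges G)) =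
        (\<integral>\<^sup>+e. (\<Sum>i. emeasure lebesgue (edge_slice G e (A i))) \<partial>count_space (edges G))"
      by (subst nn_integral_suminf) auto
    also have "\<dots> = (\<integral>\<^sup>+e. emeasure lebesgue (edge_slice G e (\<Union> (range A))) \<partial>count_space (edges G))"
      unfolding un using ms disj
      by (intro nn_integral_cong suminf_emeasure) auto
    finally show "(\<Sum>i. \<integral>\<^sup>+e. emeasure lebesgue (edge_slice G e (A i)) \<partial>count_space (edges G)) =
        (\<integral>\<^sup>+e. emeasure lebesgue (edge_slice G e (\<Union> (range A))) \<partial>count_space (edges G))" .
  qed
qed

definition L2 :: "'a measure \<Rightarrow> ('a \<Rightarrow> complex) set" where
  "L2 M = {f \<in> borel_measurable M. integrable M (\<lambda>x. (norm (f x))\<^sup>2)}"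

definition L2_inner :: "'a measure \<Rightarrow> ('a \<Rightarrow> complex) \<Rightarrow> ('a \<Rightarrow> complex) \<Rightarrow> complex" where
  "L2_inner M f g = (LINT x|M. f x * cnj (g x))"

definition C1_compact_support :: "real set \<Rightarrow> (real \<Rightarrow> real) \<Rightarrow> bool" where
  "C1_compact_support I \<eta> \<longleftrightarrow>
     (\<forall>x. \<eta> differentiable at x) \<and> continuous_on UNIV (deriv \<eta>) \<and>
     (\<exists>K. compact K \<and> K \<subseteq> I \<and> (\<forall>x. x \<notin> K \<longrightarrow> \<eta> x = 0))"

definition locally_integrable :: "real set \<Rightarrow> (real \<Rightarrow> complex) \<Rightarrow> bool" where
  "locally_integrable I f \<longleftrightarrow> (\<forall>K. compact K \<and> K \<subseteq> I \<longrightarrow> set_integrable lebesgue K f)"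

definition has_weak_derivative :: "real set \<Rightarrow> (real \<Rightarrow> complex) \<Rightarrow> (real \<Rightarrow> complex) \<Rightarrow> bool" where
  "has_weak_derivative I f f' \<longleftrightarrow> locally_integrable I f \<and> locally_integrable I f' \<and>
     (\<forall>\<eta>. C1_compact_support I \<eta> \<longrightarrow>
       (LINT t:I|lebesgue. deriv \<eta> t *\<^sub>R f t) = - (LINT t:I|lebesgue. \<eta> t *\<^sub>R f' t))"

definition is_tree_derivative ::
  "('v, 'e) rooted_graph \<Rightarrow> (('v, 'e) point \<Rightarrow> complex) \<Rightarrow> (('v, 'e) point \<Rightarrow> complex) \<Rightarrow> bool" where
  "is_tree_derivative G \<phi> \<phi>' \<longleftrightarrow>
     (\<forall>e\<in>edges G. has_weak_derivative {t. 0 < t \<and> ereal t < len G e}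
       (\<lambda>t. \<phi> (Inner e t)) (\<lambda>t. \<phi>' (Inner e t)))"

text \<open>Continuity on a locally finite graph is continuity along each closed edge.\<close>

definition continuous_on_tree ::
  "('v, 'e) rooted_graph \<Rightarrow> (('v, 'e) point \<Rightarrow> complex) \<Rightarrow> bool" where
  "continuous_on_tree G \<phi> \<longleftrightarrow>
     (\<forall>e\<in>edges G. continuous_on {t. 0 \<le> t \<and> ereal t \<le> len G e} (\<lambda>t. \<phi> (edge_point G e t)))"

text \<open>
  Functions on the tree are extended by \<open>0\<close> to the values of type \<^typ>\<open>('v, 'e) point\<close> that are not
  points of the tree. By continuity, elements of \<open>H1 G\<close> that agree almost everywhere are then equal.
\<close>

definition H1 :: "('v, 'e) rooted_graph \<Rightarrow> (('v, 'e) point \<Rightarrow> complex) set" where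
  "H1 G = {\<phi>. (\<forall>x. x \<notin> points G \<longrightarrow> \<phi> x = 0) \<and> continuous_on_tree G \<phi> \<and>
     \<phi> \<in> L2 (tree_measure G) \<and> (\<exists>\<phi>'\<in>L2 (tree_measure G). is_tree_derivative G \<phi> \<phi>')}"

text \<open>The choice is unique up to null sets for \<open>\<phi> \<in> H1 G\<close>.\<close>

definition tree_derivative ::
  "('v, 'e) rooted_graph \<Rightarrow> (('v, 'e) point \<Rightarrow> complex) \<Rightarrow> ('v, 'e) point \<Rightarrow> complex" where
  "tree_derivative G \<phi> = (SOME \<phi>'. \<phi>' \<in> L2 (tree_measure G) \<and> is_tree_derivative G \<phi> \<phi>')"

section \<open>Schroedinger operators and Riesz means\<close>

text \<open>
  An operator in \<open>L2 M\<close> is represented by its graph. \<open>form_operator M D h\<close> is the operator \<open>H\<close>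
  associated with a sesquilinear form \<open>h\<close> with domain \<open>D\<close>: \<open>u\<close> is in its domain and \<open>H u = f\<close> iff
  \<open>u \<in> D\<close> and \<open>h u v = L2_inner M f v\<close> for all \<open>v \<in> D\<close>.
\<close>

definition form_operator :: "'a measure \<Rightarrow> ('a \<Rightarrow> complex) set \<Rightarrow>
    (('a \<Rightarrow> complex) \<Rightarrow> ('a \<Rightarrow> complex) \<Rightarrow> complex) \<Rightarrow> (('a \<Rightarrow> complex) \<times> ('a \<Rightarrow> complex)) set" where
  "form_operator M D h = {(u, f). u \<in> D \<and> f \<in> L2 M \<and> (\<forall>v\<in>D. h u v = L2_inner M f v)}"

definition schroedinger_domain ::
  "('v, 'e) rooted_graph \<Rightarrow> (('v, 'e) point \<Rightarrow> real) \<Rightarrow> (('v, 'e) point \<Rightarrow> complex) set" where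
  "schroedinger_domain G V =
     {\<phi> \<in> H1 G. integrable (tree_measure G) (\<lambda>x. V x * (norm (\<phi> x))\<^sup>2)}"

definition schroedinger_form :: "('v, 'e) rooted_graph \<Rightarrow> (('v, 'e) point \<Rightarrow> real) \<Rightarrow>
    (('v, 'e) point \<Rightarrow> complex) \<Rightarrow> (('v, 'e) point \<Rightarrow> complex) \<Rightarrow> complex" where
  "schroedinger_form G V \<phi> \<psi> =
     (LINT x|tree_measure G. tree_derivative G \<phi> x * cnj (tree_derivative G \<psi> x)) -
     (LINT x|tree_measure G. of_real (V x) * \<phi> x * cnj (\<psi> x))"

text \<open>The operator \<open>- \<Delta> - V\<close> with Neumann condition at the root.\<close>

definition schroedinger_operator :: "('v, 'e) rooted_graph \<Rightarrow> (('v, 'e) point \<Rightarrow> real) \<Rightarrow>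
    ((('v, 'e) point \<Rightarrow> complex) \<times> (('v, 'e) point \<Rightarrow> complex)) set" where
  "schroedinger_operator G V =
     form_operator (tree_measure G) (schroedinger_domain G V) (schroedinger_form G V)"

interpretation cfun: vector_space "\<lambda>(c::complex) (f::'a \<Rightarrow> complex) x. c * f x"
  by unfold_locales (auto simp: fun_eq_iff algebra_simps)

definition eigenspace ::
  "(('a \<Rightarrow> complex) \<times> ('a \<Rightarrow> complex)) set \<Rightarrow> real \<Rightarrow> ('a \<Rightarrow> complex) set" where
  "eigenspace H \<mu> = {u. (u, \<lambda>x. of_real \<mu> * u x) \<in> H}"

text \<open>The dimension of the eigenspace, \<open>\<infinity>\<close> if it is infinite (where \<open>cfun.dim\<close> would be \<open>0\<close>).\<close>

definition multiplicity_of ::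
  "(('a \<Rightarrow> complex) \<times> ('a \<Rightarrow> complex)) set \<Rightarrow> real \<Rightarrow> ennreal" where
  "multiplicity_of H \<mu> =
     (SUP B\<in>{B. finite B \<and> B \<subseteq> eigenspace H \<mu> \<and> cfun.independent B}. of_nat (card B))"

definition trace_neg ::
  "(('a \<Rightarrow> complex) \<times> ('a \<Rightarrow> complex)) set \<Rightarrow> real \<Rightarrow> ennreal" where
  "trace_neg H \<gamma> =
     (\<integral>\<^sup>+\<mu>. multiplicity_of H \<mu> * ennreal (\<bar>\<mu>\<bar> powr \<gamma>) \<partial>count_space {..<0})"

definition decays_at_infinity ::
  "('v, 'e) rooted_graph \<Rightarrow> (('v, 'e) point \<Rightarrow> real) \<Rightarrow> bool" where
  "decays_at_infinity G V \<longleftrightarrow>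
     (\<forall>\<epsilon>>0. \<exists>R. AE x in tree_measure G. R < root_dist G x \<longrightarrow> \<bar>V x\<bar> < \<epsilon>)"

end

theory Submission
  imports Defs
begin

text \<open>
  Let \<open>N(E)\<close> be the number of eigenvalues below \<open>- 2 E\<close>. On the span of the eigenfunctions the form of
  \<open>- \<Delta> + E\<close> is at most \<open>\<integral>(V - E)\<^sub>+ |u|\<^sup>2\<close>, so the trace of the Birman-Schwinger operator gives
  \<open>N(E) \<le> \<integral>(V(x) - E)\<^sub>+ G(x) dx\<close>, where \<open>G(x)\<close> is the diagonal of the resolvent kernel at \<open>- E\<close>.
  Comparing \<open>u(x)\<close> with its averages over all forward paths of length \<open>E powr (- 1/2)\<close> bounds \<open>G(x)\<close> by a
  multiple of \<open>(1 + |x|) powr \<delta> * E powr (- (1 - \<delta>)/2)\<close>; the growth of the branching function enters here.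
  Integrating \<open>N(E)\<close> against \<open>E powr (\<gamma> - 1)\<close> gives the inequality for \<open>\<gamma> > (1 - a)/2\<close> with \<open>\<delta> = a\<close>.
  At \<open>\<gamma> = (1 - a)/2\<close> one combines two values of \<open>\<delta>\<close> if \<open>0 < a < 1\<close>, and \<open>a = 1\<close> is the bound on the
  number of eigenvalues. For \<open>a = 0\<close> the tree is cut at its vertices into infinite rays, which only lowers
  the operator, and every ray is cut into intervals \<open>J\<close> with \<open>|J| \<integral>\<^sub>J V = 1/2\<close> (Weidl). With a Dirichlet
  condition at its left end \<open>J\<close> carries no negative eigenvalue, and without it none below
  \<open>- 4 (\<integral>\<^sub>J V)\<^sup>2\<close>, so \<open>N(E)\<close> is at most the number of intervals with \<open>4 (\<integral>\<^sub>J V)\<^sup>2 > E\<close>.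
\<close>

section \<open>Functions with an integrable derivative\<close>

text \<open>No spectral theory enters. \<open>trace_neg\<close> is a sum of multiplicities, each a
  supremum over finite independent sets, so it suffices to treat finite families of eigenfunctions
  with bounds uniform in the family. Of the distance \<open>2 E\<close> below zero, one half turns V
  into V - E, which confines the integral over E to E below V, and the other half makes the form of
  - \<Delta> + E positive definite. Two obstacles shape the proof. Independence in an eigenspace
  concerns functions, whereas the forms see only classes modulo null sets; and
  \<open>tree_derivative\<close> is a choice that need not be linear. Hence the estimates are stated
  for pairs of a function and a derivative related by integration along rays, and the pointwise
  bound for G(x) serves a second time, to turn a function of norm and energy zero into the zero
  function. Along a single path one would get only the one-dimensional bound E^(-1/2). The gain
  comes from weighting a path by the number of branches, since the resistance of the forward tree is
  the integral of the reciprocal of that number.\<close>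

lemma borel_measurable_lebesgueI: "f \<in> borel_measurable borel \<Longrightarrow> f \<in> borel_measurable lebesgue"
  by (intro measurable_completion) (simp only: measurable_lborel2)

text \<open>Local absolute continuity of \<open>u\<close> with derivative \<open>g\<close>, in
  integrated form. Only compact subintervals are mentioned, so \<open>S\<close> may be a half-line
  on which \<open>g\<close> is not integrable.\<close>

definition primitive_on :: "real set \<Rightarrow> (real \<Rightarrow> complex) \<Rightarrow> (real \<Rightarrow> complex) \<Rightarrow> bool" where
  "primitive_on S u g \<longleftrightarrow> (\<forall>s\<in>S. \<forall>t\<in>S. s \<le> t \<longrightarrow>
     set_integrable lebesgue {s..t} g \<and> (LINT x:{s..t}|lebesgue. g x) = u t - u s)"

lemma primitive_on_subset: "primitive_on S u g \<Longrightarrow> T \<subseteq> S \<Longrightarrow> primitive_on T u g"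
  unfolding primitive_on_def subset_iff by simp

lemma primitive_on_continuous:
  assumes "primitive_on {a..b} u g"
  shows "continuous_on {a..b} u"
proof (cases "a \<le> b")
  case True
  have int: "set_integrable lebesgue {a..t} g \<and> (LINT x:{a..t}|lebesgue. g x) = u t - u a"
    if "t \<in> {a..b}" for t
  proof -
    have "a \<in> {a..b}" "a \<le> t" using that True by auto
    then show ?thesis using assms that unfolding primitive_on_def by blast
  qed
  have eq: "u t = u a + integral {a..t} g" if "t \<in> {a..b}" for t
  proof -
    have "integral {a..t} g = u t - u a"
      using int[OF that] set_lebesgue_integral_eq_integral(2)[of "{a..t}" g] by argo
    then show ?thesis by (simp only: diff_add_cancel add.commute[of "u a"])
  qed
  have "set_integrable lebesgue {a..b} g" using int[of b] True by simp
  then have "g integrable_on {a..b}" by (rule set_lebesgue_integral_eq_integral(1))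
  then have "continuous_on {a..b} (\<lambda>t. u a + integral {a..t} g)"
    by (rule continuous_on_add[OF continuous_on_const indefinite_integral_continuous_1])
  then show ?thesis by (simp only: continuous_on_cong[OF refl eq])
qed auto

lemma primitive_on_increment:
  assumes "primitive_on {a..b} u g" "s \<in> {a..b}" "t \<in> {a..b}"
  shows "ennreal (norm (u t - u s)) \<le> (\<integral>\<^sup>+x\<in>{a..b}. ennreal (norm (g x)) \<partial>lebesgue)"
proof -
  have *: "ennreal (norm (u t - u s)) \<le> (\<integral>\<^sup>+x\<in>{a..b}. ennreal (norm (g x)) \<partial>lebesgue)"
    if "s \<in> {a..b}" "t \<in> {a..b}" "s \<le> t" for s t
  proof -
    have i: "set_integrable lebesgue {s..t} g" "u t - u s = (LINT x:{s..t}|lebesgue. g x)"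
      using assms(1) that unfolding primitive_on_def by auto
    have "ennreal (norm (u t - u s)) \<le> (\<integral>\<^sup>+x. norm (indicator {s..t} x *\<^sub>R g x) \<partial>lebesgue)"
      unfolding i(2) set_lebesgue_integral_def
      by (rule integral_norm_bound_ennreal) (use i(1) in \<open>simp add: set_integrable_def\<close>)
    also have "\<dots> \<le> (\<integral>\<^sup>+x\<in>{a..b}. ennreal (norm (g x)) \<partial>lebesgue)"
      using that by (intro nn_integral_mono) (auto split: split_indicator)
    finally show ?thesis .
  qed
  show ?thesis
    using *[OF assms(2,3)] *[OF assms(3,2)] by (cases "s \<le> t") (auto simp: norm_minus_commute)
qed

lemma primitive_on_measurable:
  assumes "primitive_on {a..b} u g"
  shows "set_borel_measurable lebesgue {a..b} u" "set_borel_measurable lebesgue {a..b} g"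
proof -
  show "set_borel_measurable lebesgue {a..b} u"
    unfolding set_borel_measurable_def
    using borel_measurable_continuous_on_indicator[OF _ primitive_on_continuous[OF assms]]
    by (auto intro: measurable_completion)
  show "set_borel_measurable lebesgue {a..b} g"
  proof (cases "a \<le> b")
    case True
    then have "set_integrable lebesgue {a..b} g" using assms unfolding primitive_on_def by auto
    then show ?thesis
      unfolding set_integrable_def set_borel_measurable_def by (rule borel_measurable_integrable)
  qed (auto simp: set_borel_measurable_def)
qed

text \<open>Write |f| as \<open>sqrt (1 / n)\<close> times \<open>sqrt n * |f|\<close>. On the tree
  the weight \<open>n\<close> is a branching number, and the integral of \<open>1 / n\<close> is
  then a resistance.\<close>

lemma Cauchy_Schwarz_weighted:
  fixes f :: "real \<Rightarrow> complex" and n :: "real \<Rightarrow> real"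
  assumes f: "set_borel_measurable lebesgue A f" and [measurable]: "n \<in> borel_measurable lebesgue" "A \<in> sets lebesgue"
    and n: "\<And>x. x \<in> A \<Longrightarrow> 0 < n x"
  shows "(\<integral>\<^sup>+x\<in>A. ennreal (norm (f x)) \<partial>lebesgue)\<^sup>2 \<le>
    (\<integral>\<^sup>+x\<in>A. ennreal (1 / n x) \<partial>lebesgue) * (\<integral>\<^sup>+x\<in>A. ennreal (n x * (norm (f x))\<^sup>2) \<partial>lebesgue)"
proof -
  define h where "h x = indicator A x *\<^sub>R f x" for x
  have [measurable]: "h \<in> borel_measurable lebesgue"
    using f unfolding h_def set_borel_measurable_def .
  define p where "p x = ennreal (sqrt (1 / n x)) * indicator A x" for x
  define q where "q x = ennreal (sqrt (n x) * norm (h x)) * indicator A x" for x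
  have m: "p \<in> borel_measurable lebesgue" "q \<in> borel_measurable lebesgue"
    unfolding p_def q_def by measurable
  have pq: "p x * q x = ennreal (norm (f x)) * indicator A x" for x
    using n[of x] by (auto simp: p_def q_def h_def ennreal_mult'[symmetric] real_sqrt_divide split: split_indicator)
  have pp: "(p x)\<^sup>2 = ennreal (1 / n x) * indicator A x" for x
    using n[of x] by (auto simp: p_def power2_eq_square ennreal_mult'[symmetric] split: split_indicator)
  have qq: "(q x)\<^sup>2 = ennreal (n x * (norm (f x))\<^sup>2) * indicator A x" for x
  proof (cases "x \<in> A")
    case True
    have "sqrt (n x) * norm (h x) * (sqrt (n x) * norm (h x)) = n x * (norm (f x))\<^sup>2"
      using n[OF True] True by (simp add: h_def power2_eq_square)
    then show ?thesis using True n[of x]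
      by (simp add: q_def power2_eq_square ennreal_mult'[symmetric])
  qed (simp add: q_def)
  show ?thesis
    using Cauchy_Schwarz_nn_integral[OF m] unfolding pq pp qq .
qed

lemma ennreal_add_power2_le:
  fixes x y :: ennreal shows "(x + y)\<^sup>2 \<le> 2 * x\<^sup>2 + 2 * y\<^sup>2"
proof (cases x; cases y)
  fix r s assume "x = ennreal r" "0 \<le> r" "y = ennreal s" "0 \<le> s"
  moreover have "(r + s)\<^sup>2 \<le> 2 * r\<^sup>2 + 2 * s\<^sup>2"
    using sum_squares_bound[of r s] by (simp add: power2_sum)
  ultimately show ?thesis
    by (simp add: ennreal_power ennreal_numeral[symmetric] ennreal_mult'[symmetric] ennreal_plus[symmetric] del: ennreal_numeral ennreal_plus)
qed (auto simp: power2_eq_square ennreal_mult_top ennreal_top_mult)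

text \<open>For every x in the interval, |u(p)| is at most |u(x)| plus the integral of |g|.
  Averaging over x, squaring, and the weighted Cauchy-Schwarz inequality bring in the two energies;
  the factor 2 is that of \<open>ennreal_add_power2_le\<close>.\<close>

lemma primitive_on_pointwise_bound:
  fixes n :: "real \<Rightarrow> real"
  assumes u: "primitive_on {a..b} u g" and ab: "a < b" and p: "p \<in> {a..b}"
    and n: "n \<in> borel_measurable lebesgue" "\<And>x. x \<in> {a..b} \<Longrightarrow> 0 < n x"
  shows "ennreal ((norm (u p))\<^sup>2) \<le> 2 * (\<integral>\<^sup>+x\<in>{a..b}. ennreal (1 / n x) \<partial>lebesgue) *
    (ennreal (1 / (b - a)\<^sup>2) * (\<integral>\<^sup>+x\<in>{a..b}. ennreal (n x * (norm (u x))\<^sup>2) \<partial>lebesgue) +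
     (\<integral>\<^sup>+x\<in>{a..b}. ennreal (n x * (norm (g x))\<^sup>2) \<partial>lebesgue))"
proof -
  define L where "L = b - a"
  have L: "L > 0" using ab by (simp add: L_def)
  define P where "P = (\<integral>\<^sup>+x\<in>{a..b}. ennreal (1 / n x) \<partial>lebesgue)"
  define X where "X = (\<integral>\<^sup>+x\<in>{a..b}. ennreal (norm (u x)) \<partial>lebesgue)"
  define Y where "Y = (\<integral>\<^sup>+x\<in>{a..b}. ennreal (norm (g x)) \<partial>lebesgue)"
  define U where "U = (\<integral>\<^sup>+x\<in>{a..b}. ennreal (n x * (norm (u x))\<^sup>2) \<partial>lebesgue)"
  define W where "W = (\<integral>\<^sup>+x\<in>{a..b}. ennreal (n x * (norm (g x))\<^sup>2) \<partial>lebesgue)"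
  note meas = primitive_on_measurable[OF u]
  have mX: "(\<lambda>x. ennreal (norm (u x)) * indicator {a..b} x) \<in> borel_measurable lebesgue"
  proof -
    define h where "h x = indicator {a..b} x *\<^sub>R u x" for x
    have [measurable]: "h \<in> borel_measurable lebesgue"
      using meas(1) by (simp add: set_borel_measurable_def h_def[abs_def])
    have "(\<lambda>x. ennreal (norm (u x)) * indicator {a..b} x) = (\<lambda>x. ennreal (norm (h x)))"
      by (auto simp: h_def split: split_indicator)
    then show ?thesis by simp
  qed
  have X2: "X\<^sup>2 \<le> P * U" and Y2: "Y\<^sup>2 \<le> P * W"
    unfolding X_def Y_def P_def U_def W_def
    by (rule Cauchy_Schwarz_weighted; use meas n in auto)+
  have "ennreal L * ennreal (norm (u p)) = (\<integral>\<^sup>+x\<in>{a..b}. ennreal (norm (u p)) \<partial>lebesgue)"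
    using L by (simp add: nn_integral_cmult_indicator L_def ab less_imp_le mult.commute)
  also have "\<dots> \<le> (\<integral>\<^sup>+x. ennreal (norm (u x)) * indicator {a..b} x + Y * indicator {a..b} x \<partial>lebesgue)"
  proof (intro nn_integral_mono)
    fix x
    have "ennreal (norm (u p)) \<le> ennreal (norm (u x)) + Y" if "x \<in> {a..b}"
    proof -
      have "norm (u p) \<le> norm (u x) + norm (u p - u x)"
        using norm_triangle_sub by blast
      then have "ennreal (norm (u p)) \<le> ennreal (norm (u x)) + ennreal (norm (u p - u x))"
        by (simp add: ennreal_plus[symmetric] del: ennreal_plus)
      also have "\<dots> \<le> ennreal (norm (u x)) + Y"
        unfolding Y_def by (intro add_left_mono primitive_on_increment[OF u that p])
      finally show ?thesis .
    qed
    then show "ennreal (norm (u p)) * indicator {a..b} x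
        \<le> ennreal (norm (u x)) * indicator {a..b} x + Y * indicator {a..b} x"
      by (auto split: split_indicator)
  qed
  also have "\<dots> = X + Y * ennreal L"
    using mX ab by (subst nn_integral_add) (auto simp: X_def nn_integral_cmult_indicator L_def less_imp_le intro!: borel_measurable_times_ennreal borel_measurable_indicator)
  finally have "(ennreal L * ennreal (norm (u p)))\<^sup>2 \<le> (X + Y * ennreal L)\<^sup>2"
    by (intro power_mono) auto
  also have "\<dots> \<le> 2 * X\<^sup>2 + 2 * (Y * ennreal L)\<^sup>2" by (rule ennreal_add_power2_le)
  also have "\<dots> \<le> 2 * (P * U) + 2 * ((P * W) * (ennreal L)\<^sup>2)"
    using X2 Y2 by (intro add_mono mult_left_mono) (auto simp: power_mult_distrib intro!: mult_right_mono)
  finally have "ennreal (1 / L\<^sup>2) * (ennreal L * ennreal (norm (u p)))\<^sup>2 \<le>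
      ennreal (1 / L\<^sup>2) * (2 * (P * U) + 2 * ((P * W) * (ennreal L)\<^sup>2))"
    by (intro mult_left_mono) auto
  also have "ennreal (1 / L\<^sup>2) * (ennreal L * ennreal (norm (u p)))\<^sup>2 = ennreal ((norm (u p))\<^sup>2)"
    using L by (simp add: power_mult_distrib ennreal_power ennreal_mult'[symmetric])
  also have "ennreal (1 / L\<^sup>2) * (2 * (P * U) + 2 * ((P * W) * (ennreal L)\<^sup>2)) =
     2 * P * (ennreal (1 / L\<^sup>2) * U) + 2 * P * W * (ennreal (1 / L\<^sup>2) * ennreal (L\<^sup>2))"
    using L by (simp add: distrib_left ac_simps ennreal_power)
  also have "ennreal (1 / L\<^sup>2) * ennreal (L\<^sup>2) = 1"
    using L by (simp add: ennreal_mult'[symmetric])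
  finally show ?thesis
    unfolding P_def U_def W_def L_def by (simp add: distrib_left ac_simps)
qed

section \<open>C1 test functions and the fundamental theorem of calculus for weak
  derivatives\<close>

definition ramp :: "real \<Rightarrow> real" where
  "ramp x = ((max 0 x)\<^sup>2 - 2 * (max 0 (x - 1))\<^sup>2 + (max 0 (x - 2))\<^sup>2) / 2"

text \<open>The hat function of mass 1 on [0, 2], which is the derivative of \<open>ramp\<close>.
  Test functions need only be C1, so the piecewise quadratic step \<open>ramp\<close> from 0 to 1
  takes the place of a smooth mollifier.\<close>

definition tent :: "real \<Rightarrow> real" where
  "tent x = max 0 x - 2 * max 0 (x - 1) + max 0 (x - 2)"

lemma has_real_derivative_max0_power2:
  "((\<lambda>x::real. (max 0 x)\<^sup>2) has_real_derivative 2 * max 0 x) (at x)"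
proof -
  consider "x > 0" | "x < 0" | "x = 0" by linarith
  then show ?thesis
  proof cases
    case 1
    have "((\<lambda>x. x\<^sup>2) has_real_derivative 2 * max 0 x) (at x)"
      using 1 by (auto intro!: derivative_eq_intros)
    then show ?thesis
      by (rule has_field_derivative_transform_within_open[where S = "{0<..}"]) (use 1 in auto)
  next
    case 2
    have "((\<lambda>x. 0) has_real_derivative 2 * max 0 x) (at x)" using 2 by simp
    then show ?thesis
      by (rule has_field_derivative_transform_within_open[where S = "{..<0}"]) (use 2 in auto)
  next
    case 3
    have "(\<lambda>h. ((max 0 h)\<^sup>2) / h) \<midarrow>0\<rightarrow> (0::real)"
    proof (rule Lim_null_comparison)
      show "\<forall>\<^sub>F h in at 0. norm ((max 0 h)\<^sup>2 / h) \<le> \<bar>h::real\<bar>"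
        by (intro always_eventually) (auto simp: max_def power2_eq_square abs_mult)
      show "(\<lambda>h::real. \<bar>h\<bar>) \<midarrow>0\<rightarrow> 0" by (auto intro!: tendsto_eq_intros)
    qed
    then show ?thesis using 3 by (simp add: has_field_derivative_iff)
  qed
qed

lemma ramp_derivative: "(ramp has_real_derivative tent x) (at x)"
proof -
  have shift: "((\<lambda>x. (max 0 (x - c))\<^sup>2) has_real_derivative 2 * max 0 (x - c)) (at x)" for c
    using DERIV_shift[of "\<lambda>x. (max 0 x)\<^sup>2" "2 * max 0 (x - c)" x "- c"]
      has_real_derivative_max0_power2[of "x - c"] by simp
  show ?thesis
    unfolding ramp_def[abs_def] tent_def
    using DERIV_cdivide[OF DERIV_add[OF DERIV_diff[OF shift[of 0] DERIV_cmult[OF shift[of 1], of 2]]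
      shift[of 2]], of 2]
    by (simp only: diff_0_right) (simp add: add_divide_distrib diff_divide_distrib)
qed

lemma ramp_eq_0: "x \<le> 0 \<Longrightarrow> ramp x = 0"
  by (simp add: ramp_def max_def)

lemma ramp_eq_1: "2 \<le> x \<Longrightarrow> ramp x = 1"
  by (simp add: ramp_def max_def power2_eq_square algebra_simps)

lemma tent_nonneg: "0 \<le> tent x"
  by (auto simp: tent_def max_def)

lemma tent_eq_0: "x \<le> 0 \<or> 2 \<le> x \<Longrightarrow> tent x = 0"
  by (auto simp: tent_def max_def)

lemma ramp_mono: "x \<le> y \<Longrightarrow> ramp x \<le> ramp y"
  by (rule DERIV_nonneg_imp_nondecreasing) (use ramp_derivative tent_nonneg in blast)+

lemma ramp_bounds: "0 \<le> ramp x" "ramp x \<le> 1"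
proof -
  show "0 \<le> ramp x" using ramp_mono[of "min x 0" x] ramp_eq_0[of "min x 0"] by simp
  show "ramp x \<le> 1" using ramp_mono[of x "max x 2"] ramp_eq_1[of "max x 2"] by simp
qed

lemma continuous_on_tent: "continuous_on A tent"
  unfolding tent_def[abs_def] by (intro continuous_intros)

lemma has_real_derivative_scaled_ramp:
  "((\<lambda>x. ramp (n * (x - s))) has_real_derivative n * tent (n * (x - s))) (at x)"
proof -
  have "((\<lambda>x. n * (x - s)) has_real_derivative n) (at x)"
    by (auto intro!: derivative_eq_intros)
  from DERIV_chain2[OF ramp_derivative this] show ?thesis by (simp add: mult.commute)
qed

text \<open>The kernel has mass 1 and lives between s and s + 2/n: an approximate identity that
  looks only to the right of \<open>s\<close>, so that continuity on \<open>{s..b}\<close> is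
  enough.\<close>

lemma tent_kernel_tendsto:
  fixes f :: "real \<Rightarrow> complex"
  assumes f: "continuous_on {s..b} f" and sb: "s < b"
  shows "(\<lambda>m. integral {s..b} (\<lambda>x. (real (Suc m) * tent (real (Suc m) * (x - s))) *\<^sub>R f x)) \<longlonglongrightarrow> f s"
proof (rule LIMSEQ_I)
  fix e :: real assume e: "0 < e"
  obtain d where d: "d > 0" "\<And>x. x \<in> {s..b} \<Longrightarrow> dist x s < d \<Longrightarrow> dist (f x) (f s) < e / 2"
    using f sb e unfolding continuous_on_iff by (metis atLeastAtMost_iff half_gt_zero less_le order_refl)
  define d' where "d' = min d (b - s)"
  have d': "d' > 0" using d sb by (simp add: d'_def)
  \<comment> \<open>Beyond this index the kernel vanishes at distance \<open>d'\<close> or more from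
    \<open>s\<close>.\<close>
  obtain N where N: "2 / d' < real N" using reals_Archimedean2 by blast
  show "\<exists>N. \<forall>m\<ge>N. norm (integral {s..b} (\<lambda>x. (real (Suc m) * tent (real (Suc m) * (x - s))) *\<^sub>R f x) - f s) < e"
  proof (intro exI allI impI)
    fix m assume "N \<le> m"
    define n where "n = real (Suc m)"
    have n: "n > 0" "2 < n * d'" using N \<open>N \<le> m\<close> d' by (auto simp: n_def field_simps)
        (smt (verit, best) mult_right_mono of_nat_le_iff mult.commute)
    define k where "k x = n * tent (n * (x - s))" for x
    have k0: "k x \<ge> 0" for x using n tent_nonneg by (simp add: k_def)
    have kc: "continuous_on A k" for A unfolding k_def
      by (intro continuous_intros continuous_on_compose2[OF continuous_on_tent[of UNIV]]) auto
    have "(k has_integral (ramp (n * (b - s)) - ramp (n * (s - s)))) {s..b}"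
      unfolding k_def using sb has_real_derivative_scaled_ramp[of n s]
      by (intro fundamental_theorem_of_calculus)
        (auto simp: has_real_derivative_iff_has_vector_derivative[symmetric] intro: has_field_derivative_at_within)
    moreover have "2 \<le> n * (b - s)"
      using n mult_left_mono[of d' "b - s" n] unfolding d'_def by linarith
    ultimately have k1: "(k has_integral 1) {s..b}" by (simp add: ramp_eq_0 ramp_eq_1)
    have int: "(\<lambda>x. k x *\<^sub>R f x) integrable_on {s..b}"
      by (intro integrable_continuous_interval continuous_intros kc f)
    have c1: "((\<lambda>x. k x *\<^sub>R f s) has_integral f s) {s..b}"
      using has_integral_scaleR_left[OF k1, of "f s"] by simp
    have "integral {s..b} (\<lambda>x. k x *\<^sub>R f x) - f s = integral {s..b} (\<lambda>x. k x *\<^sub>R f x - k x *\<^sub>R f s)"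
      using int c1 by (subst integral_diff) (auto simp: integrable_on_def integral_unique)
    also have "norm \<dots> \<le> integral {s..b} (\<lambda>x. k x * (e / 2))"
    proof (rule integral_norm_bound_integral)
      show "(\<lambda>x. k x *\<^sub>R f x - k x *\<^sub>R f s) integrable_on {s..b}"
        using int c1 by (intro integrable_diff) (auto simp: integrable_on_def)
      show "(\<lambda>x. k x * (e / 2)) integrable_on {s..b}"
        using has_integral_mult_left[OF k1, of "e / 2"] by (auto simp: integrable_on_def)
      fix x assume x: "x \<in> {s..b}"
      show "norm (k x *\<^sub>R f x - k x *\<^sub>R f s) \<le> k x * (e / 2)"
      proof (cases "dist x s < d")
        case True
        then have "norm (f x - f s) \<le> e / 2" using d(2)[OF x] by (simp add: dist_norm)
        then have "k x * norm (f x - f s) \<le> k x * (e / 2)" using k0 by (intro mult_left_mono)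
        then show ?thesis using k0[of x] by (simp add: scaleR_diff_right[symmetric])
      next
        case False
        then have "d' \<le> x - s" using x by (auto simp: d'_def dist_real_def)
        then have "2 \<le> n * (x - s)" using n mult_left_mono[of d' "x - s" n] by linarith
        then show ?thesis by (simp add: k_def tent_eq_0)
      qed
    qed
    also have "\<dots> = e / 2" using has_integral_mult_left[OF k1, of "e / 2"] by (metis integral_unique mult_1)
    also have "\<dots> < e" using e by simp
    finally show "norm (integral {s..b} (\<lambda>x. (real (Suc m) * tent (real (Suc m) * (x - s))) *\<^sub>R f x) - f s) < e"
      by (simp add: k_def n_def)
  qed
qed

lemma set_lebesgue_integral_restrict:
  fixes h :: "real \<Rightarrow> complex"
  assumes "K \<subseteq> I" "\<And>x. x \<in> I \<Longrightarrow> x \<notin> K \<Longrightarrow> h x = 0"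
  shows "(LINT x:I|lebesgue. h x) = (LINT x:K|lebesgue. h x)"
  unfolding set_lebesgue_integral_def
  using assms by (intro Bochner_Integration.integral_cong) (auto split: split_indicator)

text \<open>The weak equation is tested with a steep ramp at \<open>s\<close> minus a steep ramp at
  \<open>t\<close>. The derivative is a difference of two tent kernels and yields
  \<open>f s - f t\<close>; the test function itself is bounded by 1 and tends to the indicator of
  \<open>{s<..t}\<close>, so dominated convergence yields the integral of \<open>f'\<close>.\<close>

lemma weak_derivative_increment:
  assumes w: "has_weak_derivative I f f'" and cont: "continuous_on I f"
    and I: "I = {a<..<b}" and s: "a < s" and st: "s < t" and t: "t < b"
  shows "set_integrable lebesgue {s..t} f' \<and> (LINT x:{s..t}|lebesgue. f' x) = f t - f s"
proof -
  \<comment> \<open>The ramp at \<open>t\<close> rises only to the right of \<open>t\<close>, so the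
    support of the test function needs some room before \<open>b\<close>; for large \<open>m\<close>
    it stays within \<open>{s..t'}\<close>.\<close>
  define t' where "t' = (t + b) / 2"
  have t': "t < t'" "t' < b" using t by (auto simp: t'_def field_simps)
  let ?K = "{s..t'}"
  have KI: "?K \<subseteq> I" using I s t' by auto
  have "set_integrable lebesgue ?K f'"
    using w KI unfolding has_weak_derivative_def locally_integrable_def by auto
  then have f'K: "integrable lebesgue (\<lambda>x. indicator ?K x *\<^sub>R f' x)"
    by (simp add: set_integrable_def)
  obtain N where N: "2 / (t' - t) < real N" using reals_Archimedean2 by blast
  define eta where "eta m x = ramp (real (Suc m) * (x - s)) - ramp (real (Suc m) * (x - t))" for m x
  define eta' where "eta' m x = real (Suc m) * tent (real (Suc m) * (x - s))
      - real (Suc m) * tent (real (Suc m) * (x - t))" for m x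
  have der: "(eta m has_real_derivative eta' m x) (at x)" for m x
    unfolding eta_def[abs_def] eta'_def by (intro DERIV_diff has_real_derivative_scaled_ramp)
  have deriv_eta: "deriv (eta m) = eta' m" for m
    using der DERIV_imp_deriv by blast
  have cont': "continuous_on A (eta' m)" for A m
    unfolding eta'_def[abs_def]
    by (intro continuous_intros continuous_on_compose2[OF continuous_on_tent[of UNIV]]) auto
  have big: "2 \<le> real (Suc m) * (x - t)" if "N \<le> m" "t' \<le> x" for m x
  proof -
    have "2 < real N * (t' - t)" using N t' by (simp add: field_simps)
    also have "\<dots> \<le> real (Suc m) * (x - t)"
      using that t' by (intro mult_mono) auto
    finally show ?thesis by simp
  qed
  have outside: "eta m x = 0" "eta' m x = 0" if "N \<le> m" "x \<notin> ?K" for m x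
  proof -
    have "x < s \<or> t' < x" using that(2) by auto
    then have "eta m x = 0 \<and> eta' m x = 0"
    proof
      assume "x < s"
      then have "real (Suc m) * (x - s) \<le> 0" "real (Suc m) * (x - t) \<le> 0"
        using st by (auto simp: mult_le_0_iff)
      then show ?thesis by (auto simp: eta_def eta'_def ramp_eq_0 tent_eq_0)
    next
      assume x: "t' < x"
      have "2 \<le> real (Suc m) * (x - t)" using big that(1) x by simp
      moreover have "real (Suc m) * (x - t) \<le> real (Suc m) * (x - s)"
        using st by (intro mult_left_mono) auto
      ultimately have "2 \<le> real (Suc m) * (x - t)" "2 \<le> real (Suc m) * (x - s)" by linarith+
      then show ?thesis by (auto simp: eta_def eta'_def ramp_eq_1 tent_eq_0)
    qed
    then show "eta m x = 0" "eta' m x = 0" by auto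
  qed
  have test: "C1_compact_support I (eta m)" if "N \<le> m" for m
    unfolding C1_compact_support_def deriv_eta
  proof (intro conjI allI exI[of _ ?K])
    show "eta m differentiable at x" for x
      using der[of m x] by (auto simp: real_differentiable_def)
  qed (use KI cont' outside[OF that] in auto)
  have "(LINT x:I|lebesgue. eta' m x *\<^sub>R f x) = - (LINT x:I|lebesgue. eta m x *\<^sub>R f' x)" if "N \<le> m" for m
    using w test[OF that] unfolding has_weak_derivative_def by (metis deriv_eta)
  moreover have "(LINT x:I|lebesgue. eta' m x *\<^sub>R f x) = (LINT x:?K|lebesgue. eta' m x *\<^sub>R f x)"
      "(LINT x:I|lebesgue. eta m x *\<^sub>R f' x) = (LINT x:?K|lebesgue. eta m x *\<^sub>R f' x)" if "N \<le> m" for m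
    using outside[OF that] KI by (auto intro!: set_lebesgue_integral_restrict)
  ultimately have weak: "(LINT x:?K|lebesgue. eta' m x *\<^sub>R f x) = - (LINT x:?K|lebesgue. eta m x *\<^sub>R f' x)" if "N \<le> m" for m
    using that by simp
  have fK: "continuous_on ?K f" using cont KI continuous_on_subset by blast
  have left: "(\<lambda>m. LINT x:?K|lebesgue. eta' m x *\<^sub>R f x) \<longlonglongrightarrow> f s - f t"
  proof -
    define J where "J c m x = (real (Suc m) * tent (real (Suc m) * (x - c))) *\<^sub>R f x" for c m x
    have Jc: "continuous_on ?K (J c m)" for c m
      unfolding J_def[abs_def]
      by (intro continuous_intros fK continuous_on_compose2[OF continuous_on_tent[of UNIV]]) auto
    have "(LINT x:?K|lebesgue. eta' m x *\<^sub>R f x) = integral ?K (J s m) - integral {t..t'} (J t m)" for m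
    proof -
      have "(LINT x:?K|lebesgue. eta' m x *\<^sub>R f x) = integral ?K (\<lambda>x. eta' m x *\<^sub>R f x)"
        using absolutely_integrable_continuous[of s t' "\<lambda>x. eta' m x *\<^sub>R f x"]
        by (intro set_lebesgue_integral_eq_integral(2)) (auto intro!: continuous_intros cont' fK)
      also have "\<dots> = integral ?K (\<lambda>x. J s m x - J t m x)"
        by (intro integral_cong) (auto simp: eta'_def J_def scaleR_diff_left)
      also have "\<dots> = integral ?K (J s m) - integral ?K (J t m)"
        by (intro integral_diff integrable_continuous_interval Jc)
      also have "integral ?K (J t m) = integral {s..t} (J t m) + integral {t..t'} (J t m)"
        using st t' integrable_continuous_interval[OF Jc[of t m]]
        by (intro Henstock_Kurzweil_Integration.integral_combine[symmetric]) auto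
      also have "integral {s..t} (J t m) = integral {s..t} (\<lambda>_. 0)"
        by (intro integral_cong) (auto simp: J_def tent_eq_0 mult_le_0_iff)
      finally show ?thesis by (simp only: integral_0 add_0_left)
    qed
    moreover have "(\<lambda>m. integral ?K (J s m)) \<longlonglongrightarrow> f s"
      unfolding J_def[abs_def] by (rule tent_kernel_tendsto) (use fK st t' in auto)
    moreover have "(\<lambda>m. integral {t..t'} (J t m)) \<longlonglongrightarrow> f t"
      unfolding J_def[abs_def] by (rule tent_kernel_tendsto)
        (use fK st t' in \<open>auto intro: continuous_on_subset\<close>)
    ultimately show ?thesis by (auto intro!: tendsto_diff)
  qed
  \<comment> \<open>Each ramp is still 0 at its starting point, hence the limit is the indicator of
    a half-open interval.\<close>
  define g where "g x = indicator {s<..t} x *\<^sub>R f' x" for x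
  have g1: "set_integrable lebesgue {s..t} f'"
    using w KI t' unfolding has_weak_derivative_def locally_integrable_def
    by (meson atLeastatMost_subset_iff compact_Icc less_le order_trans order_refl)
  have right: "(\<lambda>m. LINT x:?K|lebesgue. eta m x *\<^sub>R f' x) \<longlonglongrightarrow> (LINT x|lebesgue. g x)"
    unfolding set_lebesgue_integral_def
  proof (rule integral_dominated_convergence[where w = "\<lambda>x. norm (indicator ?K x *\<^sub>R f' x)"])
    have f'm: "(\<lambda>x. indicator ?K x *\<^sub>R f' x) \<in> borel_measurable lebesgue"
      using f'K by (rule borel_measurable_integrable)
    have "g = (\<lambda>x. indicator {s<..t} x *\<^sub>R (indicator ?K x *\<^sub>R f' x))"
      using t' by (auto simp: g_def fun_eq_iff split: split_indicator)
    moreover have "\<dots> \<in> borel_measurable lebesgue"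
      by (rule borel_measurable_scaleR[OF borel_measurable_indicator f'm]) simp
    ultimately show "g \<in> borel_measurable lebesgue" by (simp only:)
    have [measurable]: "eta m \<in> borel_measurable lebesgue" for m
    proof -
      have "continuous_on UNIV (eta m)"
        using der DERIV_continuous_on by blast
      then show ?thesis by (intro borel_measurable_lebesgueI borel_measurable_continuous_onI)
    qed
    have "(\<lambda>x. indicator ?K x *\<^sub>R eta m x *\<^sub>R f' x) = (\<lambda>x. eta m x *\<^sub>R (indicator ?K x *\<^sub>R f' x))" for m
      by (auto split: split_indicator)
    moreover have "(\<lambda>x. eta m x *\<^sub>R (indicator ?K x *\<^sub>R f' x)) \<in> borel_measurable lebesgue" for m
      by (rule borel_measurable_scaleR[OF _ f'm]) simp
    ultimately show "(\<lambda>x. indicator ?K x *\<^sub>R eta m x *\<^sub>R f' x) \<in> borel_measurable lebesgue" for m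
      by (simp only:)
    show "integrable lebesgue (\<lambda>x. norm (indicator ?K x *\<^sub>R f' x))"
      using f'K by (rule integrable_norm)
    show "AE x in lebesgue. (\<lambda>m. indicator ?K x *\<^sub>R eta m x *\<^sub>R f' x) \<longlonglongrightarrow> g x"
    proof (intro AE_I2)
      fix x
      have ev: "\<forall>\<^sub>F m in sequentially. ramp (real (Suc m) * y) = 1" if "y > 0" for y
      proof -
        obtain M where M: "2 / y < real M" using reals_Archimedean2 by blast
        have "2 \<le> real (Suc m) * y" if "M \<le> m" for m
        proof -
          have "2 < real M * y" using M \<open>y > 0\<close> by (simp add: field_simps)
          also have "\<dots> \<le> real (Suc m) * y" using that \<open>y > 0\<close> by (intro mult_right_mono) auto
          finally show ?thesis by simp
        qed
        then show ?thesis unfolding eventually_sequentially using ramp_eq_1 by blast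
      qed
      have z: "ramp (real (Suc m) * y) = 0" if "y \<le> 0" for y m
        using that by (intro ramp_eq_0) (auto simp: mult_le_0_iff)
      consider "x \<le> s" | "s < x" "x \<le> t" | "t < x" by linarith
      then have "\<forall>\<^sub>F m in sequentially. eta m x = indicator {s<..t} x"
      proof cases
        case 1 then show ?thesis using st by (simp add: eta_def z del: of_nat_Suc)
      next
        case 2 then show ?thesis using ev[of "x - s"] by (simp add: eta_def z del: of_nat_Suc)
      next
        case 3
        have "\<forall>\<^sub>F m in sequentially. ramp (real (Suc m) * (x - s)) = 1 \<and> ramp (real (Suc m) * (x - t)) = 1"
          using 3 st by (intro eventually_conj ev) auto
        then show ?thesis using 3 by (auto simp: eta_def elim!: eventually_mono simp del: of_nat_Suc)
      qed
      then have "\<forall>\<^sub>F m in sequentially. indicator ?K x *\<^sub>R eta m x *\<^sub>R f' x = g x"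
        by (rule eventually_mono) (use t' in \<open>auto simp: g_def split: split_indicator\<close>)
      then show "(\<lambda>m. indicator ?K x *\<^sub>R eta m x *\<^sub>R f' x) \<longlonglongrightarrow> g x"
        by (rule tendsto_eventually)
    qed
    show "AE x in lebesgue. norm (indicator ?K x *\<^sub>R eta m x *\<^sub>R f' x) \<le> norm (indicator ?K x *\<^sub>R f' x)" for m
    proof (intro AE_I2)
      fix x
      have "\<bar>eta m x\<bar> \<le> 1"
        using ramp_bounds[of "real (Suc m) * (x - s)"] ramp_bounds[of "real (Suc m) * (x - t)"]
        unfolding eta_def by linarith
      then show "norm (indicator ?K x *\<^sub>R eta m x *\<^sub>R f' x) \<le> norm (indicator ?K x *\<^sub>R f' x)"
        by (auto simp: mult_left_le_one_le split: split_indicator)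
    qed
  qed
  have "(\<lambda>m. - (LINT x:?K|lebesgue. eta m x *\<^sub>R f' x)) \<longlonglongrightarrow> f s - f t"
    using left by (rule Lim_transform_eventually)
      (use weak in \<open>auto simp: eventually_sequentially\<close>)
  then have "- (LINT x|lebesgue. g x) = f s - f t"
    using tendsto_minus[OF right] LIMSEQ_unique by blast
  moreover have "(LINT x|lebesgue. g x) = (LINT x:{s..t}|lebesgue. f' x)"
    unfolding set_lebesgue_integral_def g_def
  proof (rule integral_cong_AE)
    show "(\<lambda>x. indicat_real {s..t} x *\<^sub>R f' x) \<in> borel_measurable lebesgue"
      using g1 unfolding set_integrable_def by (rule borel_measurable_integrable)
    then have "(\<lambda>x. indicator {s<..t} x *\<^sub>R (indicat_real {s..t} x *\<^sub>R f' x)) \<in> borel_measurable lebesgue"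
      by (rule borel_measurable_scaleR[OF borel_measurable_indicator, rotated]) simp
    then show "(\<lambda>x. indicat_real {s<..t} x *\<^sub>R f' x) \<in> borel_measurable lebesgue"
      by (rule subst[rotated, of "\<lambda>h. h \<in> _"]) (auto split: split_indicator)
    have "AE x in lebesgue. x \<noteq> s" by (rule AE_completion[OF AE_lborel_singleton])
    then show "AE x in lebesgue. indicat_real {s<..t} x *\<^sub>R f' x = indicat_real {s..t} x *\<^sub>R f' x"
      by eventually_elim (auto split: split_indicator)
  qed
  ultimately show ?thesis using g1 by (metis minus_diff_eq neg_equal_iff_equal)
qed

text \<open>\<open>F\<close> minus the indefinite integral of \<open>f'\<close> is constant on the
  open interval by \<open>weak_derivative_increment\<close>, and by continuity up to both ends.
  Integrability of \<open>f'\<close> on the whole interval, and not just locally, lets the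
  indefinite integral start at 0.\<close>

lemma weak_derivative_primitive:
  assumes w: "has_weak_derivative {0<..<L} f f'" and cont: "continuous_on {0..L} F"
    and eq: "\<And>t. t \<in> {0<..<L} \<Longrightarrow> F t = f t" and int: "set_integrable lebesgue {0<..<L} f'"
    and L: "0 < L"
  shows "primitive_on {0..L} F f'"
proof -
  have int': "set_integrable lebesgue {0..L} f'"
    using int absolutely_integrable_on_open_interval[where f = f' and a = 0 and b = L] by simp
  then have sint: "set_integrable lebesgue {s..t} f'" if "0 \<le> s" "t \<le> L" for s t
    by (rule set_integrable_subset) (use that in auto)
  have i: "f' integrable_on {s..t}" "(LINT x:{s..t}|lebesgue. f' x) = integral {s..t} f'"
    if "0 \<le> s" "t \<le> L" for s t
    using set_lebesgue_integral_eq_integral[OF sint[OF that]] by auto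
  have comb: "integral {0..t} f' = integral {0..s} f' + integral {s..t} f'"
    if "0 \<le> s" "s \<le> t" "t \<le> L" for s t
    using that by (intro Henstock_Kurzweil_Integration.integral_combine[symmetric] i(1)) auto
  define H where "H t = F t - integral {0..t} f'" for t
  have contf: "continuous_on {0<..<L} f"
    by (rule continuous_on_eq[OF continuous_on_subset[OF cont]]) (use eq in auto)
  have Hc: "continuous_on {0..L} H"
    unfolding H_def[abs_def]
    by (intro continuous_on_diff cont indefinite_integral_continuous_1 i(1)) auto
  have step: "H s = H t" if "0 < s" "s < t" "t < L" for s t
  proof -
    have "0 \<le> s" "s \<le> t" "t \<le> L" "s \<in> {0<..<L}" "t \<in> {0<..<L}" using that by auto
    note c = comb[OF this(1-3)] and e = this(4,5)[THEN eq] and j = i(2)[OF this(1,3)]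
    have "integral {s..t} f' = f t - f s"
      using weak_derivative_increment[OF w contf refl that] unfolding j by (rule conjunct2)
    then show ?thesis unfolding H_def c e by simp
  qed
  have "H t = H (L / 2)" if "t \<in> {0<..<L}" for t
  proof (cases t "L / 2" rule: linorder_cases)
    case less
    then show ?thesis using step[of t "L / 2"] that L by simp
  next
    case greater
    then show ?thesis using step[of "L / 2" t, symmetric] that L by simp
  qed (simp only:)
  then have const: "H t = H (L / 2)" if "t \<in> {0..L}" for t
    using continuous_constant_on_closure[of "{0<..<L}" H "H (L / 2)" t] Hc L that
    unfolding closure_greaterThanLessThan[OF L] by blast
  show ?thesis
    unfolding primitive_on_def
  proof (intro ballI impI conjI)
    fix s t assume st: "s \<in> {0..L}" "t \<in> {0..L}" "s \<le> t"
    show "set_integrable lebesgue {s..t} f'" using sint st by simp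
    show "(LINT x:{s..t}|lebesgue. f' x) = F t - F s"
    proof -
      have st': "0 \<le> s" "t \<le> L" using st by auto
      have "H t = H s" using const[OF st(1)] const[OF st(2)] by (simp only:)
      then have "F t - F s = integral {0..t} f' - integral {0..s} f'"
        unfolding H_def by (simp only: algebra_simps)
      also have "\<dots> = integral {s..t} f'" using comb[OF st'(1) st(3) st'(2)] by simp
      finally show ?thesis using i(2)[OF st'] by (simp only:)
    qed
  qed
qed

section \<open>Sums over eigenvalues\<close>

text \<open>The suprema are taken off one summand at a time, and \<open>c\<close> collects the
  summands already fixed. In this way a bound for every simultaneous choice of finite independent
  sets becomes a bound for a sum of multiplicities.\<close>

lemma sum_SUP_le_ennreal:
  fixes g :: "'m \<Rightarrow> 'b \<Rightarrow> ennreal"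
  assumes "finite F" "\<And>m. m \<in> F \<Longrightarrow> S m \<noteq> {}"
    and "\<And>f. (\<And>m. m \<in> F \<Longrightarrow> f m \<in> S m) \<Longrightarrow> c + (\<Sum>m\<in>F. g m (f m)) \<le> X"
  shows "c + (\<Sum>m\<in>F. SUP b\<in>S m. g m b) \<le> X"
  using assms
proof (induction F arbitrary: c rule: finite_induct)
  case empty
  then show ?case by simp
next
  case (insert m F)
  have "c + g m b + (\<Sum>m\<in>F. SUP b\<in>S m. g m b) \<le> X" if b: "b \<in> S m" for b
  proof (rule insert.IH)
    show "S m' \<noteq> {}" if "m' \<in> F" for m' using insert.prems(1) that by simp
    fix f assume f: "\<And>m'. m' \<in> F \<Longrightarrow> f m' \<in> S m'"
    have "(\<Sum>m'\<in>F. g m' ((f(m := b)) m')) = (\<Sum>m'\<in>F. g m' (f m'))"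
      using insert.hyps(2) by (intro sum.cong) auto
    moreover have "c + (\<Sum>m'\<in>insert m F. g m' ((f(m := b)) m')) \<le> X"
      using f b by (intro insert.prems(2)) auto
    ultimately show "c + g m b + (\<Sum>m'\<in>F. g m' (f m')) \<le> X"
      using insert.hyps by (simp add: add.assoc)
  qed
  then have *: "(SUP b\<in>S m. g m b + (c + (\<Sum>m\<in>F. SUP b\<in>S m. g m b))) \<le> X"
    by (intro SUP_least) (simp add: ac_simps)
  have "S m \<noteq> {}" using insert.prems(1) by simp
  from *[unfolded ennreal_SUP_add_left[OF this]] show ?case
    using insert.hyps by (simp add: ac_simps)
qed

text \<open>If \<open>X\<close> is finite, then for each n only finitely many points satisfy
  \<open>1 / Suc n \<le> h m\<close>, and these sets exhaust the support of \<open>h\<close>.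
  Therefore the index set may be uncountable, such as all negative reals.\<close>

lemma nn_integral_count_space_le:
  fixes h :: "'m \<Rightarrow> ennreal"
  assumes fin: "\<And>F. finite F \<Longrightarrow> F \<subseteq> A \<Longrightarrow> (\<Sum>m\<in>F. h m) \<le> X"
  shows "(\<integral>\<^sup>+m. h m \<partial>count_space A) \<le> X"
proof (cases "X = top")
  case False
  define B where "B n = {m\<in>A. ennreal (1 / real (Suc n)) \<le> h m}" for n
  have "finite (B n)" for n
  proof (rule ccontr)
    assume "infinite (B n)"
    obtain r where r: "X = ennreal r" "r \<ge> 0" using False by (cases X) auto
    obtain N where N: "r * Suc n < real N" using reals_Archimedean2 by blast
    obtain F where F: "F \<subseteq> B n" "finite F" "card F = N"
      using infinite_arbitrarily_large[OF \<open>infinite (B n)\<close>] by blast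
    have "ennreal (real N / Suc n) = (\<Sum>m\<in>F. ennreal (1 / real (Suc n)))"
      using F by (simp add: ennreal_of_nat_eq_real_of_nat ennreal_mult'[symmetric] del: of_nat_Suc)
    also have "\<dots> \<le> (\<Sum>m\<in>F. h m)" using F by (intro sum_mono) (auto simp: B_def)
    also have "\<dots> \<le> ennreal r" using fin[of F] F r by (auto simp: B_def)
    finally have "real N / Suc n \<le> r" using r by simp
    then show False using N by (simp add: field_simps)
  qed
  note finB = this
  have mono: "B n \<subseteq> B (Suc n)" for n
  proof -
    have "ennreal (1 / real (Suc (Suc n))) \<le> ennreal (1 / real (Suc n))"
      by (intro ennreal_leI divide_left_mono) auto
    then show ?thesis unfolding B_def by (blast intro: order_trans)
  qed
  have h_eq: "h m = (SUP n. h m * indicator (B n) m)" if "m \<in> A" for m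
  proof (cases "h m = 0")
    case False
    have "\<exists>n. ennreal (1 / real (Suc n)) \<le> h m"
    proof (cases "h m")
      case (real r)
      then have "r > 0" using False by (simp add: zero_less_iff_neq_zero[symmetric])
      then obtain n where "inverse (real (Suc n)) < r" using reals_Archimedean by blast
      then have "ennreal (1 / real (Suc n)) \<le> h m" using real by (simp add: inverse_eq_divide ennreal_leI)
      then show ?thesis by blast
    qed auto
    then obtain n where "ennreal (1 / real (Suc n)) \<le> h m" by blast
    then have "m \<in> B n" using that unfolding B_def by blast
    then have "h m \<le> (SUP n. h m * indicator (B n) m)"
      by (intro SUP_upper2[of n]) auto
    moreover have "(SUP n. h m * indicator (B n) m) \<le> h m"
      by (intro SUP_least) (auto split: split_indicator)
    ultimately show ?thesis by (rule antisym)
  qed simp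
  have "(\<integral>\<^sup>+m. h m \<partial>count_space A) = (\<integral>\<^sup>+m. (SUP n. h m * indicator (B n) m) \<partial>count_space A)"
    by (intro nn_integral_cong h_eq) simp
  also have "\<dots> = (SUP n. \<integral>\<^sup>+m. h m * indicator (B n) m \<partial>count_space A)"
    using mono by (intro nn_integral_monotone_convergence_SUP incseq_SucI) (auto simp: le_fun_def split: split_indicator)
  also have "\<dots> \<le> X"
  proof (intro SUP_least)
    fix n
    have "(\<integral>\<^sup>+m. h m * indicator (B n) m \<partial>count_space A) = (\<Sum>m\<in>B n. h m * indicator (B n) m)"
      by (intro nn_integral_count_space' finB) (auto simp: B_def)
    also have "\<dots> = (\<Sum>m\<in>B n. h m)" by (intro sum.cong) auto
    also have "\<dots> \<le> X" using fin finB by (auto simp: B_def)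
    finally show "(\<integral>\<^sup>+m. h m * indicator (B n) m \<partial>count_space A) \<le> X" .
  qed
  finally show ?thesis .
qed simp

lemma nn_integral_powr_Icc:
  assumes "0 < s" "0 \<le> c"
  shows "(\<integral>\<^sup>+E\<in>{0..c}. ennreal (E powr (s - 1)) \<partial>lborel) = ennreal (c powr s / s)"
  using nn_integral_has_integral_lebesgue'[OF _ has_integral_powr_from_0[of "s - 1" c]] assms by simp

lemma nn_integral_powr_atLeast:
  assumes "0 < s" "0 < c"
  shows "(\<integral>\<^sup>+E\<in>{c..}. ennreal (E powr (- s - 1)) \<partial>lborel) = ennreal (c powr (- s) / s)"
  using nn_integral_has_integral_lebesgue'[OF _ has_integral_powr_to_inf[of "- s - 1" c]] assms by simp

text \<open>Each power is \<open>2 powr \<gamma> * \<gamma>\<close> times the integral of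
  \<open>E powr (\<gamma> - 1)\<close> over E between 0 and \<open>a i / 2\<close>; the 2 reflects
  counting at the threshold \<open>2 * E\<close>. Summation under the integral produces the counting
  function, and Tonelli exchanges \<open>E\<close> and \<open>x\<close>. The measure
  \<open>M\<close> is once the tree measure and once a counting measure on intervals.\<close>

lemma layer_cake_sum:
  fixes a :: "'i \<Rightarrow> real" and F :: "real \<Rightarrow> 'x \<Rightarrow> ennreal"
  assumes M: "sigma_finite_measure M" and I: "finite I" "\<And>i. i \<in> I \<Longrightarrow> 0 < a i" and \<gamma>: "0 < \<gamma>"
    and F: "(\<lambda>(E, x). F E x) \<in> borel_measurable (lborel \<Otimes>\<^sub>M M)"
    and count: "\<And>E. 0 < E \<Longrightarrow> of_nat (card {i\<in>I. 2 * E < a i}) \<le> (\<integral>\<^sup>+x. F E x \<partial>M)"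
  shows "(\<Sum>i\<in>I. ennreal (a i powr \<gamma>)) \<le> ennreal (2 powr \<gamma> * \<gamma>) *
    (\<integral>\<^sup>+x. (\<integral>\<^sup>+E\<in>{0<..}. ennreal (E powr (\<gamma> - 1)) * F E x \<partial>lborel) \<partial>M)"
proof -
  interpret M: sigma_finite_measure M by fact
  interpret P: pair_sigma_finite lborel M ..
  note F[measurable]
  have pow: "ennreal (a i powr \<gamma>) = ennreal (2 powr \<gamma> * \<gamma>) *
      (\<integral>\<^sup>+E\<in>{0<..}. ennreal (E powr (\<gamma> - 1)) * indicator {..<a i / 2} E \<partial>lborel)" if "i \<in> I" for i
  proof -
    have ai: "0 < a i" using I that by auto
    have "(\<integral>\<^sup>+E\<in>{0<..}. ennreal (E powr (\<gamma> - 1)) * indicator {..<a i / 2} E \<partial>lborel)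
        = (\<integral>\<^sup>+E\<in>{0..a i / 2}. ennreal (E powr (\<gamma> - 1)) \<partial>lborel)"
    proof (rule nn_integral_cong_AE)
      have "AE E in lborel. E \<noteq> 0 \<and> E \<noteq> a i / 2"
        by (intro AE_conjI AE_lborel_singleton)
      then show "AE E in lborel. ennreal (E powr (\<gamma> - 1)) * indicator {..<a i / 2} E * indicator {0<..} E
          = ennreal (E powr (\<gamma> - 1)) * indicator {0..a i / 2} E"
        by eventually_elim (auto split: split_indicator)
    qed
    also have "\<dots> = ennreal ((a i / 2) powr \<gamma> / \<gamma>)"
      using \<gamma> ai by (intro nn_integral_powr_Icc) auto
    finally have eq: "(\<integral>\<^sup>+E\<in>{0<..}. ennreal (E powr (\<gamma> - 1)) * indicator {..<a i / 2} E \<partial>lborel)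
        = ennreal ((a i / 2) powr \<gamma> / \<gamma>)" .
    have "ennreal (2 powr \<gamma> * \<gamma>) * (\<integral>\<^sup>+E\<in>{0<..}. ennreal (E powr (\<gamma> - 1)) * indicator {..<a i / 2} E \<partial>lborel)
        = ennreal (2 powr \<gamma> * \<gamma> * ((a i / 2) powr \<gamma> / \<gamma>))"
      unfolding eq by (rule ennreal_mult[symmetric]) (use \<gamma> in auto)
    also have "2 powr \<gamma> * \<gamma> * ((a i / 2) powr \<gamma> / \<gamma>) = a i powr \<gamma>"
      using \<gamma> ai by (simp add: powr_divide)
    finally show ?thesis by simp
  qed
  have cardE: "(\<Sum>i\<in>I. indicator {..<a i / 2} E) = (of_nat (card {i\<in>I. 2 * E < a i}) :: ennreal)" for E
  proof -
    have "(\<Sum>i\<in>I. indicator {..<a i / 2} E :: ennreal) = (\<Sum>i\<in>I. if 2 * E < a i then 1 else 0)"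
      by (intro sum.cong) (auto split: split_indicator)
    also have "\<dots> = of_nat (card {i\<in>I. 2 * E < a i})"
      using I(1) by (subst sum.inter_filter[symmetric]) auto
    finally show ?thesis .
  qed
  have "(\<Sum>i\<in>I. ennreal (a i powr \<gamma>)) = ennreal (2 powr \<gamma> * \<gamma>) *
      (\<integral>\<^sup>+E. (\<Sum>i\<in>I. ennreal (E powr (\<gamma> - 1)) * indicator {..<a i / 2} E * indicator {0<..} E) \<partial>lborel)"
    by (subst nn_integral_sum) (auto simp: pow sum_distrib_left)
  also have "(\<integral>\<^sup>+E. (\<Sum>i\<in>I. ennreal (E powr (\<gamma> - 1)) * indicator {..<a i / 2} E * indicator {0<..} E) \<partial>lborel)
      \<le> (\<integral>\<^sup>+E. (\<integral>\<^sup>+x. ennreal (E powr (\<gamma> - 1)) * F E x * indicator {0<..} E \<partial>M) \<partial>lborel)"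
  proof (intro nn_integral_mono)
    fix E :: real
    have "(\<Sum>i\<in>I. ennreal (E powr (\<gamma> - 1)) * indicator {..<a i / 2} E * indicator {0<..} E)
        = ennreal (E powr (\<gamma> - 1)) * indicator {0<..} E * of_nat (card {i\<in>I. 2 * E < a i})"
      unfolding cardE[symmetric] by (simp add: sum_distrib_left ac_simps)
    also have "\<dots> \<le> ennreal (E powr (\<gamma> - 1)) * indicator {0<..} E * (\<integral>\<^sup>+x. F E x \<partial>M)"
      using count[of E] by (auto intro!: mult_left_mono split: split_indicator)
    also have "\<dots> = (\<integral>\<^sup>+x. ennreal (E powr (\<gamma> - 1)) * indicator {0<..} E * F E x \<partial>M)"
      by (subst nn_integral_cmult) auto
    finally show "(\<Sum>i\<in>I. ennreal (E powr (\<gamma> - 1)) * indicator {..<a i / 2} E * indicator {0<..} E)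
        \<le> (\<integral>\<^sup>+x. ennreal (E powr (\<gamma> - 1)) * F E x * indicator {0<..} E \<partial>M)"
      by (simp add: ac_simps)
  qed
  also have "(\<integral>\<^sup>+E. (\<integral>\<^sup>+x. ennreal (E powr (\<gamma> - 1)) * F E x * indicator {0<..} E \<partial>M) \<partial>lborel)
      = (\<integral>\<^sup>+x. (\<integral>\<^sup>+E\<in>{0<..}. ennreal (E powr (\<gamma> - 1)) * F E x \<partial>lborel) \<partial>M)"
    by (rule P.Fubini'[symmetric]) measurable
  finally show ?thesis by (simp add: mult_left_mono)
qed

section \<open>Weidl's partition of a half-line\<close>

lemma nn_integral_lebesgue_Icc_Ico:
  "(\<integral>\<^sup>+x\<in>{a..b::real}. f x \<partial>lebesgue) = (\<integral>\<^sup>+x\<in>{a..<b}. f x \<partial>lebesgue)"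
proof (rule nn_integral_cong_AE)
  have "AE x in lebesgue. x \<noteq> b" by (rule AE_completion[OF AE_lborel_singleton])
  then show "AE x in lebesgue. f x * indicator {a..b} x = f x * indicator {a..<b} x"
    by eventually_elim (auto split: split_indicator)
qed

lemma primitive_on_measurable_atLeast:
  assumes "primitive_on {a..} u g"
  shows "set_borel_measurable lebesgue {a..} u" "set_borel_measurable lebesgue {a..} g"
proof -
  have *: "set_borel_measurable lebesgue {a..} h"
    if "\<And>b. set_borel_measurable lebesgue {a..b} h" for h :: "real \<Rightarrow> complex"
    unfolding set_borel_measurable_def
  proof (rule borel_measurable_LIMSEQ_metric)
    show "(\<lambda>x. indicat_real {a..real n} x *\<^sub>R h x) \<in> borel_measurable lebesgue" for n
      using that unfolding set_borel_measurable_def .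
    fix x
    obtain N where N: "x < real N" using reals_Archimedean2 by blast
    have "\<forall>\<^sub>F n in sequentially. indicat_real {a..real n} x *\<^sub>R h x = indicat_real {a..} x *\<^sub>R h x"
      unfolding eventually_sequentially using N by (intro exI[of _ N]) (auto split: split_indicator)
    then show "(\<lambda>n. indicat_real {a..real n} x *\<^sub>R h x) \<longlonglongrightarrow> indicat_real {a..} x *\<^sub>R h x"
      by (rule tendsto_eventually)
  qed
  have "primitive_on {a..b} u g" for b
    by (rule primitive_on_subset[OF assms]) auto
  note this[THEN primitive_on_measurable(1), THEN *] this[THEN primitive_on_measurable(2), THEN *]
  then show "set_borel_measurable lebesgue {a..} u" "set_borel_measurable lebesgue {a..} g" .
qed

lemma nn_integral_weighted_le:
  assumes "\<And>x. x \<in> A \<Longrightarrow> ennreal ((norm (u x))\<^sup>2) \<le> c" "\<And>x. 0 \<le> V x"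
    and [measurable]: "V \<in> borel_measurable M" "A \<in> sets M"
  shows "(\<integral>\<^sup>+x\<in>A. ennreal (V x * (norm (u x))\<^sup>2) \<partial>M) \<le> (\<integral>\<^sup>+x\<in>A. ennreal (V x) \<partial>M) * c"
proof -
  have "(\<integral>\<^sup>+x\<in>A. ennreal (V x * (norm (u x))\<^sup>2) \<partial>M) \<le> (\<integral>\<^sup>+x. ennreal (V x) * indicator A x * c \<partial>M)"
    using assms(1,2) by (intro nn_integral_mono) (auto simp: ennreal_mult intro!: mult_left_mono split: split_indicator)
  also have "\<dots> = (\<integral>\<^sup>+x\<in>A. ennreal (V x) \<partial>M) * c"
    by (rule nn_integral_multc) auto
  finally show ?thesis .
qed

text \<open>As \<open>u\<close> vanishes at the left end, Cauchy-Schwarz bounds |u(p)|^2 by the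
  length times the energy. Integrating against V costs the mass \<open>v\<close>, and mass times
  length is at most 1.\<close>

lemma potential_bound_vanishing:
  assumes u: "primitive_on {a..b} u g" and ab: "a < b" and u0: "u a = 0"
    and V: "V \<in> borel_measurable lebesgue" "\<And>x. 0 \<le> V x"
    and v: "(\<integral>\<^sup>+x\<in>{a..b}. ennreal (V x) \<partial>lebesgue) \<le> ennreal v" "0 \<le> v" "v * (b - a) \<le> 1"
  shows "(\<integral>\<^sup>+x\<in>{a..b}. ennreal (V x * (norm (u x))\<^sup>2) \<partial>lebesgue) \<le> (\<integral>\<^sup>+x\<in>{a..b}. ennreal ((norm (g x))\<^sup>2) \<partial>lebesgue)"
proof -
  define W where "W = (\<integral>\<^sup>+x\<in>{a..b}. ennreal ((norm (g x))\<^sup>2) \<partial>lebesgue)"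
  have "ennreal ((norm (u p))\<^sup>2) \<le> ennreal (b - a) * W" if "p \<in> {a..b}" for p
  proof -
    have "ennreal (norm (u p - u a)) \<le> (\<integral>\<^sup>+x\<in>{a..b}. ennreal (norm (g x)) \<partial>lebesgue)"
      using that ab by (intro primitive_on_increment[OF u]) auto
    then have "(ennreal (norm (u p)))\<^sup>2 \<le> (\<integral>\<^sup>+x\<in>{a..b}. ennreal (norm (g x)) \<partial>lebesgue)\<^sup>2"
      unfolding u0 by (intro power_mono) auto
    also have "\<dots> \<le> (\<integral>\<^sup>+x\<in>{a..b}. ennreal (1 / 1) \<partial>lebesgue) * (\<integral>\<^sup>+x\<in>{a..b}. ennreal (1 * (norm (g x))\<^sup>2) \<partial>lebesgue)"
      by (rule Cauchy_Schwarz_weighted[OF primitive_on_measurable(2)[OF u]]) auto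
    also have "\<dots> = ennreal (b - a) * W" using ab by (simp add: W_def less_imp_le)
    finally show ?thesis by (simp add: ennreal_power)
  qed
  then have "(\<integral>\<^sup>+x\<in>{a..b}. ennreal (V x * (norm (u x))\<^sup>2) \<partial>lebesgue)
      \<le> (\<integral>\<^sup>+x\<in>{a..b}. ennreal (V x) \<partial>lebesgue) * (ennreal (b - a) * W)"
    using V by (intro nn_integral_weighted_le) auto
  also have "\<dots> \<le> ennreal v * (ennreal (b - a) * W)"
    by (intro mult_right_mono v) auto
  also have "\<dots> = ennreal (v * (b - a)) * W"
    using v ab by (simp add: ennreal_mult mult.assoc)
  also have "\<dots> \<le> 1 * W"
    using v by (intro mult_right_mono) (auto simp: ennreal_le_1)
  finally show ?thesis by (simp add: W_def)
qed

text \<open>On an interval of length L the pointwise bound with weight 1 reads |u|^2 \<le> 2 L (U /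
  L^2 + W). Integrating against V multiplies by v, and v L = 1/2 turns the coefficients 2 v / L and
  2 v L into 4 v^2 and 1: this is the origin of the threshold \<open>4 * v\<^sup>2\<close>.\<close>

lemma potential_bound:
  assumes u: "primitive_on {a..b} u g" and ab: "a < b"
    and V: "V \<in> borel_measurable lebesgue" "\<And>x. 0 \<le> V x"
    and v: "(\<integral>\<^sup>+x\<in>{a..b}. ennreal (V x) \<partial>lebesgue) \<le> ennreal v" "0 \<le> v"
      "v = 0 \<or> v * (b - a) = 1 / 2"
  shows "(\<integral>\<^sup>+x\<in>{a..b}. ennreal (V x * (norm (u x))\<^sup>2) \<partial>lebesgue) \<le>
    (\<integral>\<^sup>+x\<in>{a..b}. ennreal ((norm (g x))\<^sup>2) \<partial>lebesgue) +
    ennreal (4 * v\<^sup>2) * (\<integral>\<^sup>+x\<in>{a..b}. ennreal ((norm (u x))\<^sup>2) \<partial>lebesgue)"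
proof -
  define W where "W = (\<integral>\<^sup>+x\<in>{a..b}. ennreal ((norm (g x))\<^sup>2) \<partial>lebesgue)"
  define U where "U = (\<integral>\<^sup>+x\<in>{a..b}. ennreal ((norm (u x))\<^sup>2) \<partial>lebesgue)"
  define L where "L = b - a"
  have L: "L > 0" using ab by (simp add: L_def)
  have "ennreal ((norm (u p))\<^sup>2) \<le> 2 * ennreal L * (ennreal (1 / L\<^sup>2) * U + W)" if "p \<in> {a..b}" for p
    using primitive_on_pointwise_bound[OF u ab that, of "\<lambda>_. 1"] L
    by (simp add: U_def W_def L_def less_imp_le)
  then have "(\<integral>\<^sup>+x\<in>{a..b}. ennreal (V x * (norm (u x))\<^sup>2) \<partial>lebesgue)
      \<le> (\<integral>\<^sup>+x\<in>{a..b}. ennreal (V x) \<partial>lebesgue) * (2 * ennreal L * (ennreal (1 / L\<^sup>2) * U + W))"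
    using V by (intro nn_integral_weighted_le) auto
  also have "\<dots> \<le> ennreal v * (2 * ennreal L * (ennreal (1 / L\<^sup>2) * U + W))"
    by (intro mult_right_mono v) auto
  also have "\<dots> = ennreal (v * (2 * L) * (1 / L\<^sup>2)) * U + ennreal (v * (2 * L)) * W"
  proof -
    have "ennreal (v * (2 * L)) = ennreal v * (2 * ennreal L)"
      using v L by (simp add: ennreal_mult)
    moreover have "ennreal (v * (2 * L) * (1 / L\<^sup>2)) = ennreal (v * (2 * L)) * ennreal (1 / L\<^sup>2)"
      using v L by (intro ennreal_mult) auto
    ultimately show ?thesis by (simp only: distrib_left mult.assoc)
  qed
  also have "\<dots> \<le> ennreal (4 * v\<^sup>2) * U + 1 * W"
  proof (intro add_mono mult_right_mono)
    have "v * (2 * L) * (1 / L\<^sup>2) \<le> 4 * v\<^sup>2"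
    proof (cases "v = 0")
      case False
      then have vL: "v * L = 1 / 2" using v by (simp add: L_def)
      have "4 * v\<^sup>2 * L\<^sup>2 = 4 * (v * L)\<^sup>2" by (simp add: power_mult_distrib)
      also have "\<dots> = 1" unfolding vL by (simp add: power_divide)
      finally have "4 * v\<^sup>2 * L\<^sup>2 = 1" .
      moreover have "v * (2 * L) = 1" using vL by simp
      ultimately have "v * (2 * L) = 1" "4 * v\<^sup>2 * L\<^sup>2 = 1" by blast+
      then show ?thesis using L by (simp add: field_simps)
    qed simp
    then show "ennreal (v * (2 * L) * (1 / L\<^sup>2)) \<le> ennreal (4 * v\<^sup>2)" by (rule ennreal_leI)
    show "ennreal (v * (2 * L)) \<le> 1" using v(3) by (auto simp: L_def ennreal_le_1 algebra_simps)
  qed auto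
  finally show ?thesis by (simp add: U_def W_def add.commute)
qed

text \<open>The product of mass and length of [x, y] is continuous in y, vanishes at y = x and is
  unbounded unless the mass is always zero, so it takes the value 1/2. In the massless case any
  length is admissible and 1 is taken.\<close>

lemma critical_interval_exists:
  assumes V: "V \<in> borel_measurable lebesgue" "\<And>x. 0 \<le> V x"
    and fin: "(\<integral>\<^sup>+x\<in>{\<alpha>..}. ennreal (V x) \<partial>lebesgue) < \<infinity>" and x: "\<alpha> \<le> x"
  shows "\<exists>y v. x < y \<and> 0 \<le> v \<and> (\<integral>\<^sup>+t\<in>{x..y}. ennreal (V t) \<partial>lebesgue) = ennreal v \<and>
    (v = 0 \<and> y = x + 1 \<or> v * (y - x) = 1 / 2)"
proof -
  define m where "m y = (\<integral>\<^sup>+t\<in>{x..y}. ennreal (V t) \<partial>lebesgue)" for y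
  have m_fin: "m y < \<infinity>" for y
  proof -
    have "m y \<le> (\<integral>\<^sup>+x\<in>{\<alpha>..}. ennreal (V x) \<partial>lebesgue)"
      unfolding m_def using x by (intro nn_integral_mono) (auto split: split_indicator)
    then show ?thesis using fin by (rule le_less_trans)
  qed
  have int: "set_integrable lebesgue {x..y} V" for y
    unfolding set_integrable_def
  proof (rule integrableI_bounded)
    have "(\<integral>\<^sup>+t. ennreal (norm (indicat_real {x..y} t *\<^sub>R V t)) \<partial>lebesgue) = m y"
      unfolding m_def using V(2) by (intro nn_integral_cong) (auto split: split_indicator)
    then show "(\<integral>\<^sup>+t. ennreal (norm (indicat_real {x..y} t *\<^sub>R V t)) \<partial>lebesgue) < \<infinity>"
      using m_fin by simp
    show "(\<lambda>t. indicat_real {x..y} t *\<^sub>R V t) \<in> borel_measurable lebesgue"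
      by (rule borel_measurable_scaleR[OF borel_measurable_indicator V(1)]) simp
  qed
  define \<phi> where "\<phi> y = integral {x..y} V" for y
  have \<phi>: "V integrable_on {x..y}" "m y = ennreal (\<phi> y)" "0 \<le> \<phi> y" for y
  proof -
    note set_lebesgue_integral_eq_integral[OF int, of y]
    then show "V integrable_on {x..y}" by simp
    have *: "\<phi> y = (LINT t:{x..y}|lebesgue. V t)"
      using set_lebesgue_integral_eq_integral(2)[OF int, of y] by (simp add: \<phi>_def)
    show "0 \<le> \<phi> y" unfolding * set_lebesgue_integral_def
      using V(2) by (intro Bochner_Integration.integral_nonneg) auto
    have "m y = (\<integral>\<^sup>+t. ennreal (indicat_real {x..y} t *\<^sub>R V t) \<partial>lebesgue)"
      unfolding m_def by (intro nn_integral_cong) (auto split: split_indicator)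
    also have "\<dots> = ennreal (\<phi> y)"
      unfolding * set_lebesgue_integral_def
      using int[of y] V(2) by (intro nn_integral_eq_integral) (auto simp: set_integrable_def)
    finally show "m y = ennreal (\<phi> y)" .
  qed
  have mono: "\<phi> y \<le> \<phi> z" if "y \<le> z" for y z
  proof -
    have "m y \<le> m z" unfolding m_def using that
      by (intro nn_integral_mono) (auto split: split_indicator)
    then show ?thesis using \<phi>(2,3) by simp
  qed
  show ?thesis
  proof (cases "\<forall>y\<ge>x. \<phi> y = 0")
    case True
    then show ?thesis using \<phi>(2)[of "x + 1"]
      by (intro exI[of _ "x + 1"] exI[of _ 0]) (auto simp: m_def)
  next
    case False
    then obtain T where T: "T \<ge> x" "\<phi> T > 0" using \<phi>(3) by (metis less_le)
    \<comment> \<open>Beyond \<open>T\<close> the mass is at least \<open>\<phi> T\<close>, so at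
      this length the product has reached 1/2.\<close>
    define Y where "Y = max T (x + 1 / (2 * \<phi> T))"
    have Y: "x \<le> Y" "T \<le> Y" "1 / (2 * \<phi> T) \<le> Y - x" using T by (auto simp: Y_def)
    have "1 / 2 = \<phi> T * (1 / (2 * \<phi> T))" using T by simp
    also have "\<dots> \<le> \<phi> Y * (Y - x)" using T Y mono[OF Y(2)] by (intro mult_mono) auto
    finally have "1 / 2 \<le> \<phi> Y * (Y - x)" .
    moreover have "continuous_on {x..Y} (\<lambda>y. \<phi> y * (y - x))"
      unfolding \<phi>_def by (intro continuous_on_mult indefinite_integral_continuous_1 \<phi>(1) continuous_intros)
    ultimately obtain y where y: "x \<le> y" "y \<le> Y" "\<phi> y * (y - x) = 1 / 2"
      using IVT'[of "\<lambda>y. \<phi> y * (y - x)" x "1 / 2" Y] Y(1) by auto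
    then have "x < y" by (cases "x = y") auto
    then show ?thesis using y \<phi>(2,3)[of y] by (intro exI[of _ y] exI[of _ "\<phi> y"]) (auto simp: m_def)
  qed
qed

text \<open>Critical intervals are laid end to end from \<alpha>; \<open>z i\<close> is the left end
  of an interval and \<open>v i\<close> the mass of V on it. Where
  \<open>E < 4 * (v i)\<^sup>2\<close>, the condition at the left end makes
  \<open>potential_bound_vanishing\<close> applicable; elsewhere \<open>potential_bound\<close>
  loses at most \<open>E\<close> times the squared norm.\<close>

lemma Weidl_partition:
  assumes V: "V \<in> borel_measurable lebesgue" "\<And>x. 0 \<le> V x"
    and fin: "(\<integral>\<^sup>+x\<in>{\<alpha>..}. ennreal (V x) \<partial>lebesgue) < \<infinity>"
  shows "\<exists>(z::nat \<Rightarrow> real) (v::nat \<Rightarrow> real). (\<forall>i. \<alpha> \<le> z i \<and> 0 \<le> v i) \<and>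
    (\<Sum>i. ennreal (v i)) = (\<integral>\<^sup>+x\<in>{\<alpha>..}. ennreal (V x) \<partial>lebesgue) \<and>
    (\<forall>E u g. 0 \<le> E \<and> primitive_on {\<alpha>..} u g \<and> (\<forall>i. E < 4 * (v i)\<^sup>2 \<longrightarrow> u (z i) = 0) \<longrightarrow>
      (\<integral>\<^sup>+x\<in>{\<alpha>..}. ennreal (V x * (norm (u x))\<^sup>2) \<partial>lebesgue) \<le>
      (\<integral>\<^sup>+x\<in>{\<alpha>..}. ennreal ((norm (g x))\<^sup>2) \<partial>lebesgue) +
      ennreal E * (\<integral>\<^sup>+x\<in>{\<alpha>..}. ennreal ((norm (u x))\<^sup>2) \<partial>lebesgue))"
proof -
  define T where "T = enn2real (\<integral>\<^sup>+x\<in>{\<alpha>..}. ennreal (V x) \<partial>lebesgue)"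
  have T: "(\<integral>\<^sup>+x\<in>{\<alpha>..}. ennreal (V x) \<partial>lebesgue) = ennreal T" "0 \<le> T"
    using fin by (auto simp: T_def)
  define R where "R x y v \<longleftrightarrow> x < y \<and> 0 \<le> v \<and> (\<integral>\<^sup>+t\<in>{x..y}. ennreal (V t) \<partial>lebesgue) = ennreal v \<and>
    (v = 0 \<and> y = x + 1 \<or> v * (y - x) = 1 / 2)" for x y v
  define nxt where "nxt x = (SOME y. \<exists>v. R x y v)" for x
  define z where "z i = (nxt ^^ i) \<alpha>" for i
  have R_ex: "\<exists>v. R x (nxt x) v" if "\<alpha> \<le> x" for x
    unfolding nxt_def by (rule someI_ex)
      (use critical_interval_exists[OF V fin that] in \<open>unfold R_def, blast\<close>)
  have z_ge: "\<alpha> \<le> z i" for i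
  proof (induction i)
    case (Suc i)
    then show ?case using R_ex[of "z i"] by (auto simp: z_def R_def)
  qed (simp add: z_def)
  obtain v where v: "R (z i) (z (Suc i)) (v i)" for i
    using R_ex[OF z_ge] unfolding z_def by simp metis
  \<comment> \<open>A lower bound for all lengths, so that the intervals exhaust the half-line: a
    massless one has length 1, and a mass of at most \<open>T\<close> forces at least the length
    1/(2 T). The added 1 avoids a division by zero.\<close>
  define \<delta> where "\<delta> = min 1 (1 / (2 * (T + 1)))"
  have \<delta>: "0 < \<delta>" using T by (simp add: \<delta>_def)
  have step: "z i + \<delta> \<le> z (Suc i)" for i
  proof -
    have "v i = 0 \<and> z (Suc i) = z i + 1 \<or> v i * (z (Suc i) - z i) = 1 / 2" "z i < z (Suc i)" "0 \<le> v i"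
      using v[of i] by (auto simp: R_def)
    then consider "z (Suc i) = z i + 1" | "v i * (z (Suc i) - z i) = 1 / 2" "z i < z (Suc i)" by blast
    then show ?thesis
    proof cases
      case 2
      have "ennreal (v i) \<le> ennreal T"
        unfolding T(1)[symmetric] using v[of i] z_ge[of i] unfolding R_def
        by (auto simp del: ennreal_le_iff intro!: nn_integral_mono dest!: sym[of _ "ennreal (v i)"] split: split_indicator)
      then have "v i \<le> T + 1" using T(2) by (auto simp: ennreal_le_iff2)
      then have "1 / 2 \<le> (T + 1) * (z (Suc i) - z i)"
        using 2 mult_right_mono[of "v i" "T + 1" "z (Suc i) - z i"] by linarith
      then have "1 / (2 * (T + 1)) \<le> z (Suc i) - z i" using T(2) by (simp add: field_simps)
      then show ?thesis by (simp add: \<delta>_def)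
    qed (simp add: \<delta>_def)
  qed
  have z_inc: "z i < z (Suc i)" for i using step[of i] \<delta> by simp
  then have z_mono: "mono z"
    by (simp add: incseq_SucI less_imp_le)
  have z_big: "\<alpha> + real i * \<delta> \<le> z i" for i
  proof (induction i)
    case (Suc i)
    then show ?case using step[of i] by (simp add: algebra_simps)
  qed (simp add: z_def)
  define J where "J i = {z i..<z (Suc i)}" for i
  have UJ: "(\<Union>i. J i) = {\<alpha>..}"
  proof (intro equalityI subsetI)
    fix x assume "x \<in> {\<alpha>..}"
    obtain n where "(x - \<alpha>) / \<delta> < real n" using reals_Archimedean2 by blast
    then have "x < z n" using z_big[of n] \<delta> by (simp add: field_simps)
    define k where "k = (LEAST n. x < z n)"
    have k1: "x < z k"
      unfolding k_def by (rule LeastI[of "\<lambda>n. x < z n" n]) fact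
    have k2: "\<not> x < z j" if "j < k" for j
      using that unfolding k_def by (rule not_less_Least)
    have "z 0 = \<alpha>" by (simp add: z_def)
    then have "k \<noteq> 0" using k1 \<open>x \<in> {\<alpha>..}\<close> by (metis atLeast_iff not_less)
    then obtain j where j: "k = Suc j" by (cases k) simp_all
    have "z j \<le> x" using k2[of j] j by simp
    then have "x \<in> J j" using k1 unfolding J_def j by simp
    then show "x \<in> (\<Union>i. J i)" by blast
  next
    fix x assume "x \<in> (\<Union>i. J i)"
    then obtain i where "z i \<le> x" by (auto simp: J_def)
    then show "x \<in> {\<alpha>..}" using z_ge[of i] by simp
  qed
  have disj: "disjoint_family J"
    unfolding disjoint_family_on_def
  proof (intro ballI impI)
    fix i j :: nat assume "i \<noteq> j"
    then consider "Suc i \<le> j" | "Suc j \<le> i" by linarith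
    then show "J i \<inter> J j = {}"
      by cases (auto simp: J_def dest: monoD[OF z_mono])
  qed
  have split: "(\<integral>\<^sup>+x\<in>{\<alpha>..}. f x \<partial>lebesgue) = (\<Sum>i. \<integral>\<^sup>+x\<in>{z i..z (Suc i)}. f x \<partial>lebesgue)"
    if "(\<lambda>x. f x * indicator {\<alpha>..} x) \<in> borel_measurable lebesgue" for f :: "real \<Rightarrow> ennreal"
  proof -
    have "(\<integral>\<^sup>+x\<in>{\<alpha>..}. f x \<partial>lebesgue) = (\<integral>\<^sup>+x\<in>(\<Union>i. J i). f x * indicator {\<alpha>..} x \<partial>lebesgue)"
      unfolding UJ by (intro nn_integral_cong) (auto split: split_indicator)
    also have "\<dots> = (\<Sum>i. \<integral>\<^sup>+x\<in>J i. f x * indicator {\<alpha>..} x \<partial>lebesgue)"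
      by (intro nn_integral_disjoint_family that disj) (simp add: J_def)
    also have "\<dots> = (\<Sum>i. \<integral>\<^sup>+x\<in>{z i..z (Suc i)}. f x \<partial>lebesgue)"
    proof (intro suminf_cong)
      fix i
      have "(\<integral>\<^sup>+x\<in>J i. f x * indicator {\<alpha>..} x \<partial>lebesgue) = (\<integral>\<^sup>+x\<in>J i. f x \<partial>lebesgue)"
        using z_ge[of i] by (intro nn_integral_cong) (auto simp: J_def split: split_indicator)
      then show "(\<integral>\<^sup>+x\<in>J i. f x * indicator {\<alpha>..} x \<partial>lebesgue) = (\<integral>\<^sup>+x\<in>{z i..z (Suc i)}. f x \<partial>lebesgue)"
        unfolding J_def nn_integral_lebesgue_Icc_Ico .
    qed
    finally show ?thesis .
  qed
  have v0: "0 \<le> v i" for i using v[of i] by (simp add: R_def)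
  have sum_v: "(\<Sum>i. ennreal (v i)) = (\<integral>\<^sup>+x\<in>{\<alpha>..}. ennreal (V x) \<partial>lebesgue)"
  proof -
    have "(\<integral>\<^sup>+x\<in>{\<alpha>..}. ennreal (V x) \<partial>lebesgue) = (\<Sum>i. \<integral>\<^sup>+x\<in>{z i..z (Suc i)}. ennreal (V x) \<partial>lebesgue)"
      by (intro split borel_measurable_times_ennreal borel_measurable_indicator
          measurable_compose[OF V(1) measurable_ennreal]) simp
    then show ?thesis using v by (simp add: R_def)
  qed
  have main: "(\<integral>\<^sup>+x\<in>{\<alpha>..}. ennreal (V x * (norm (u x))\<^sup>2) \<partial>lebesgue) \<le>
      (\<integral>\<^sup>+x\<in>{\<alpha>..}. ennreal ((norm (g x))\<^sup>2) \<partial>lebesgue) +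
      ennreal E * (\<integral>\<^sup>+x\<in>{\<alpha>..}. ennreal ((norm (u x))\<^sup>2) \<partial>lebesgue)"
    if E: "0 \<le> E" and u: "primitive_on {\<alpha>..} u g" and u0: "\<And>i. E < 4 * (v i)\<^sup>2 \<Longrightarrow> u (z i) = 0" for E u g
  proof -
    define u' where "u' x = indicat_real {\<alpha>..} x *\<^sub>R u x" for x
    define g' where "g' x = indicat_real {\<alpha>..} x *\<^sub>R g x" for x
    have [measurable]: "u' \<in> borel_measurable lebesgue" "g' \<in> borel_measurable lebesgue"
      using primitive_on_measurable_atLeast[OF u]
      unfolding u'_def[abs_def] g'_def[abs_def] set_borel_measurable_def .
    note V(1)[measurable]
    have mu: "(\<lambda>x. ennreal ((norm (u x))\<^sup>2) * indicator {\<alpha>..} x) \<in> borel_measurable lebesgue"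
    proof -
      have "(\<lambda>x. ennreal ((norm (u x))\<^sup>2) * indicator {\<alpha>..} x) = (\<lambda>x. ennreal ((norm (u' x))\<^sup>2))"
        by (auto simp: u'_def split: split_indicator)
      then show ?thesis by simp
    qed
    have mV: "(\<lambda>x. ennreal (V x * (norm (u x))\<^sup>2) * indicator {\<alpha>..} x) \<in> borel_measurable lebesgue"
    proof -
      have "(\<lambda>x. ennreal (V x * (norm (u x))\<^sup>2) * indicator {\<alpha>..} x) = (\<lambda>x. ennreal (V x * (norm (u' x))\<^sup>2))"
        by (auto simp: u'_def split: split_indicator)
      then show ?thesis by simp
    qed
    have mg: "(\<lambda>x. ennreal ((norm (g x))\<^sup>2) * indicator {\<alpha>..} x) \<in> borel_measurable lebesgue"
    proof -
      have "(\<lambda>x. ennreal ((norm (g x))\<^sup>2) * indicator {\<alpha>..} x) = (\<lambda>x. ennreal ((norm (g' x))\<^sup>2))"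
        by (auto simp: g'_def split: split_indicator)
      then show ?thesis by simp
    qed
    have piece: "(\<integral>\<^sup>+x\<in>{z i..z (Suc i)}. ennreal (V x * (norm (u x))\<^sup>2) \<partial>lebesgue) \<le>
      (\<integral>\<^sup>+x\<in>{z i..z (Suc i)}. ennreal ((norm (g x))\<^sup>2) \<partial>lebesgue) +
      ennreal E * (\<integral>\<^sup>+x\<in>{z i..z (Suc i)}. ennreal ((norm (u x))\<^sup>2) \<partial>lebesgue)" for i
    proof -
      have ui: "primitive_on {z i..z (Suc i)} u g"
        using z_ge[of i] by (intro primitive_on_subset[OF u]) auto
      have Ri: "(\<integral>\<^sup>+t\<in>{z i..z (Suc i)}. ennreal (V t) \<partial>lebesgue) \<le> ennreal (v i)"
        "v i = 0 \<or> v i * (z (Suc i) - z i) = 1 / 2"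
        using v[of i] by (auto simp: R_def)
      show ?thesis
      proof (cases "E < 4 * (v i)\<^sup>2")
        case True
        have "(\<integral>\<^sup>+x\<in>{z i..z (Suc i)}. ennreal (V x * (norm (u x))\<^sup>2) \<partial>lebesgue)
            \<le> (\<integral>\<^sup>+x\<in>{z i..z (Suc i)}. ennreal ((norm (g x))\<^sup>2) \<partial>lebesgue)"
          using Ri v0[of i] by (intro potential_bound_vanishing[OF ui z_inc u0[OF True] V, of "v i"]) auto
        then show ?thesis by (rule order_trans) simp
      next
        case False
        have "(\<integral>\<^sup>+x\<in>{z i..z (Suc i)}. ennreal (V x * (norm (u x))\<^sup>2) \<partial>lebesgue) \<le>
          (\<integral>\<^sup>+x\<in>{z i..z (Suc i)}. ennreal ((norm (g x))\<^sup>2) \<partial>lebesgue) +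
          ennreal (4 * (v i)\<^sup>2) * (\<integral>\<^sup>+x\<in>{z i..z (Suc i)}. ennreal ((norm (u x))\<^sup>2) \<partial>lebesgue)"
          by (rule potential_bound[OF ui z_inc V Ri(1) v0 Ri(2)])
        also have "\<dots> \<le> (\<integral>\<^sup>+x\<in>{z i..z (Suc i)}. ennreal ((norm (g x))\<^sup>2) \<partial>lebesgue) +
          ennreal E * (\<integral>\<^sup>+x\<in>{z i..z (Suc i)}. ennreal ((norm (u x))\<^sup>2) \<partial>lebesgue)"
          using False by (intro add_left_mono mult_right_mono ennreal_leI) auto
        finally show ?thesis .
      qed
    qed
    have "(\<integral>\<^sup>+x\<in>{\<alpha>..}. ennreal (V x * (norm (u x))\<^sup>2) \<partial>lebesgue) \<le>
      (\<Sum>i. (\<integral>\<^sup>+x\<in>{z i..z (Suc i)}. ennreal ((norm (g x))\<^sup>2) \<partial>lebesgue) +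
        ennreal E * (\<integral>\<^sup>+x\<in>{z i..z (Suc i)}. ennreal ((norm (u x))\<^sup>2) \<partial>lebesgue))"
      unfolding split[OF mV] by (intro suminf_le piece) auto
    also have "\<dots> = (\<Sum>i. \<integral>\<^sup>+x\<in>{z i..z (Suc i)}. ennreal ((norm (g x))\<^sup>2) \<partial>lebesgue) +
        ennreal E * (\<Sum>i. \<integral>\<^sup>+x\<in>{z i..z (Suc i)}. ennreal ((norm (u x))\<^sup>2) \<partial>lebesgue)"
      by (subst suminf_add[symmetric]) auto
    finally show ?thesis unfolding split[OF mu] split[OF mg] .
  qed
  show ?thesis
  proof (rule exI[of _ z], rule exI[of _ v], intro conjI allI impI)
    show "\<alpha> \<le> z i" "0 \<le> v i" for i by (fact z_ge v0)+
  next
    fix E u g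
    assume *: "0 \<le> E \<and> primitive_on {\<alpha>..} u g \<and> (\<forall>i. E < 4 * (v i)\<^sup>2 \<longrightarrow> u (z i) = 0)"
    show "(\<integral>\<^sup>+x\<in>{\<alpha>..}. ennreal (V x * (norm (u x))\<^sup>2) \<partial>lebesgue) \<le>
      (\<integral>\<^sup>+x\<in>{\<alpha>..}. ennreal ((norm (g x))\<^sup>2) \<partial>lebesgue) +
      ennreal E * (\<integral>\<^sup>+x\<in>{\<alpha>..}. ennreal ((norm (u x))\<^sup>2) \<partial>lebesgue)"
      by (rule main) (use * in simp_all)
  qed (fact sum_v)
qed

section \<open>Generations and rays of a symmetric tree\<close>

lemma walk_in_verts: "walk G u p v \<Longrightarrow> v \<in> verts G"
  by (induction p arbitrary: u) auto

context rooted_metric_tree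
begin

lemma walk_start_in_verts: "walk G u p v \<Longrightarrow> u \<in> verts G"
  by (cases p) (auto intro: src_in tgt_in)

lemma walk_append: "walk G u (p @ q) w \<longleftrightarrow> (\<exists>v. walk G u p v \<and> walk G v q w)"
proof (induction p arbitrary: u)
  case Nil
  then show ?case using walk_start_in_verts[of u q w] by auto
qed auto

definition root_path :: "'v \<Rightarrow> 'e list" where
  "root_path v = (THE p. is_path G (root G) p v)"

lemma root_path: "v \<in> verts G \<Longrightarrow> is_path G (root G) (root_path v) v"
  unfolding root_path_def by (rule theI'[OF unique_path[OF root_in]])

lemma root_path_eqI:
  assumes "is_path G (root G) p v"
  shows "root_path v = p"
proof -
  have "v \<in> verts G" using assms walk_in_verts[of G "root G" p v] by (simp add: is_path_def)
  from the1_equality[OF unique_path[OF root_in this] assms] show ?thesis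
    by (simp add: root_path_def)
qed

lemma vertex_dist_eq: "vertex_dist G v = (\<Sum>e\<leftarrow>root_path v. real_of_ereal (len G e))"
  by (simp add: vertex_dist_def root_path_def)

lemma root_path_root: "root_path (root G) = []"
  by (rule root_path_eqI) (simp add: is_path_def root_in)

lemma real_len_pos: "e \<in> edges G \<Longrightarrow> len G e < \<infinity> \<Longrightarrow> 0 < real_of_ereal (len G e)"
  using len_pos[of e] by (cases "len G e") auto

text \<open>Suppose \<open>e\<close> already lay on the path to its source. Passed forwards, it
  would leave a proper initial segment as a second path to the source; passed backwards, it would
  put the source farther from the root than the target, against \<open>outward\<close>.\<close>

lemma root_path_tgt:
  assumes e: "e \<in> edges G" "len G e < \<infinity>"
  shows "root_path (tgt G e) = root_path (src G e) @ [e]"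
proof (rule root_path_eqI)
  define p where "p = root_path (src G e)"
  have p: "walk G (root G) p (src G e)" "distinct p"
    using root_path[OF src_in[OF e(1)]] by (auto simp: is_path_def p_def)
  have "e \<notin> set p"
  proof
    assume "e \<in> set p"
    then obtain p1 p2 where p12: "p = p1 @ e # p2" by (auto simp: in_set_conv_decomp)
    then obtain w where w: "walk G (root G) p1 w" "walk G w (e # p2) (src G e)"
      using p(1) by (auto simp: walk_append)
    then consider "src G e = w" | "tgt G e = w" by auto
    then show False
    proof cases
      case 1
      then have "is_path G (root G) p1 (src G e)" using w p(2) p12 by (auto simp: is_path_def)
      then have "p = p1" unfolding p_def by (rule root_path_eqI)
      then show False using p12 by simp
    next
      case 2
      have "is_path G (root G) p1 (tgt G e)" using w p(2) p12 2 by (auto simp: is_path_def)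
      then have tgt: "root_path (tgt G e) = p1" by (rule root_path_eqI)
      have "walk G (root G) (p1 @ [e]) (src G e)"
        unfolding walk_append using w(1) e 2 src_in[OF e(1)] by (intro exI[of _ w]) auto
      then have "is_path G (root G) (p1 @ [e]) (src G e)" using p(2) p12 by (auto simp: is_path_def)
      then have "root_path (src G e) = p1 @ [e]" by (rule root_path_eqI)
      then have "vertex_dist G (src G e) = vertex_dist G (tgt G e) + real_of_ereal (len G e)"
        by (simp add: vertex_dist_eq tgt)
      then show False using outward[OF e] real_len_pos[OF e] by simp
    qed
  qed
  moreover have "walk G (root G) (p @ [e]) (tgt G e)"
    unfolding walk_append using p(1) e tgt_in[OF e] by (intro exI[of _ "src G e"]) auto
  ultimately show "is_path G (root G) (root_path (src G e) @ [e]) (tgt G e)"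
    using p(2) by (simp add: is_path_def p_def)
qed

lemma vertex_dist_tgt:
  "e \<in> edges G \<Longrightarrow> len G e < \<infinity> \<Longrightarrow> vertex_dist G (tgt G e) = vertex_dist G (src G e) + real_of_ereal (len G e)"
  by (simp add: vertex_dist_eq root_path_tgt)

text \<open>The last edge of the root path is passed forwards: otherwise
  \<open>root_path_tgt\<close> would make the path to its target two edges longer than
  itself.\<close>

lemma vertex_cases:
  assumes v: "v \<in> verts G" and "v \<noteq> root G"
  obtains e where "e \<in> edges G" "len G e < \<infinity>" "tgt G e = v"
proof -
  have p: "walk G (root G) (root_path v) v" "distinct (root_path v)"
    using root_path[OF v] by (auto simp: is_path_def)
  have "root_path v \<noteq> []" using p(1) assms(2) by auto
  then obtain p1 e where p1: "root_path v = p1 @ [e]" by (metis rev_exhaust)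
  then obtain w where w: "walk G (root G) p1 w" "walk G w [e] v"
    using p(1) by (auto simp: walk_append)
  then have e: "e \<in> edges G" "len G e < \<infinity>" and "src G e = w \<and> tgt G e = v \<or> tgt G e = w \<and> src G e = v" by auto
  then show ?thesis
  proof (elim disjE conjE)
    assume "tgt G e = w" "src G e = v"
    moreover have "root_path w = p1" using w(1) p(2) p1 by (intro root_path_eqI) (auto simp: is_path_def)
    ultimately have "p1 = p1 @ [e] @ [e]" using root_path_tgt[OF e] p1 by simp
    then show ?thesis by simp
  qed (use that e in auto)
qed

lemma tgt_inject:
  assumes "e \<in> edges G" "len G e < \<infinity>" "e' \<in> edges G" "len G e' < \<infinity>" "tgt G e = tgt G e'"
  shows "e = e'"
proof -
  have "root_path (src G e) @ [e] = root_path (src G e') @ [e']"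
    unfolding root_path_tgt[OF assms(1,2), symmetric] root_path_tgt[OF assms(3,4), symmetric] assms(5) ..
  then show ?thesis by simp
qed

text \<open>A path of k edges has k vertices besides its end, so this is the generation of the
  vertex \<open>src G e\<close>.\<close>

definition edge_gen :: "'e \<Rightarrow> nat" where
  "edge_gen e = length (root_path (src G e))"

definition gen_edges :: "nat \<Rightarrow> 'e set" where
  "gen_edges k = {e \<in> edges G. edge_gen e = k}"

lemma gen_edges_0: "gen_edges 0 = out_edges G (root G)"
proof -
  have "root_path (src G e) = [] \<longleftrightarrow> src G e = root G" if "e \<in> edges G" for e
    using root_path[OF src_in[OF that]] root_path_root by (auto simp: is_path_def)
  then show ?thesis by (auto simp: gen_edges_def edge_gen_def out_edges_def)
qed

lemma edge_gen_out:
  assumes "e \<in> gen_edges k" "len G e < \<infinity>" "f \<in> out_edges G (tgt G e)"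
  shows "f \<in> gen_edges (Suc k)"
proof -
  have "e \<in> edges G" "length (root_path (src G e)) = k" "f \<in> edges G" and f: "src G f = tgt G e"
    using assms by (auto simp: gen_edges_def edge_gen_def out_edges_def)
  then show ?thesis
    using root_path_tgt[OF _ assms(2)] by (simp add: gen_edges_def edge_gen_def f)
qed

lemma gen_edges_Suc:
  "gen_edges (Suc k) = (\<Union>e\<in>{e \<in> gen_edges k. len G e < \<infinity>}. out_edges G (tgt G e))"
proof (intro equalityI subsetI)
  fix f assume f: "f \<in> gen_edges (Suc k)"
  then have fe: "f \<in> edges G" "length (root_path (src G f)) = Suc k"
    by (auto simp: gen_edges_def edge_gen_def)
  then have "src G f \<noteq> root G" using root_path_root by auto
  then obtain e where e: "e \<in> edges G" "len G e < \<infinity>" "tgt G e = src G f"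
    using vertex_cases src_in[OF fe(1)] by blast
  then have "e \<in> gen_edges k"
    using root_path_tgt[OF e(1,2)] fe(2) by (simp add: gen_edges_def edge_gen_def)
  then show "f \<in> (\<Union>e\<in>{e \<in> gen_edges k. len G e < \<infinity>}. out_edges G (tgt G e))"
    using e fe by (auto simp: out_edges_def)
qed (use edge_gen_out in auto)

end

context symmetric_tree
begin

lemma out_edges_nonempty: "v \<in> verts G \<Longrightarrow> out_edges G v \<noteq> {}"
proof (cases "v = root G")
  case True
  then show ?thesis using root_branching by (metis card.empty zero_neq_one)
next
  case False
  assume "v \<in> verts G"
  from branching_ge_2[OF this False] show ?thesis by (metis card.empty not_numeral_le_zero)
qed

lemma finite_gen_edges: "finite (gen_edges k)"
proof (induction k)
  case 0
  then show ?case using gen_edges_0 finite_branching root_in by simp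
next
  case (Suc k)
  have "finite (out_edges G (tgt G e))" if "e \<in> gen_edges k" "len G e < \<infinity>" for e
    using that tgt_in by (intro finite_branching) (auto simp: gen_edges_def)
  then show ?case unfolding gen_edges_Suc using Suc by auto
qed

text \<open>The symmetry axioms compare vertices at equal distance from the root, not of equal
  generation. Induction along the incoming edges links the two: their sources are at equal distance,
  so their lengths agree.\<close>

lemma vertex_dist_gen:
  assumes "u \<in> verts G" "v \<in> verts G" "length (root_path u) = length (root_path v)"
  shows "vertex_dist G u = vertex_dist G v"
  using assms
proof (induction "length (root_path v)" arbitrary: u v)
  case 0
  have "w = root G" if "w \<in> verts G" "root_path w = []" for w
    using root_path[OF that(1)] that(2) by (auto simp: is_path_def)
  then have "u = root G" "v = root G" using 0 by auto
  then show ?case by simp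
next
  case (Suc k)
  have ex: "\<exists>e. e \<in> edges G \<and> len G e < \<infinity> \<and> tgt G e = w" if "w \<in> verts G" "length (root_path w) = Suc k" for w
  proof -
    have "w \<noteq> root G" using that(2) root_path_root by auto
    then show ?thesis by (rule vertex_cases[OF that(1)]) blast
  qed
  obtain e where e: "e \<in> edges G" "len G e < \<infinity>" "tgt G e = u"
    using ex[of u] Suc by auto
  obtain f where f: "f \<in> edges G" "len G f < \<infinity>" "tgt G f = v"
    using ex[of v] Suc by auto
  have k: "k = length (root_path (src G f))" "length (root_path (src G e)) = length (root_path (src G f))"
    using root_path_tgt[OF e(1,2)] root_path_tgt[OF f(1,2)] e(3) f(3) Suc(2,5) by auto
  have d: "vertex_dist G (src G e) = vertex_dist G (src G f)"
    by (rule Suc.hyps(1)[OF k(1) src_in[OF e(1)] src_in[OF f(1)] k(2)])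
  then have "len G e = len G f"
    using e f src_in by (intro symmetric_len[of "src G e" "src G f"]) (auto simp: out_edges_def)
  then show ?case using d vertex_dist_tgt[OF e(1,2)] vertex_dist_tgt[OF f(1,2)] e(3) f(3) by simp
qed

lemma gen_edges_same:
  assumes "e \<in> gen_edges k" "f \<in> gen_edges k"
  shows "vertex_dist G (src G e) = vertex_dist G (src G f)" "len G e = len G f"
proof -
  have v: "src G e \<in> verts G" "src G f \<in> verts G" using assms src_in by (auto simp: gen_edges_def)
  show d: "vertex_dist G (src G e) = vertex_dist G (src G f)"
    using assms v by (intro vertex_dist_gen) (auto simp: gen_edges_def edge_gen_def)
  show "len G e = len G f"
    using assms v d by (intro symmetric_len[of "src G e" "src G f"]) (auto simp: out_edges_def gen_edges_def)
qed

text \<open>By symmetry all edges in the generation of \<open>e\<close> are half-lines, so there is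
  no later generation, and every generation is finite.\<close>

lemma finite_edges_if_infinite_len:
  assumes "e \<in> edges G" "len G e = \<infinity>"
  shows "finite (edges G)"
proof -
  define k where "k = edge_gen e"
  have e: "e \<in> gen_edges k" using assms by (simp add: k_def gen_edges_def)
  have "gen_edges (Suc k) = {}"
    unfolding gen_edges_Suc using gen_edges_same(2)[OF e] assms(2) by auto
  then have empty: "gen_edges (Suc k + j) = {}" for j
    by (induction j) (auto simp: gen_edges_Suc)
  have "f \<in> (\<Union>j\<le>k. gen_edges j)" if "f \<in> edges G" for f
  proof -
    have f: "f \<in> gen_edges (edge_gen f)" using that by (simp add: gen_edges_def)
    have "edge_gen f \<le> k"
    proof (rule ccontr)
      assume "\<not> edge_gen f \<le> k"
      then obtain j where "edge_gen f = Suc k + j" by (metis add_Suc not_less_eq_eq le_iff_add)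
      then show False using f empty by auto
    qed
    then show ?thesis using f by blast
  qed
  then have "edges G \<subseteq> (\<Union>j\<le>k. gen_edges j)" by blast
  then show ?thesis by (rule finite_subset) (auto simp: finite_gen_edges)
qed

end

section \<open>Excluding half-lines for d > 1, and the radii of the generations\<close>

lemma global_dimension_bounds:
  assumes "global_dimension G d"
  obtains c C where "0 < c" "0 < C" "\<And>r. 0 \<le> r \<Longrightarrow> c * (1 + r) powr (d - 1) \<le> real (g0 G r)"
    "\<And>r. 0 \<le> r \<Longrightarrow> real (g0 G r) \<le> C * (1 + r) powr (d - 1)"
proof -
  define q where "q r = ereal (real (g0 G r) / (1 + r) powr (d - 1))" for r
  have inf: "0 < (INF r\<in>{0..}. q r)" and sup: "(SUP r\<in>{0..}. q r) < \<infinity>"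
    using assms by (auto simp: global_dimension_def q_def)
  obtain c where c: "0 < ereal c" "ereal c < (INF r\<in>{0..}. q r)"
    using ereal_dense2[OF inf] by blast
  have lower: "c * (1 + r) powr (d - 1) \<le> real (g0 G r)" if "0 \<le> r" for r
  proof -
    have "ereal c \<le> q r" using that c(2) by (meson INF_lower atLeast_iff less_imp_le order_trans)
    then show ?thesis using that by (simp add: q_def field_simps)
  qed
  obtain C where C: "(SUP r\<in>{0..}. q r) < ereal C" using ereal_dense2[OF sup] by blast
  have upper: "real (g0 G r) \<le> max C 1 * (1 + r) powr (d - 1)" if "0 \<le> r" for r
  proof -
    have "q r \<le> ereal C" using that C by (meson SUP_upper atLeast_iff less_imp_le order_trans)
    then have "real (g0 G r) \<le> C * (1 + r) powr (d - 1)" using that by (simp add: q_def field_simps)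
    also have "\<dots> \<le> max C 1 * (1 + r) powr (d - 1)" by (intro mult_right_mono) auto
    finally show ?thesis .
  qed
  show thesis using that[of c "max C 1"] c lower upper by simp
qed

text \<open>With a half-line the graph would be finite and \<open>g0\<close> bounded, whereas d > 1
  forces \<open>g0\<close> to grow at least like a positive power of the distance.\<close>

lemma (in symmetric_tree) len_finite:
  assumes gd: "global_dimension G d" and d: "1 < d" and e: "e \<in> edges G"
  shows "len G e < \<infinity>"
proof (rule ccontr)
  assume "\<not> len G e < \<infinity>"
  then have fin: "finite (edges G)" using finite_edges_if_infinite_len[OF e] by simp
  have "verts G \<subseteq> insert (root G) (tgt G ` edges G)" using vertex_cases by blast
  then have finv: "finite (verts G)" using fin finite_subset by blast
  define N where "N = card (verts G) + card (edges G)"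
  have le: "g0 G s \<le> N" for s
  proof -
    have "{x \<in> points G. root_dist G x = s} \<subseteq> Vertex ` verts G \<union> (\<lambda>e. Inner e (s - vertex_dist G (src G e))) ` edges G"
      by (auto simp: points_def)
    then have "g0 G s \<le> card (Vertex ` verts G \<union> (\<lambda>e. Inner e (s - vertex_dist G (src G e))) ` edges G)"
      unfolding g0_def using fin finv by (intro card_mono) auto
    also have "\<dots> \<le> N" unfolding N_def
      by (intro order_trans[OF card_Un_le] add_mono card_image_le fin finv)
    finally show ?thesis .
  qed
  obtain c where c: "0 < c" "\<And>r. 0 \<le> r \<Longrightarrow> c * (1 + r) powr (d - 1) \<le> real (g0 G r)"
    by (rule global_dimension_bounds[OF gd]) (rule that)
  \<comment> \<open>Chosen such that \<open>c * y\<close> exceeds \<open>N\<close>; the radius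
    \<open>r\<close> then solves \<open>(1 + r) powr (d - 1) = y\<close>.\<close>
  define y where "y = max 1 ((real N + 1) / c)"
  define r where "r = y powr (1 / (d - 1)) - 1"
  have y: "1 \<le> y" "(real N + 1) / c \<le> y" by (simp_all add: y_def)
  have "1 \<le> y powr (1 / (d - 1))" using d y(1) by (intro ge_one_powr_ge_zero) simp_all
  then have r: "0 \<le> r" by (simp add: r_def)
  have "(1 + r) powr (d - 1) = y" using d y(1) by (simp add: r_def powr_powr)
  then have "c * y \<le> real (g0 G r)" using c(2)[OF r] by simp
  also have "\<dots> \<le> real N" using le by simp
  finally have "c * y \<le> real N" .
  moreover have "real N + 1 \<le> c * y" using c(1) y(2) by (simp add: pos_divide_le_eq mult.commute)
  ultimately show False by linarith
qed

locale finite_length_tree = symmetric_tree G for G :: "('v, 'e) rooted_graph" +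
  assumes finite_len: "e \<in> edges G \<Longrightarrow> len G e < \<infinity>"
begin

lemma gen_edges_edges: "e \<in> gen_edges k \<Longrightarrow> e \<in> edges G"
  by (simp add: gen_edges_def)

lemma gen_edges_Suc': "gen_edges (Suc k) = (\<Union>e\<in>gen_edges k. out_edges G (tgt G e))"
  unfolding gen_edges_Suc using finite_len by (auto simp: gen_edges_def)

lemma tgt_verts: "e \<in> edges G \<Longrightarrow> tgt G e \<in> verts G"
  using tgt_in finite_len by blast

lemma gen_edges_nonempty: "gen_edges k \<noteq> {}"
proof (induction k)
  case 0
  then show ?case using gen_edges_0 out_edges_nonempty root_in by simp
next
  case (Suc k)
  then obtain e where "e \<in> gen_edges k" by blast
  then show ?case
    unfolding gen_edges_Suc' using out_edges_nonempty[OF tgt_verts[OF gen_edges_edges]] by blast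
qed

text \<open>The numbers r_k of the branching function; by \<open>gen_edges_same\<close> the choice
  of the edge is immaterial.\<close>

definition radius :: "nat \<Rightarrow> real" where
  "radius k = vertex_dist G (src G (SOME e. e \<in> gen_edges k))"

lemma vertex_dist_src_gen: "e \<in> gen_edges k \<Longrightarrow> vertex_dist G (src G e) = radius k"
  unfolding radius_def by (rule gen_edges_same(1)) (auto intro: someI)

lemma vertex_dist_tgt_gen:
  assumes e: "e \<in> gen_edges k"
  shows "vertex_dist G (tgt G e) = radius (Suc k)"
proof -
  obtain f where f: "f \<in> out_edges G (tgt G e)"
    using out_edges_nonempty[OF tgt_verts[OF gen_edges_edges[OF e]]] by blast
  then have "f \<in> gen_edges (Suc k)" using e by (auto simp: gen_edges_Suc')
  moreover have "src G f = tgt G e" using f by (simp add: out_edges_def)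
  ultimately show ?thesis using vertex_dist_src_gen[of f "Suc k"] by simp
qed

lemma len_gen:
  assumes e: "e \<in> gen_edges k"
  shows "len G e = ereal (radius (Suc k) - radius k)"
proof -
  have ed: "e \<in> edges G" using e by (rule gen_edges_edges)
  have "real_of_ereal (len G e) = radius (Suc k) - radius k"
    using vertex_dist_tgt[OF ed finite_len[OF ed]] vertex_dist_src_gen[OF e] vertex_dist_tgt_gen[OF e] by simp
  then show ?thesis using finite_len[OF ed] len_pos[OF ed] by (cases "len G e") auto
qed

lemma radius_less_Suc: "radius k < radius (Suc k)"
proof -
  obtain e where e: "e \<in> gen_edges k" using gen_edges_nonempty by blast
  then show ?thesis using len_pos[OF gen_edges_edges[OF e]] by (simp add: len_gen[OF e] zero_ereal_def)
qed

lemma radius_strict_mono: "strict_mono radius"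
  using radius_less_Suc by (simp add: strict_mono_Suc_iff)

lemma radius_less_iff [simp]: "radius i < radius j \<longleftrightarrow> i < j"
  using radius_strict_mono by (rule strict_mono_less)

lemma radius_le_iff [simp]: "radius i \<le> radius j \<longleftrightarrow> i \<le> j"
  using radius_strict_mono by (rule strict_mono_less_eq)

lemma radius_0: "radius 0 = 0"
proof -
  obtain e where e: "e \<in> gen_edges 0" using gen_edges_nonempty by blast
  then have "src G e = root G" by (simp add: gen_edges_0 out_edges_def)
  then show ?thesis using vertex_dist_src_gen[OF e] by (simp add: vertex_dist_eq root_path_root)
qed

lemma radius_nonneg: "0 \<le> radius k"
  using radius_le_iff[of 0 k] radius_0 by simp

lemma vertex_src:
  assumes "v \<in> verts G"
  obtains k e where "e \<in> gen_edges k" "src G e = v"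
proof -
  obtain e where "e \<in> out_edges G v" using out_edges_nonempty[OF assms] by blast
  then show thesis using that[of e "edge_gen e"] by (auto simp: gen_edges_def out_edges_def)
qed

lemma radius_unbounded: "\<exists>k. R < radius k"
proof (rule ccontr)
  assume "\<not> (\<exists>k. R < radius k)"
  then have R: "radius k \<le> R" for k by (simp add: not_less)
  have "root_dist G x \<le> R" if "x \<in> points G" for x
  proof (cases x)
    case (Vertex v)
    then have "v \<in> verts G" using that by (auto simp: points_def)
    then obtain k e where "e \<in> gen_edges k" "src G e = v" by (rule vertex_src)
    then show ?thesis using vertex_dist_src_gen R Vertex by auto
  next
    case (Inner e t)
    then have e: "e \<in> edges G" "ereal t < len G e" using that by (auto simp: points_def)
    then have e': "e \<in> gen_edges (edge_gen e)" by (simp add: gen_edges_def)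
    have "radius (edge_gen e) + t < radius (Suc (edge_gen e))"
      using e(2) by (simp add: len_gen[OF e'] algebra_simps)
    then show ?thesis using R[of "Suc (edge_gen e)"] vertex_dist_src_gen[OF e'] Inner by simp
  qed
  then show False using unbounded by (auto simp: bdd_above_def)
qed

text \<open>The generation intervals are closed on the left here, while \<open>g0\<close> is
  constant on intervals closed on the right. The two conventions differ only at the radii, a null
  set that is excluded by \<open>AE_neq_radius\<close>.\<close>

definition gen_index :: "real \<Rightarrow> nat" where
  "gen_index s = (LEAST j. s < radius (Suc j))"

lemma gen_index:
  assumes "0 \<le> s"
  shows "radius (gen_index s) \<le> s" "s < radius (Suc (gen_index s))"
proof -
  obtain k where "s < radius k" using radius_unbounded by blast
  then have "s < radius (Suc k)" using radius_less_Suc[of k] by linarith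
  then show "s < radius (Suc (gen_index s))"
    unfolding gen_index_def by (rule LeastI[of "\<lambda>j. s < radius (Suc j)"])
  show "radius (gen_index s) \<le> s"
  proof (cases "gen_index s")
    case 0
    then show ?thesis using assms radius_0 by simp
  next
    case (Suc j)
    then have "j < gen_index s" by simp
    then have "\<not> s < radius (Suc j)" unfolding gen_index_def by (rule not_less_Least)
    then show ?thesis using Suc by simp
  qed
qed

lemma gen_index_eqI:
  assumes "radius j \<le> s" "s < radius (Suc j)"
  shows "gen_index s = j"
proof -
  have s: "0 \<le> s" using radius_nonneg[of j] assms(1) by simp
  have "radius j < radius (Suc (gen_index s))" "radius (gen_index s) < radius (Suc j)"
    using gen_index[OF s] assms by linarith+
  then show ?thesis by simp
qed

section \<open>Numbers of descendants, ancestors and rays\<close>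

lemma card_out_gen:
  assumes "e \<in> gen_edges k" "f \<in> gen_edges k"
  shows "card (out_edges G (tgt G e)) = card (out_edges G (tgt G f))"
  using assms vertex_dist_tgt_gen
  by (intro symmetric_branching tgt_verts gen_edges_edges) simp_all

lemma out_edges_tgt_disjoint:
  assumes "e \<in> edges G" "e' \<in> edges G" "e \<noteq> e'"
  shows "out_edges G (tgt G e) \<inter> out_edges G (tgt G e') = {}"
  using tgt_inject[OF assms(1) finite_len[OF assms(1)] assms(2) finite_len[OF assms(2)]] assms(3)
  by (auto simp: out_edges_def)

lemma card_gen_edges_Suc:
  assumes "e \<in> gen_edges k"
  shows "card (gen_edges (Suc k)) = card (gen_edges k) * card (out_edges G (tgt G e))"
proof -
  have "card (gen_edges (Suc k)) = (\<Sum>f\<in>gen_edges k. card (out_edges G (tgt G f)))"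
    unfolding gen_edges_Suc'
    using finite_gen_edges finite_branching[OF tgt_verts] out_edges_tgt_disjoint
    by (intro card_UN_disjoint) (auto simp: gen_edges_def)
  also have "\<dots> = (\<Sum>f\<in>gen_edges k. card (out_edges G (tgt G e)))"
    using card_out_gen[OF _ assms] by (intro sum.cong) auto
  finally show ?thesis by simp
qed

lemma card_gen_edges_pos: "0 < card (gen_edges k)"
  using gen_edges_nonempty finite_gen_edges by (simp add: card_gt_0_iff)

lemma card_gen_edges_mono: "i \<le> j \<Longrightarrow> card (gen_edges i) \<le> card (gen_edges j)"
proof (rule lift_Suc_mono_le[where f = "\<lambda>k. card (gen_edges k)"])
  fix k
  obtain e where e: "e \<in> gen_edges k" using gen_edges_nonempty by blast
  have "0 < card (out_edges G (tgt G e))"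
    using out_edges_nonempty[OF tgt_verts] finite_branching[OF tgt_verts] gen_edges_edges[OF e]
    by (simp add: card_gt_0_iff)
  then show "card (gen_edges k) \<le> card (gen_edges (Suc k))"
    unfolding card_gen_edges_Suc[OF e] by simp
qed

text \<open>The root path of the source with \<open>f\<close> appended lists one edge for each
  generation from 0 up to that of \<open>f\<close>, so position \<open>j\<close> holds the ancestor
  of generation \<open>j\<close>.\<close>

definition ancestor :: "nat \<Rightarrow> 'e \<Rightarrow> 'e" where
  "ancestor j f = (root_path (src G f) @ [f]) ! j"

lemma ancestor_self: "f \<in> gen_edges k \<Longrightarrow> ancestor k f = f"
  by (auto simp: ancestor_def gen_edges_def edge_gen_def nth_append)

lemma ancestor_out:
  assumes "g \<in> gen_edges k" "f \<in> out_edges G (tgt G g)" "j \<le> k"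
  shows "ancestor j f = ancestor j g"
proof -
  have g: "g \<in> edges G" "length (root_path (src G g)) = k"
    using assms(1) by (auto simp: gen_edges_def edge_gen_def)
  have f: "src G f = tgt G g" using assms(2) by (simp add: out_edges_def)
  show ?thesis
    using g(2) assms(3) unfolding ancestor_def f root_path_tgt[OF g(1) finite_len[OF g(1)]]
    by (simp add: nth_append)
qed

lemma ancestor_gen: "f \<in> gen_edges k \<Longrightarrow> j \<le> k \<Longrightarrow> ancestor j f \<in> gen_edges j"
proof (induction k arbitrary: f)
  case 0
  then show ?case using ancestor_self by simp
next
  case (Suc k)
  show ?case
  proof (cases "j = Suc k")
    case True
    then show ?thesis using ancestor_self Suc.prems by simp
  next
    case False
    then have j: "j \<le> k" using Suc.prems by simp
    obtain g where g: "g \<in> gen_edges k" "f \<in> out_edges G (tgt G g)"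
      using Suc.prems(1) by (auto simp: gen_edges_Suc')
    then show ?thesis using ancestor_out[OF g j] Suc.IH[OF g(1) j] by simp
  qed
qed

lemma ancestor_link: "f \<in> gen_edges k \<Longrightarrow> j < k \<Longrightarrow> src G (ancestor (Suc j) f) = tgt G (ancestor j f)"
proof (induction k arbitrary: f)
  case (Suc k)
  obtain g where g: "g \<in> gen_edges k" "f \<in> out_edges G (tgt G g)"
    using Suc.prems(1) by (auto simp: gen_edges_Suc')
  show ?case
  proof (cases "j = k")
    case True
    have "ancestor (Suc k) f = f" by (rule ancestor_self[OF Suc.prems(1)])
    moreover have "ancestor k f = g" using ancestor_out[OF g] ancestor_self[OF g(1)] by simp
    ultimately show ?thesis using g(2) True by (simp add: out_edges_def)
  next
    case False
    then have j: "j < k" using Suc.prems(2) by simp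
    have "ancestor (Suc j) f = ancestor (Suc j) g" "ancestor j f = ancestor j g"
      using j by (intro ancestor_out[OF g]; simp)+
    then show ?thesis using Suc.IH[OF g(1) j] by simp
  qed
qed simp

text \<open>By symmetry all edges of generation \<open>j\<close> have equally many descendants in
  generation \<open>J\<close>, namely the quotient of the two cardinalities. Multiplying out avoids
  a division in \<open>ennreal\<close>.\<close>

lemma ancestor_average:
  fixes h :: "'e \<Rightarrow> ennreal"
  assumes "k \<le> j" "j \<le> J"
  shows "(\<Sum>f\<in>{f\<in>gen_edges J. ancestor k f = e}. h (ancestor j f)) * of_nat (card (gen_edges j)) =
    of_nat (card (gen_edges J)) * (\<Sum>f\<in>{f\<in>gen_edges j. ancestor k f = e}. h f)"
  using assms(2)
proof (induction J rule: dec_induct)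
  case base
  have "(\<Sum>f\<in>{f\<in>gen_edges j. ancestor k f = e}. h (ancestor j f)) = (\<Sum>f\<in>{f\<in>gen_edges j. ancestor k f = e}. h f)"
    by (intro sum.cong) (auto simp: ancestor_self)
  then show ?case by (simp add: mult.commute)
next
  case (step J)
  obtain e0 where e0: "e0 \<in> gen_edges J" using gen_edges_nonempty by blast
  define b where "b = card (out_edges G (tgt G e0))"
  define D where "D = {f\<in>gen_edges J. ancestor k f = e}"
  have Dsub: "D \<subseteq> gen_edges J" by (auto simp: D_def)
  have "{f\<in>gen_edges (Suc J). ancestor k f = e} = (\<Union>g\<in>D. out_edges G (tgt G g))"
    using ancestor_out[of _ J _ k] assms(1) step.hyps by (auto simp: gen_edges_Suc' D_def)
  then have "(\<Sum>f\<in>{f\<in>gen_edges (Suc J). ancestor k f = e}. h (ancestor j f))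
      = (\<Sum>g\<in>D. \<Sum>f\<in>out_edges G (tgt G g). h (ancestor j f))"
  proof (simp only:, intro sum.UNION_disjoint ballI impI)
    show "finite D" using Dsub finite_gen_edges by (rule finite_subset)
    show "finite (out_edges G (tgt G i))" if "i \<in> D" for i
      using that Dsub by (intro finite_branching tgt_verts gen_edges_edges) auto
    show "out_edges G (tgt G i) \<inter> out_edges G (tgt G j) = {}" if "i \<in> D" "j \<in> D" "i \<noteq> j" for i j
      using that Dsub by (intro out_edges_tgt_disjoint) (auto dest: gen_edges_edges)
  qed
  also have "\<dots> = (\<Sum>g\<in>D. of_nat b * h (ancestor j g))"
  proof (intro sum.cong refl)
    fix g assume "g \<in> D"
    then have g: "g \<in> gen_edges J" using Dsub by blast
    have "(\<Sum>f\<in>out_edges G (tgt G g). h (ancestor j f)) = (\<Sum>f\<in>out_edges G (tgt G g). h (ancestor j g))"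
      using ancestor_out[OF g _ step.hyps(1)] by (intro sum.cong) auto
    then show "(\<Sum>f\<in>out_edges G (tgt G g). h (ancestor j f)) = of_nat b * h (ancestor j g)"
      using card_out_gen[OF g e0] by (simp add: b_def)
  qed
  also have "\<dots> = of_nat b * (\<Sum>g\<in>D. h (ancestor j g))" by (simp add: sum_distrib_left)
  finally show ?case
    using step.IH card_gen_edges_Suc[OF e0] by (simp add: D_def b_def mult.assoc) (simp add: ac_simps)
qed

text \<open>An arbitrary but fixed outgoing edge. It continues finite paths to infinite ones, and
  the chains it generates decompose the tree into rays.\<close>

definition child :: "'e \<Rightarrow> 'e" where
  "child e = (SOME f. f \<in> out_edges G (tgt G e))"

lemma child: "e \<in> edges G \<Longrightarrow> child e \<in> out_edges G (tgt G e)"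
  unfolding child_def using out_edges_nonempty[OF tgt_verts] by (simp add: some_in_eq)

lemma child_gen: "e \<in> gen_edges k \<Longrightarrow> child e \<in> gen_edges (Suc k)"
  using child[OF gen_edges_edges] by (auto simp: gen_edges_Suc')

lemma src_child: "e \<in> edges G \<Longrightarrow> src G (child e) = tgt G e"
  using child by (auto simp: out_edges_def)

lemma child_funpow_gen: "e \<in> gen_edges k \<Longrightarrow> (child ^^ i) e \<in> gen_edges (k + i)"
  by (induction i) (auto intro: child_gen)

definition is_ray :: "(nat \<Rightarrow> 'e) \<Rightarrow> bool" where
  "is_ray \<rho> \<longleftrightarrow> (\<forall>j. \<rho> j \<in> gen_edges j \<and> src G (\<rho> (Suc j)) = tgt G (\<rho> j))"

text \<open>Up to \<open>f\<close> the path is forced; beyond \<open>f\<close> it follows the fixed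
  children, so that its edges from \<open>f\<close> on are the iterates of
  \<open>child\<close>.\<close>

definition ray :: "'e \<Rightarrow> nat \<Rightarrow> 'e" where
  "ray f j = (if j \<le> edge_gen f then ancestor j f else (child ^^ (j - edge_gen f)) f)"

lemma is_ray_ray:
  assumes "f \<in> edges G"
  shows "is_ray (ray f)"
proof -
  define k where "k = edge_gen f"
  have f: "f \<in> gen_edges k" using assms by (simp add: k_def gen_edges_def)
  have "ray f j \<in> gen_edges j" for j
    using ancestor_gen[OF f, of j] child_funpow_gen[OF f, of "j - k"] by (auto simp: ray_def k_def)
  moreover have "src G (ray f (Suc j)) = tgt G (ray f j)" for j
  proof -
    consider "Suc j \<le> k" | "j = k" | "k < j" by linarith
    then show ?thesis
    proof cases
      case 1
      then show ?thesis using ancestor_link[OF f, of j] by (simp add: ray_def k_def)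
    next
      case 2
      then show ?thesis using ancestor_self[OF f] src_child[OF assms] by (simp add: ray_def k_def)
    next
      case 3
      then have "(child ^^ (Suc j - k)) f = child ((child ^^ (j - k)) f)"
        by (simp add: Suc_diff_le)
      then show ?thesis
        using 3 src_child[OF gen_edges_edges[OF child_funpow_gen[OF f, of "j - k"]]]
        by (simp add: ray_def k_def)
    qed
  qed
  ultimately show ?thesis by (simp add: is_ray_def)
qed

lemma is_ray_gen: "is_ray \<rho> \<Longrightarrow> \<rho> j \<in> gen_edges j"
  by (simp add: is_ray_def)

definition ray_point :: "(nat \<Rightarrow> 'e) \<Rightarrow> real \<Rightarrow> ('v, 'e) point" where
  "ray_point \<rho> s = edge_point G (\<rho> (gen_index s)) (s - radius (gen_index s))"

lemma ray_point_inner: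
  assumes "is_ray \<rho>" "radius j < s" "s < radius (Suc j)"
  shows "ray_point \<rho> s = Inner (\<rho> j) (s - radius j)"
  using assms gen_index_eqI[of j s] len_gen[OF is_ray_gen[OF assms(1)], of j]
  by (simp add: ray_point_def edge_point_def)

lemma ray_point_edge_point:
  assumes \<rho>: "is_ray \<rho>" and s: "radius j \<le> s" "s \<le> radius (Suc j)"
  shows "ray_point \<rho> s = edge_point G (\<rho> j) (s - radius j)"
proof (cases "s = radius (Suc j)")
  case True
  then have "gen_index s = Suc j" by (intro gen_index_eqI) auto
  then show ?thesis
    using \<rho> True len_gen[OF is_ray_gen[OF \<rho>], of j] radius_less_Suc[of j]
    by (simp add: ray_point_def edge_point_def is_ray_def)
next
  case False
  then have "gen_index s = j" using s by (intro gen_index_eqI) auto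
  then show ?thesis by (simp add: ray_point_def)
qed

end

section \<open>Integration on the tree\<close>

text \<open>Agreement of the derivatives is asked only in the interior, because the ends of an edge
  are vertices, where a derivative may have any value.\<close>

lemma primitive_on_cong:
  assumes "primitive_on {a..b} u g" and u: "\<And>s. s \<in> {a..b} \<Longrightarrow> u' s = u s"
    and g: "\<And>s. a < s \<Longrightarrow> s < b \<Longrightarrow> g' s = g s"
  shows "primitive_on {a..b} u' g'"
  unfolding primitive_on_def
proof (intro ballI impI)
  fix s t assume st: "s \<in> {a..b}" "t \<in> {a..b}" "s \<le> t"
  have g': "g' x = g x" if "x \<in> {s..t} - {a, b}" for x using that st g by auto
  have i: "set_integrable lebesgue {s..t} g" "(LINT x:{s..t}|lebesgue. g x) = u t - u s"
    using assms(1) st unfolding primitive_on_def by auto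
  have i': "set_integrable lebesgue {s..t} g'"
    by (rule absolutely_integrable_spike[OF i(1), where S = "{a, b}"]) (use g' in auto)
  have "integral {s..t} g' = integral {s..t} g"
    by (rule integral_spike[of "{a, b}"]) (use g' in auto)
  then have "(LINT x:{s..t}|lebesgue. g' x) = u t - u s"
    unfolding set_lebesgue_integral_eq_integral(2)[OF i'] set_lebesgue_integral_eq_integral(2)[OF i(1)] i(2)[symmetric] .
  then show "set_integrable lebesgue {s..t} g' \<and> (LINT x:{s..t}|lebesgue. g' x) = u' t - u' s"
    using i' u st by simp
qed

lemma primitive_on_shift:
  assumes "primitive_on {a..b} u g"
  shows "primitive_on {c + a..c + b} (\<lambda>s. u (s - c)) (\<lambda>s. g (s - c))"
  unfolding primitive_on_def
proof (intro ballI impI)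
  fix s t assume st: "s \<in> {c + a..c + b}" "t \<in> {c + a..c + b}" "s \<le> t"
  then have st': "s - c \<in> {a..b}" "t - c \<in> {a..b}" "s - c \<le> t - c" by auto
  have i: "set_integrable lebesgue {s - c..t - c} g" "(LINT x:{s - c..t - c}|lebesgue. g x) = u (t - c) - u (s - c)"
    using assms(1)[unfolded primitive_on_def, rule_format, OF st'] by auto
  have eq: "(\<lambda>x. indicat_real {s..t} x *\<^sub>R g (x - c)) = (\<lambda>x. indicat_real {s - c..t - c} (- c + 1 * x) *\<^sub>R g (- c + 1 * x))"
    by (auto split: split_indicator simp: algebra_simps)
  show "set_integrable lebesgue {s..t} (\<lambda>s. g (s - c)) \<and> (LINT x:{s..t}|lebesgue. g (x - c)) = u (t - c) - u (s - c)"
  proof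
    show "set_integrable lebesgue {s..t} (\<lambda>s. g (s - c))"
      unfolding set_integrable_def eq
      by (rule lebesgue_integrable_real_affine) (use i(1) in \<open>simp_all add: set_integrable_def\<close>)
    show "(LINT x:{s..t}|lebesgue. g (x - c)) = u (t - c) - u (s - c)"
      unfolding i(2)[symmetric] set_lebesgue_integral_def eq
      using lebesgue_integral_real_affine[of 1 "\<lambda>x. indicat_real {s - c..t - c} x *\<^sub>R g x" "- c"] by simp
  qed
qed

lemma primitive_on_join:
  assumes "primitive_on {a..b} u g" "primitive_on {b..c} u g" "a \<le> b" "b \<le> c"
  shows "primitive_on {a..c} u g"
  unfolding primitive_on_def
proof (intro ballI impI)
  fix s t assume st: "s \<in> {a..c}" "t \<in> {a..c}" "s \<le> t"
  note i1 = assms(1)[unfolded primitive_on_def, rule_format]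
  note i2 = assms(2)[unfolded primitive_on_def, rule_format]
  consider "t \<le> b" | "b \<le> s" | "s < b" "b < t" by linarith
  then show "set_integrable lebesgue {s..t} g \<and> (LINT x:{s..t}|lebesgue. g x) = u t - u s"
  proof cases
    case 1
    then show ?thesis using st by (intro i1) auto
  next
    case 2
    then show ?thesis using st by (intro i2) auto
  next
    case 3
    have l: "set_integrable lebesgue {s..b} g \<and> (LINT x:{s..b}|lebesgue. g x) = u b - u s"
      using st 3 by (intro i1) auto
    have r: "set_integrable lebesgue {b..t} g \<and> (LINT x:{b..t}|lebesgue. g x) = u t - u b"
      using st 3 by (intro i2) auto
    have un: "{s..t} = {s..b} \<union> {b..t}" using 3 by auto
    have int: "set_integrable lebesgue {s..t} g"
      unfolding un using l r by (intro set_integrable_Un) auto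
    have "(LINT x:{s..t}|lebesgue. g x) = integral {s..t} g"
      by (rule set_lebesgue_integral_eq_integral(2)[OF int])
    also have "\<dots> = integral {s..b} g + integral {b..t} g"
      using 3 set_lebesgue_integral_eq_integral(1)[OF int]
      by (intro Henstock_Kurzweil_Integration.integral_combine[symmetric]) auto
    also have "\<dots> = (u b - u s) + (u t - u b)"
      using l r set_lebesgue_integral_eq_integral(2)[of "{s..b}" g] set_lebesgue_integral_eq_integral(2)[of "{b..t}" g]
      by metis
    finally show ?thesis using int by simp
  qed
qed

lemma primitive_on_sum:
  assumes "\<And>i. i \<in> I \<Longrightarrow> primitive_on S (u i) (g i)"
  shows "primitive_on S (\<lambda>s. \<Sum>i\<in>I. c i * u i s) (\<lambda>s. \<Sum>i\<in>I. c i * g i s)"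
  unfolding primitive_on_def
proof (intro ballI impI)
  fix s t assume st: "s \<in> S" "t \<in> S" "s \<le> t"
  have i: "integrable lebesgue (\<lambda>x. indicat_real {s..t} x *\<^sub>R g i x)"
    "(\<integral>x. indicat_real {s..t} x *\<^sub>R g i x \<partial>lebesgue) = u i t - u i s" if "i \<in> I" for i
    using assms[OF that, unfolded primitive_on_def, rule_format, OF st]
    by (auto simp: set_integrable_def set_lebesgue_integral_def)
  have eq: "(\<lambda>x. indicat_real {s..t} x *\<^sub>R (\<Sum>i\<in>I. c i * g i x)) = (\<lambda>x. \<Sum>i\<in>I. c i * (indicat_real {s..t} x *\<^sub>R g i x))"
    by (auto split: split_indicator)
  show "set_integrable lebesgue {s..t} (\<lambda>x. \<Sum>i\<in>I. c i * g i x) \<and>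
    (LINT x:{s..t}|lebesgue. (\<Sum>i\<in>I. c i * g i x)) = (\<Sum>i\<in>I. c i * u i t) - (\<Sum>i\<in>I. c i * u i s)"
    unfolding set_integrable_def set_lebesgue_integral_def eq
  proof
    show "integrable lebesgue (\<lambda>x. \<Sum>i\<in>I. c i * (indicat_real {s..t} x *\<^sub>R g i x))"
      by (intro Bochner_Integration.integrable_sum integrable_mult_right i)
    have "(\<integral>x. (\<Sum>i\<in>I. c i * (indicat_real {s..t} x *\<^sub>R g i x)) \<partial>lebesgue)
        = (\<Sum>i\<in>I. \<integral>x. c i * (indicat_real {s..t} x *\<^sub>R g i x) \<partial>lebesgue)"
      by (intro Bochner_Integration.integral_sum integrable_mult_right i)
    also have "\<dots> = (\<Sum>i\<in>I. c i * (u i t - u i s))"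
      by (intro sum.cong refl) (simp only: integral_mult_right_zero i(2))
    finally show "(\<integral>x. (\<Sum>i\<in>I. c i * (indicat_real {s..t} x *\<^sub>R g i x)) \<partial>lebesgue)
        = (\<Sum>i\<in>I. c i * u i t) - (\<Sum>i\<in>I. c i * u i s)"
      by (simp only: right_diff_distrib sum_subtractf)
  qed
qed

section \<open>Integrals over the tree as sums over edges\<close>

lemma Inner_measurable:
  assumes e: "e \<in> edges G"
  shows "Inner e \<in> restrict_space lebesgue {t. 0 < t \<and> ereal t < len G e} \<rightarrow>\<^sub>M tree_measure G"
proof (rule measurableI)
  fix t assume "t \<in> space (restrict_space lebesgue {t. 0 < t \<and> ereal t < len G e})"
  then show "Inner e t \<in> space (tree_measure G)"
    using e by (auto simp: space_tree_measure points_def space_restrict_space)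
next
  fix A assume A: "A \<in> sets (tree_measure G)"
  have "{t. 0 < t \<and> ereal t < len G e} \<in> sets lebesgue"
    using edge_slice_points_lebesgue[of G e] e by (simp add: edge_slice_def points_def)
  moreover have "edge_slice G e A \<in> sets lebesgue" using A e by (simp add: sets_tree_measure)
  moreover have "Inner e -` A \<inter> space (restrict_space lebesgue {t. 0 < t \<and> ereal t < len G e}) = edge_slice G e A"
    by (auto simp: edge_slice_def space_restrict_space)
  ultimately show "Inner e -` A \<inter> space (restrict_space lebesgue {t. 0 < t \<and> ereal t < len G e})
      \<in> sets (restrict_space lebesgue {t. 0 < t \<and> ereal t < len G e})"
    by (subst sets_restrict_space_iff) (auto simp: edge_slice_def)
qed

definition edge_integral :: "('v, 'e) rooted_graph \<Rightarrow> (('v, 'e) point \<Rightarrow> ennreal) \<Rightarrow> 'e \<Rightarrow> ennreal" where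
  "edge_integral G F e = (\<integral>\<^sup>+t\<in>{t. 0 < t \<and> ereal t < len G e}. F (Inner e t) \<partial>lebesgue)"

lemma interval_lebesgue: "{t. 0 < t \<and> ereal t < l} \<in> sets lebesgue"
proof -
  have "open {t. ereal t < l}" by (intro open_Collect_less continuous_intros)
  moreover have "{t. 0 < t \<and> ereal t < l} = {0<..} \<inter> {t. ereal t < l}" by auto
  ultimately show ?thesis by (auto intro: borel_open open_Int)
qed

lemma edge_measurable:
  fixes F :: "('v, 'e) point \<Rightarrow> ennreal"
  assumes F: "F \<in> borel_measurable (tree_measure G)" and e: "e \<in> edges G"
  shows "(\<lambda>t. F (Inner e t) * indicator {t. 0 < t \<and> ereal t < len G e} t) \<in> borel_measurable lebesgue"
  using measurable_compose[OF Inner_measurable[OF e] F]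
    borel_measurable_restrict_space_iff_ennreal[of "{t. 0 < t \<and> ereal t < len G e}" lebesgue "\<lambda>t. F (Inner e t)"]
    interval_lebesgue[of "len G e"] by simp

lemma edge_set_borel_measurable:
  fixes f :: "('v, 'e) point \<Rightarrow> complex"
  assumes f: "f \<in> borel_measurable (tree_measure G)" and e: "e \<in> edges G"
  shows "set_borel_measurable lebesgue {t. 0 < t \<and> ereal t < len G e} (\<lambda>t. f (Inner e t))"
  unfolding set_borel_measurable_def
  using measurable_compose[OF Inner_measurable[OF e] f]
    borel_measurable_restrict_space_iff[of "{t. 0 < t \<and> ereal t < len G e}" lebesgue "\<lambda>t. f (Inner e t)"]
    interval_lebesgue[of "len G e"] by simp

text \<open>For indicators this is \<open>emeasure_tree_measure\<close>; linearity and monotone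
  limits extend it.\<close>

lemma nn_integral_tree_measure:
  assumes "F \<in> borel_measurable (tree_measure G)"
  shows "(\<integral>\<^sup>+x. F x \<partial>tree_measure G) = (\<integral>\<^sup>+e. edge_integral G F e \<partial>count_space (edges G))"
  using assms
proof (induction rule: borel_measurable_induct)
  case (cong f g)
  have "edge_integral G f e = edge_integral G g e" if "e \<in> edges G" for e
    unfolding edge_integral_def using cong.hyps(3) that
    by (intro nn_integral_cong) (auto split: split_indicator simp: space_tree_measure points_def)
  then show ?case
    using cong by (auto simp: cong: nn_integral_cong_simp)
next
  case (set A)
  have "edge_integral G (indicator A) e = emeasure lebesgue (edge_slice G e A)" if "e \<in> edges G" for e
  proof -
    have "edge_integral G (indicator A) e = (\<integral>\<^sup>+t. indicator (edge_slice G e A) t \<partial>lebesgue)"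
      unfolding edge_integral_def by (intro nn_integral_cong) (auto simp: edge_slice_def split: split_indicator)
    then show ?thesis using set that by (simp add: sets_tree_measure)
  qed
  then show ?case using set by (auto simp: emeasure_tree_measure intro!: nn_integral_cong)
next
  case (mult u c)
  have "edge_integral G (\<lambda>x. c * u x) e = c * edge_integral G u e" if "e \<in> edges G" for e
    unfolding edge_integral_def mult.assoc
    by (rule nn_integral_cmult) (rule edge_measurable[OF mult(2) that])
  then have "(\<integral>\<^sup>+e. edge_integral G (\<lambda>x. c * u x) e \<partial>count_space (edges G)) = c * (\<integral>\<^sup>+e. edge_integral G u e \<partial>count_space (edges G))"
    by (subst nn_integral_cmult[symmetric]) (auto intro!: nn_integral_cong)
  then show ?case using mult by (simp add: nn_integral_cmult)
next
  case (add u v)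
  have "edge_integral G (\<lambda>x. v x + u x) e = edge_integral G v e + edge_integral G u e" if "e \<in> edges G" for e
    unfolding edge_integral_def distrib_right
    by (rule nn_integral_add) (rule edge_measurable[OF _ that], use add in simp)+
  then have "(\<integral>\<^sup>+e. edge_integral G (\<lambda>x. v x + u x) e \<partial>count_space (edges G)) =
      (\<integral>\<^sup>+e. edge_integral G v e \<partial>count_space (edges G)) + (\<integral>\<^sup>+e. edge_integral G u e \<partial>count_space (edges G))"
    by (subst nn_integral_add[symmetric]) (auto intro!: nn_integral_cong)
  then show ?case using add by (simp add: nn_integral_add)
next
  case (seq U)
  have inc: "incseq U" by (fact seq)
  have "edge_integral G (\<lambda>x. SUP i. U i x) e = (SUP i. edge_integral G (U i) e)" if "e \<in> edges G" for e
  proof -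
    have "edge_integral G (\<lambda>x. SUP i. U i x) e
        = (\<integral>\<^sup>+t. (SUP i. U i (Inner e t) * indicator {t. 0 < t \<and> ereal t < len G e} t) \<partial>lebesgue)"
      unfolding edge_integral_def by (intro nn_integral_cong) (auto split: split_indicator)
    also have "\<dots> = (SUP i. edge_integral G (U i) e)"
      unfolding edge_integral_def
      using inc edge_measurable[OF seq(1) that]
      by (intro nn_integral_monotone_convergence_SUP) (auto simp: incseq_def le_fun_def split: split_indicator)
    finally show ?thesis .
  qed
  then have "(\<integral>\<^sup>+e. edge_integral G (\<lambda>x. SUP i. U i x) e \<partial>count_space (edges G))
      = (\<integral>\<^sup>+e. (SUP i. edge_integral G (U i) e) \<partial>count_space (edges G))"
    by (intro nn_integral_cong) auto
  also have "\<dots> = (SUP i. \<integral>\<^sup>+e. edge_integral G (U i) e \<partial>count_space (edges G))"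
    using inc unfolding edge_integral_def
    by (intro nn_integral_monotone_convergence_SUP incseq_SucI le_funI nn_integral_mono)
      (auto simp: incseq_def le_fun_def split: split_indicator)
  also have "\<dots> = (SUP i. \<integral>\<^sup>+x. U i x \<partial>tree_measure G)" using seq by simp
  also have "\<dots> = (\<integral>\<^sup>+x. (SUP i. U i x) \<partial>tree_measure G)"
    using seq by (intro nn_integral_monotone_convergence_SUP[symmetric]) auto
  finally show ?case by (simp add: image_image SUP_apply[abs_def])
qed

lemma sum_edge_integral_le:
  assumes "F \<in> borel_measurable (tree_measure G)" "finite A" "A \<subseteq> edges G"
  shows "(\<Sum>e\<in>A. edge_integral G F e) \<le> (\<integral>\<^sup>+x. F x \<partial>tree_measure G)"
proof -
  have "(\<Sum>e\<in>A. edge_integral G F e) = (\<integral>\<^sup>+e. edge_integral G F e * indicator A e \<partial>count_space (edges G))"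
    using assms by (subst nn_integral_count_space'[of A]) (auto intro!: sum.cong)
  also have "\<dots> \<le> (\<integral>\<^sup>+e. edge_integral G F e \<partial>count_space (edges G))"
    by (intro nn_integral_mono) (auto split: split_indicator)
  finally show ?thesis unfolding nn_integral_tree_measure[OF assms(1)] .
qed

lemma nn_integral_lebesgue_Icc_shift:
  "(\<integral>\<^sup>+s\<in>{c + a..c + b::real}. f (s - c) \<partial>lebesgue) = (\<integral>\<^sup>+t\<in>{a..b}. f t \<partial>lebesgue)"
  if "(\<lambda>t. f t * indicator {a..b} t) \<in> borel_measurable lebesgue"
proof -
  have "(\<integral>\<^sup>+t\<in>{a..b}. f t \<partial>lebesgue) = (\<integral>\<^sup>+s. f (- c + 1 * s) * indicator {a..b} (- c + 1 * s) \<partial>lebesgue)"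
    using nn_integral_real_affine_lebesgue[OF that, of 1 "- c"] by simp
  also have "\<dots> = (\<integral>\<^sup>+s\<in>{c + a..c + b::real}. f (s - c) \<partial>lebesgue)"
    by (intro nn_integral_cong) (auto split: split_indicator)
  finally show ?thesis by simp
qed

lemma AE_lebesgue_neq: "AE x in lebesgue. x \<noteq> (c::real)"
  by (rule AE_completion[OF AE_lborel_singleton])

context finite_length_tree
begin

lemma edge_interval:
  "e \<in> gen_edges j \<Longrightarrow> {t. 0 < t \<and> ereal t < len G e} = {0<..<radius (Suc j) - radius j}"
  using len_gen[of e j] by auto

lemma ray_edge_integral:
  assumes \<rho>: "is_ray \<rho>" and F: "F \<in> borel_measurable (tree_measure G)"
  shows "(\<integral>\<^sup>+s\<in>{radius j..radius (Suc j)}. F (ray_point \<rho> s) \<partial>lebesgue) = edge_integral G F (\<rho> j)"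
proof -
  define L where "L = radius (Suc j) - radius j"
  note e = is_ray_gen[OF \<rho>, of j]
  have I: "{t. 0 < t \<and> ereal t < len G (\<rho> j)} = {0<..<L}" using edge_interval[OF e] by (simp add: L_def)
  define f where "f t = F (Inner (\<rho> j) t) * indicator {0<..<L} t" for t
  have fm: "f \<in> borel_measurable lebesgue"
    unfolding f_def[abs_def] using edge_measurable[OF F gen_edges_edges[OF e]] I by simp
  have "(\<integral>\<^sup>+s\<in>{radius j..radius (Suc j)}. F (ray_point \<rho> s) \<partial>lebesgue)
      = (\<integral>\<^sup>+s\<in>{radius j + 0..radius j + L}. f (s - radius j) \<partial>lebesgue)"
  proof (rule nn_integral_cong_AE)
    have "AE s in lebesgue. s \<noteq> radius j \<and> s \<noteq> radius (Suc j)"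
      by (intro AE_conjI AE_lebesgue_neq)
    then show "AE s in lebesgue. F (ray_point \<rho> s) * indicator {radius j..radius (Suc j)} s
        = f (s - radius j) * indicator {radius j + 0..radius j + L} s"
    proof eventually_elim
      case (elim s)
      then consider "radius j < s" "s < radius (Suc j)" | "s < radius j \<or> radius (Suc j) < s" by linarith
      then show ?case
        by cases (auto simp: f_def L_def ray_point_inner[OF \<rho>] split: split_indicator)
    qed
  qed
  also have "\<dots> = (\<integral>\<^sup>+t\<in>{0..L}. f t \<partial>lebesgue)"
    by (intro nn_integral_lebesgue_Icc_shift borel_measurable_times_ennreal fm borel_measurable_indicator) simp
  also have "\<dots> = edge_integral G F (\<rho> j)"
    unfolding edge_integral_def I f_def
    by (intro nn_integral_cong) (auto split: split_indicator)
  finally show ?thesis .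
qed

text \<open>On one edge \<open>D\<close> is square integrable and the edge is bounded, so
  \<open>D\<close> is integrable there and \<open>weak_derivative_primitive\<close> applies up to
  both ends. Since \<phi> has one value at a common vertex, consecutive edges can be joined.\<close>

lemma primitive_on_ray:
  assumes cont: "continuous_on_tree G \<phi>" and D: "D \<in> L2 (tree_measure G)" "is_tree_derivative G \<phi> D"
    and \<rho>: "is_ray \<rho>"
  shows "primitive_on {0..} (\<lambda>s. \<phi> (ray_point \<rho> s)) (\<lambda>s. D (ray_point \<rho> s))"
proof -
  have piece: "primitive_on {radius j..radius (Suc j)} (\<lambda>s. \<phi> (ray_point \<rho> s)) (\<lambda>s. D (ray_point \<rho> s))" for j
  proof -
    define L where "L = radius (Suc j) - radius j"
    note e = is_ray_gen[OF \<rho>, of j]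
    note ed = gen_edges_edges[OF e]
    have L: "0 < L" using radius_less_Suc[of j] by (simp add: L_def)
    have lenL: "len G (\<rho> j) = ereal L" using len_gen[OF e] by (simp add: L_def)
    have I: "{t. 0 < t \<and> ereal t < len G (\<rho> j)} = {0<..<L}" using lenL by auto
    have w: "has_weak_derivative {0<..<L} (\<lambda>t. \<phi> (Inner (\<rho> j) t)) (\<lambda>t. D (Inner (\<rho> j) t))"
      using D(2) ed unfolding is_tree_derivative_def I[symmetric] by blast
    have cont': "continuous_on {0..L} (\<lambda>t. \<phi> (edge_point G (\<rho> j) t))"
    proof -
      have "{t. 0 \<le> t \<and> ereal t \<le> len G (\<rho> j)} = {0..L}" using lenL by auto
      then show ?thesis using cont ed unfolding continuous_on_tree_def by metis
    qed
    define h where "h t = indicator {0<..<L} t *\<^sub>R D (Inner (\<rho> j) t)" for t :: real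
    have "set_integrable lebesgue {0<..<L} (\<lambda>t. D (Inner (\<rho> j) t))"
      unfolding set_integrable_def h_def[symmetric]
    proof (rule integrableI_bounded)
      have DM: "D \<in> borel_measurable (tree_measure G)" and Dint: "integrable (tree_measure G) (\<lambda>x. (norm (D x))\<^sup>2)"
        using D(1) by (auto simp: L2_def)
      show hm: "h \<in> borel_measurable lebesgue"
        using edge_set_borel_measurable[OF DM ed] unfolding set_borel_measurable_def I h_def[abs_def] .
      have "(\<integral>\<^sup>+t. ennreal (norm (h t)) \<partial>lebesgue) = (\<integral>\<^sup>+t. ennreal (norm (h t)) * indicator {0<..<L} t \<partial>lebesgue)"
        by (intro nn_integral_cong) (auto simp: h_def split: split_indicator)
      moreover have "(\<lambda>t. ennreal (norm (h t))) \<in> borel_measurable lebesgue" using hm by simp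
      ultimately have "(\<integral>\<^sup>+t. ennreal (norm (h t)) \<partial>lebesgue)\<^sup>2
          \<le> (\<integral>\<^sup>+t. (ennreal (norm (h t)))\<^sup>2 \<partial>lebesgue) * (\<integral>\<^sup>+t. (indicator {0<..<L} t)\<^sup>2 \<partial>lebesgue)"
        using Cauchy_Schwarz_nn_integral[of "\<lambda>t. ennreal (norm (h t))" lebesgue "indicator {0<..<L}"]
        by (simp add: borel_measurable_indicator)
      also have "(\<integral>\<^sup>+t. (indicator {0<..<L} t)\<^sup>2 \<partial>lebesgue) = ennreal L"
      proof -
        have "(\<integral>\<^sup>+t. (indicator {0<..<L} t :: ennreal)\<^sup>2 \<partial>lebesgue) = (\<integral>\<^sup>+t. indicator {0<..<L} t \<partial>lebesgue)"
          by (intro nn_integral_cong) (auto split: split_indicator)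
        then show ?thesis using L by simp
      qed
      also have "(\<integral>\<^sup>+t. (ennreal (norm (h t)))\<^sup>2 \<partial>lebesgue) = edge_integral G (\<lambda>x. ennreal ((norm (D x))\<^sup>2)) (\<rho> j)"
        unfolding edge_integral_def I
        by (intro nn_integral_cong) (auto simp: h_def ennreal_power split: split_indicator)
      also have "edge_integral G (\<lambda>x. ennreal ((norm (D x))\<^sup>2)) (\<rho> j) \<le> (\<integral>\<^sup>+x. ennreal ((norm (D x))\<^sup>2) \<partial>tree_measure G)"
        using sum_edge_integral_le[of "\<lambda>x. ennreal ((norm (D x))\<^sup>2)" G "{\<rho> j}"] DM ed by simp
      finally have "(\<integral>\<^sup>+t. ennreal (norm (h t)) \<partial>lebesgue)\<^sup>2
          \<le> (\<integral>\<^sup>+x. ennreal ((norm (D x))\<^sup>2) \<partial>tree_measure G) * ennreal L" by (simp add: mult_right_mono)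
      also have "\<dots> < \<infinity>" using Dint by (simp add: integrable_iff_bounded ennreal_mult_less_top)
      finally show "(\<integral>\<^sup>+t. ennreal (norm (h t)) \<partial>lebesgue) < \<infinity>" by (simp add: power_less_top_ennreal)
    qed
    then have "primitive_on {0..L} (\<lambda>t. \<phi> (edge_point G (\<rho> j) t)) (\<lambda>t. D (Inner (\<rho> j) t))"
      by (intro weak_derivative_primitive[OF w cont' _ _ L]) (auto simp: edge_point_def lenL)
    from primitive_on_shift[OF this, of "radius j"]
    have "primitive_on {radius j..radius (Suc j)} (\<lambda>s. \<phi> (edge_point G (\<rho> j) (s - radius j))) (\<lambda>s. D (Inner (\<rho> j) (s - radius j)))"
      by (simp add: L_def)
    then show ?thesis
      by (rule primitive_on_cong) (auto simp: ray_point_edge_point[OF \<rho>] ray_point_inner[OF \<rho>])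
  qed
  have initial: "primitive_on {0..radius j} (\<lambda>s. \<phi> (ray_point \<rho> s)) (\<lambda>s. D (ray_point \<rho> s))" for j
  proof (induction j)
    case 0
    show ?case using piece[of 0] by (rule primitive_on_subset) (use radius_0 radius_less_Suc[of 0] in auto)
  next
    case (Suc j)
    from this piece[of j] show ?case
      by (rule primitive_on_join) (use radius_nonneg radius_less_Suc[of j] in auto)
  qed
  show ?thesis
    unfolding primitive_on_def
  proof (intro ballI impI)
    fix s t :: real assume st: "s \<in> {0..}" "t \<in> {0..}" "s \<le> t"
    obtain j where "t < radius j" using radius_unbounded by blast
    then have "s \<in> {0..radius j}" "t \<in> {0..radius j}" using st by auto
    then show "set_integrable lebesgue {s..t} (\<lambda>s. D (ray_point \<rho> s)) \<and>
        (LINT x:{s..t}|lebesgue. D (ray_point \<rho> x)) = \<phi> (ray_point \<rho> t) - \<phi> (ray_point \<rho> s)"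
      using initial[of j, unfolded primitive_on_def, rule_format] st(3) by simp
  qed
qed

lemma edges_eq_UN: "edges G = (\<Union>k. gen_edges k)"
  by (auto simp: gen_edges_def)

lemma countable_edges: "countable (edges G)"
  unfolding edges_eq_UN using finite_gen_edges by (auto intro: countable_finite)

text \<open>There are countably many edges, each of finite measure, and the vertices form one null
  set. Tonelli's theorem in the layer cake formula relies on this.\<close>

lemma sigma_finite_tree_measure: "sigma_finite_measure (tree_measure G)"
proof
  define B :: "'e \<Rightarrow> ('v, 'e) point set"
    where "B e = Inner e ` {t. 0 < t \<and> ereal t < len G e}" for e
  have slice: "edge_slice G e' (B e) = (if e' = e then {t. 0 < t \<and> ereal t < len G e} else {})" for e e'
    by (auto simp: edge_slice_def B_def)
  have slice0: "edge_slice G e (Vertex ` verts G) = {}" for e :: 'e by (auto simp: edge_slice_def)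
  have BM: "B e \<in> sets (tree_measure G)" if "e \<in> edges G" for e
    unfolding sets_tree_measure using that interval_lebesgue
    by (auto simp: slice) (auto simp: B_def points_def)
  have VM: "Vertex ` verts G \<in> sets (tree_measure G)"
    unfolding sets_tree_measure by (auto simp: slice0 points_def)
  have "emeasure (tree_measure G) (B e) \<noteq> \<infinity>" if e: "e \<in> edges G" for e
  proof -
    obtain k where k: "e \<in> gen_edges k" using e edges_eq_UN by blast
    have "emeasure (tree_measure G) (B e) = (\<integral>\<^sup>+e'. ennreal (radius (Suc k) - radius k) * indicator {e} e' \<partial>count_space (edges G))"
      unfolding emeasure_tree_measure[OF BM[OF e]] slice
      by (intro nn_integral_cong) (auto simp: edge_interval[OF k] less_imp_le[OF radius_less_Suc] split: split_indicator)
    also have "\<dots> = ennreal (radius (Suc k) - radius k)"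
      using e by (simp add: nn_integral_cmult)
    finally show ?thesis by simp
  qed
  moreover have "emeasure (tree_measure G) (Vertex ` verts G) = 0"
    unfolding emeasure_tree_measure[OF VM] slice0 by simp
  moreover have "\<Union> (insert (Vertex ` verts G) (B ` edges G)) = space (tree_measure G)"
    by (auto simp: space_tree_measure points_def B_def)
  ultimately show "\<exists>A. countable A \<and> A \<subseteq> sets (tree_measure G) \<and> \<Union> A = space (tree_measure G) \<and>
      (\<forall>a\<in>A. emeasure (tree_measure G) a \<noteq> \<infinity>)"
    using countable_edges BM VM by (intro exI[of _ "insert (Vertex ` verts G) (B ` edges G)"]) auto
qed

lemma AE_not_vertex: "AE x in tree_measure G. x \<in> points G - Vertex ` verts G"
proof (rule AE_I')
  have slice0: "edge_slice G e (Vertex ` verts G) = {}" for e :: 'e by (auto simp: edge_slice_def)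
  have VM: "Vertex ` verts G \<in> sets (tree_measure G)"
    unfolding sets_tree_measure by (auto simp: slice0 points_def)
  show "Vertex ` verts G \<in> null_sets (tree_measure G)"
    using VM emeasure_tree_measure[OF VM] by (auto simp: null_sets_def slice0)
  show "{x \<in> space (tree_measure G). x \<notin> points G - Vertex ` verts G} \<subseteq> Vertex ` verts G"
    by (auto simp: space_tree_measure)
qed

lemma root_dist_Inner: "e \<in> gen_edges k \<Longrightarrow> root_dist G (Inner e t) = radius k + t"
  using vertex_dist_src_gen by simp

lemma g0_interior:
  assumes s: "radius k < s" "s < radius (Suc k)"
  shows "g0 G s = card (gen_edges k)"
proof -
  have "{x \<in> points G. root_dist G x = s} = (\<lambda>e. Inner e (s - radius k)) ` gen_edges k"
  proof (intro equalityI subsetI)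
    fix x :: "('v, 'e) point" assume "x \<in> {x \<in> points G. root_dist G x = s}"
    then have x: "x \<in> points G" "root_dist G x = s" by auto
    show "x \<in> (\<lambda>e. Inner e (s - radius k)) ` gen_edges k"
    proof (cases x)
      case (Vertex v)
      then have "v \<in> verts G" using x by (auto simp: points_def)
      then obtain j e where "e \<in> gen_edges j" "src G e = v" by (rule vertex_src)
      then have "s = radius j" using vertex_dist_src_gen Vertex x(2) by auto
      then show ?thesis using s by simp
    next
      case (Inner e t)
      define j where "j = edge_gen e"
      have e: "e \<in> gen_edges j" "0 < t" "ereal t < len G e"
        using x Inner by (auto simp: points_def j_def gen_edges_def)
      have st: "s = radius j + t" using x(2) Inner root_dist_Inner[OF e(1)] by simp
      then have "radius j < s" "s < radius (Suc j)" using e len_gen[OF e(1)] by auto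
      then have "gen_index s = j" by (intro gen_index_eqI) auto
      moreover have "gen_index s = k" using s by (intro gen_index_eqI) auto
      ultimately have "j = k" by simp
      then show ?thesis using e(1) st Inner by auto
    qed
  next
    fix x :: "('v, 'e) point" assume "x \<in> (\<lambda>e. Inner e (s - radius k)) ` gen_edges k"
    then obtain e where e: "e \<in> gen_edges k" "x = Inner e (s - radius k)" by blast
    then show "x \<in> {x \<in> points G. root_dist G x = s}"
      using s len_gen[OF e(1)] root_dist_Inner[OF e(1)] gen_edges_edges[OF e(1)] by (auto simp: points_def)
  qed
  then show ?thesis unfolding g0_def by (simp add: card_image inj_on_def)
qed

lemma gen_index_mono: "mono gen_index"
proof (rule monoI)
  fix s t :: real assume st: "s \<le> t"
  obtain k where "t < radius k" using radius_unbounded by blast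
  then have "t < radius (Suc k)" using radius_less_Suc[of k] by linarith
  then have "t < radius (Suc (gen_index t))"
    unfolding gen_index_def by (rule LeastI[of "\<lambda>j. t < radius (Suc j)"])
  then have "s < radius (Suc (gen_index t))" using st by linarith
  then show "gen_index s \<le> gen_index t" unfolding gen_index_def[of s] by (rule Least_le)
qed

lemma measurable_card_gen_index:
  "(\<lambda>s. real (card (gen_edges (gen_index s))) / c) \<in> borel_measurable lebesgue"
proof -
  have "mono (\<lambda>s. real (card (gen_edges (gen_index s))))"
    by (intro monoI) (simp add: card_gen_edges_mono monoD[OF gen_index_mono])
  then have "(\<lambda>s. real (card (gen_edges (gen_index s)))) \<in> borel_measurable borel"
    by (rule borel_measurable_mono)
  then have "(\<lambda>s. real (card (gen_edges (gen_index s))) / c) \<in> borel_measurable borel" by simp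
  then show ?thesis by (rule borel_measurable_lebesgueI)
qed

section \<open>Pointwise bounds by averaging over paths\<close>

lemma ray_measurable:
  fixes F :: "('v, 'e) point \<Rightarrow> ennreal"
  assumes \<rho>: "is_ray \<rho>" and F: "F \<in> borel_measurable (tree_measure G)"
  shows "(\<lambda>s. F (ray_point \<rho> s) * indicator {radius j<..<radius (Suc j)} s) \<in> borel_measurable lebesgue"
proof -
  note e = is_ray_gen[OF \<rho>, of j]
  define f where "f t = F (Inner (\<rho> j) t) * indicator {0<..<radius (Suc j) - radius j} t" for t
  have fm: "f \<in> borel_measurable lebesgue"
    unfolding f_def[abs_def] using edge_measurable[OF F gen_edges_edges[OF e]] edge_interval[OF e] by simp
  have "(\<lambda>s. - radius j + 1 * s) \<in> lebesgue \<rightarrow>\<^sub>M lebesgue"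
    using lebesgue_affine_measurable[where c = "\<lambda>x::real. 1" and t = "- radius j"] by simp
  then have "(\<lambda>s. f (- radius j + 1 * s)) \<in> borel_measurable lebesgue"
    by (rule measurable_compose[OF _ fm])
  moreover have "(\<lambda>s. f (- radius j + 1 * s)) = (\<lambda>s. F (ray_point \<rho> s) * indicator {radius j<..<radius (Suc j)} s)"
    by (rule ext) (auto simp: f_def ray_point_inner[OF \<rho>] split: split_indicator)
  ultimately show ?thesis by simp
qed

lemma AE_neq_radius: "AE s in lebesgue. \<forall>j. s \<noteq> radius j"
  by (simp add: AE_all_countable AE_lebesgue_neq)

text \<open>For \<open>s\<close> inside a generation interval from the k-th one on, this is by
  symmetry the number of points at distance \<open>s\<close> that lie on or beyond one given edge of
  generation \<open>k\<close>.\<close>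

definition branching_ratio :: "nat \<Rightarrow> real \<Rightarrow> real" where
  "branching_ratio k s = real (card (gen_edges (gen_index s))) / real (card (gen_edges k))"

lemma branching_ratio_pos: "0 < branching_ratio k s"
  using card_gen_edges_pos by (simp add: branching_ratio_def)

text \<open>The weight is constant on the interior of each edge; the first and the last edge may be
  covered only in part, hence an inequality.\<close>

lemma ray_weighted_integral_le:
  assumes \<rho>: "is_ray \<rho>" and F: "F \<in> borel_measurable (tree_measure G)"
    and ab: "radius k \<le> a" "b < radius (Suc J)"
  shows "(\<integral>\<^sup>+s\<in>{a..b}. ennreal (branching_ratio k s) * F (ray_point \<rho> s) \<partial>lebesgue) \<le>
    (\<Sum>j\<in>{k..J}. ennreal (real (card (gen_edges j)) / real (card (gen_edges k))) * edge_integral G F (\<rho> j))"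
proof -
  define q where "q j = ennreal (real (card (gen_edges j)) / real (card (gen_edges k)))" for j
  define I where "I j = {radius j<..<radius (Suc j)}" for j
  have "(\<integral>\<^sup>+s\<in>{a..b}. ennreal (branching_ratio k s) * F (ray_point \<rho> s) \<partial>lebesgue) \<le>
    (\<integral>\<^sup>+s. (\<Sum>j\<in>{k..J}. q j * (F (ray_point \<rho> s) * indicator (I j) s)) \<partial>lebesgue)"
  proof (rule nn_integral_mono_AE)
    show "AE s in lebesgue. ennreal (branching_ratio k s) * F (ray_point \<rho> s) * indicator {a..b} s
        \<le> (\<Sum>j\<in>{k..J}. q j * (F (ray_point \<rho> s) * indicator (I j) s))"
      using AE_neq_radius
    proof eventually_elim
      case (elim s)
      show ?case
      proof (cases "s \<in> {a..b}")
        case True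
        define j where "j = gen_index s"
        have s: "0 \<le> s" using True ab radius_nonneg[of k] by auto
        have j: "radius j \<le> s" "s < radius (Suc j)" using gen_index[OF s] by (auto simp: j_def)
        have "radius j < s" using j(1) elim by (metis less_le)
        then have sI: "s \<in> I j" using j by (simp add: I_def)
        have "a \<le> s" "s \<le> b" using True by auto
        then have "radius k < radius (Suc j)" "radius j < radius (Suc J)" using ab j by linarith+
        then have jk: "j \<in> {k..J}" by simp
        have "ennreal (branching_ratio k s) * F (ray_point \<rho> s) * indicator {a..b} s = q j * (F (ray_point \<rho> s) * indicator (I j) s)"
          using True sI by (simp add: q_def branching_ratio_def j_def)
        also have "\<dots> \<le> (\<Sum>j\<in>{k..J}. q j * (F (ray_point \<rho> s) * indicator (I j) s))"
          by (rule member_le_sum[OF jk]) auto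
        finally show ?thesis .
      qed simp
    qed
  qed
  also have "\<dots> = (\<Sum>j\<in>{k..J}. q j * (\<integral>\<^sup>+s\<in>I j. F (ray_point \<rho> s) \<partial>lebesgue))"
    using ray_measurable[OF \<rho> F] unfolding I_def
    by (subst nn_integral_sum) (auto simp: nn_integral_cmult)
  also have "\<dots> \<le> (\<Sum>j\<in>{k..J}. q j * edge_integral G F (\<rho> j))"
    unfolding ray_edge_integral[OF \<rho> F, symmetric] I_def
    by (intro sum_mono mult_left_mono nn_integral_mono) (auto split: split_indicator)
  finally show ?thesis by (simp add: q_def)
qed

text \<open>Each edge of generation \<open>j\<close> beyond \<open>e\<close> lies on the same number of the averaged paths, so the
  weight \<open>branching_ratio\<close> exactly compensates the averaging.\<close>

lemma sum_paths_le:
  assumes F: "F \<in> borel_measurable (tree_measure G)"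
    and k: "e \<in> gen_edges k" "k \<le> J" and ab: "radius k \<le> a" "b < radius (Suc J)"
  defines "D \<equiv> {f \<in> gen_edges J. ancestor k f = e}"
  shows "(\<Sum>f\<in>D. \<integral>\<^sup>+s\<in>{a..b}. ennreal (branching_ratio k s) * F (ray_point (ray f) s) \<partial>lebesgue)
      \<le> of_nat (card D) * (\<integral>\<^sup>+x. F x \<partial>tree_measure G)"
    and "0 < card D"
proof -
  define N where "N j = card (gen_edges j)" for j
  have Npos: "0 < N j" for j using card_gen_edges_pos by (simp add: N_def)
  define h where "h = edge_integral G F"
  define Dj where "Dj j = {f \<in> gen_edges j. ancestor k f = e}" for j
  have "Dj k = {e}" using k(1) ancestor_self by (auto simp: Dj_def)
  \<comment> \<open>\<open>ancestor_average\<close> for the constant function 1 counts the paths: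
    there are \<open>N J / N k\<close> of them.\<close>
  then have "of_nat (card D) * of_nat (N k) = (of_nat (N J) :: ennreal)"
    using ancestor_average[of k k J "\<lambda>_. 1" e] k(2) by (simp add: D_def N_def Dj_def)
  then have m: "card D * N k = N J"
    by (simp only: of_nat_mult[symmetric] of_nat_eq_iff)
  then show pos: "0 < card D" using Npos[of J] Npos[of k] by (metis mult_is_0 neq0_conv)
  have ratio: "ennreal (1 / real (N k)) * of_nat (N J) = of_nat (card D)"
  proof -
    have "1 / real (N k) * real (N J) = real (card D)"
      using Npos[of k] unfolding m[symmetric] by simp
    then show ?thesis by (simp add: ennreal_of_nat_eq_real_of_nat ennreal_mult'[symmetric])
  qed
  have ray_anc: "ray f j = ancestor j f" if "f \<in> D" "j \<le> J" for f j
    using that by (auto simp: ray_def D_def gen_edges_def)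
  have is_ray: "is_ray (ray f)" if "f \<in> D" for f
    using that by (intro is_ray_ray gen_edges_edges[of _ J]) (simp add: D_def)
  have "(\<Sum>f\<in>D. \<integral>\<^sup>+s\<in>{a..b}. ennreal (branching_ratio k s) * F (ray_point (ray f) s) \<partial>lebesgue)
      \<le> (\<Sum>f\<in>D. \<Sum>j\<in>{k..J}. ennreal (real (N j) / real (N k)) * h (ancestor j f))"
  proof (rule sum_mono)
    fix f assume f: "f \<in> D"
    have "(\<integral>\<^sup>+s\<in>{a..b}. ennreal (branching_ratio k s) * F (ray_point (ray f) s) \<partial>lebesgue)
        \<le> (\<Sum>j\<in>{k..J}. ennreal (real (N j) / real (N k)) * h (ray f j))"
      unfolding N_def h_def by (rule ray_weighted_integral_le[OF is_ray[OF f] F ab])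
    also have "\<dots> = (\<Sum>j\<in>{k..J}. ennreal (real (N j) / real (N k)) * h (ancestor j f))"
      using ray_anc[OF f] by (intro sum.cong) auto
    finally show "(\<integral>\<^sup>+s\<in>{a..b}. ennreal (branching_ratio k s) * F (ray_point (ray f) s) \<partial>lebesgue)
        \<le> (\<Sum>j\<in>{k..J}. ennreal (real (N j) / real (N k)) * h (ancestor j f))" .
  qed
  also have "\<dots> = (\<Sum>j\<in>{k..J}. ennreal (1 / real (N k)) * ((\<Sum>f\<in>D. h (ancestor j f)) * of_nat (N j)))"
  proof -
    have "ennreal (real (N j) / real (N k)) = ennreal (1 / real (N k)) * of_nat (N j)" for j
      by (simp add: ennreal_of_nat_eq_real_of_nat ennreal_mult'[symmetric])
    then show ?thesis
      by (subst sum.swap) (simp add: sum_distrib_left sum_distrib_right ac_simps)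
  qed
  also have "\<dots> = (\<Sum>j\<in>{k..J}. of_nat (card D) * (\<Sum>f\<in>Dj j. h f))"
  proof (intro sum.cong refl)
    fix j assume "j \<in> {k..J}"
    then have "(\<Sum>f\<in>D. h (ancestor j f)) * of_nat (N j) = of_nat (N J) * (\<Sum>f\<in>Dj j. h f)"
      unfolding D_def N_def Dj_def by (intro ancestor_average) auto
    then show "ennreal (1 / real (N k)) * ((\<Sum>f\<in>D. h (ancestor j f)) * of_nat (N j)) = of_nat (card D) * (\<Sum>f\<in>Dj j. h f)"
      unfolding ratio[symmetric] by (simp add: mult.assoc)
  qed
  also have "\<dots> = of_nat (card D) * (\<Sum>j\<in>{k..J}. \<Sum>f\<in>Dj j. h f)" by (simp add: sum_distrib_left)
  \<comment> \<open>Descendants of \<open>e\<close> in different generations are different edges, so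
    every edge integral enters once.\<close>
  also have "(\<Sum>j\<in>{k..J}. \<Sum>f\<in>Dj j. h f) = (\<Sum>f\<in>(\<Union>j\<in>{k..J}. Dj j). h f)"
    by (rule sum.UNION_disjoint[symmetric]) (auto simp: Dj_def finite_gen_edges, auto simp: gen_edges_def)
  also have "\<dots> \<le> (\<integral>\<^sup>+x. F x \<partial>tree_measure G)"
    unfolding h_def by (rule sum_edge_integral_le[OF F]) (auto simp: Dj_def finite_gen_edges gen_edges_edges)
  finally show "(\<Sum>f\<in>D. \<integral>\<^sup>+s\<in>{a..b}. ennreal (branching_ratio k s) * F (ray_point (ray f) s) \<partial>lebesgue)
      \<le> of_nat (card D) * (\<integral>\<^sup>+x. F x \<partial>tree_measure G)" by (simp add: mult_left_mono)
qed

text \<open>Carrying a derivative \<open>D\<close> along makes linear combinations harmless, which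
  the choice by \<open>SOME\<close> in \<open>tree_derivative\<close> would not. The pointwise
  bounds use only measurability and the increments along rays.\<close>

definition tree_primitive :: "(('v, 'e) point \<Rightarrow> complex) \<Rightarrow> (('v, 'e) point \<Rightarrow> complex) \<Rightarrow> bool" where
  "tree_primitive \<phi> D \<longleftrightarrow> \<phi> \<in> borel_measurable (tree_measure G) \<and> D \<in> borel_measurable (tree_measure G) \<and>
    (\<forall>\<rho>. is_ray \<rho> \<longrightarrow> primitive_on {0..} (\<lambda>s. \<phi> (ray_point \<rho> s)) (\<lambda>s. D (ray_point \<rho> s)))"

lemma tree_primitive_sum:
  assumes "\<And>i. i \<in> I \<Longrightarrow> tree_primitive (u i) (g i)"
  shows "tree_primitive (\<lambda>x. \<Sum>i\<in>I. c i * u i x) (\<lambda>x. \<Sum>i\<in>I. c i * g i x)"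
  using assms unfolding tree_primitive_def
  by (intro conjI allI impI primitive_on_sum borel_measurable_sum borel_measurable_times) auto

text \<open>The one-dimensional bound is applied along every forward path of length
  \<open>l\<close>, with weight \<open>branching_ratio k\<close>, and averaged over the paths;
  \<open>sum_paths_le\<close> turns both averages into integrals over the tree. The integral of
  \<open>1 / branching_ratio k s\<close> is the resistance of the forward tree from the point up to
  distance \<open>l\<close>.\<close>

lemma pointwise_bound:
  assumes \<phi>: "tree_primitive \<phi> D" and e: "e \<in> gen_edges k" and t: "0 < t" "t < radius (Suc k) - radius k"
    and l: "0 < l"
  defines "r \<equiv> radius k + t"
  shows "ennreal ((norm (\<phi> (Inner e t)))\<^sup>2) \<le>
    2 * (\<integral>\<^sup>+s\<in>{r..r + l}. ennreal (1 / branching_ratio k s) \<partial>lebesgue) *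
    (ennreal (1 / l\<^sup>2) * (\<integral>\<^sup>+x. ennreal ((norm (\<phi> x))\<^sup>2) \<partial>tree_measure G) +
      (\<integral>\<^sup>+x. ennreal ((norm (D x))\<^sup>2) \<partial>tree_measure G))"
proof -
  define n where "n = branching_ratio k"
  define P where "P = (\<integral>\<^sup>+s\<in>{r..r + l}. ennreal (1 / n s) \<partial>lebesgue)"
  have m\<phi>: "\<phi> \<in> borel_measurable (tree_measure G)" and mD: "D \<in> borel_measurable (tree_measure G)"
    and pr: "\<And>\<rho>. is_ray \<rho> \<Longrightarrow> primitive_on {0..} (\<lambda>s. \<phi> (ray_point \<rho> s)) (\<lambda>s. D (ray_point \<rho> s))"
    using \<phi> by (auto simp: tree_primitive_def)
  have r: "radius k < r" "r < radius (Suc k)" using t by (auto simp: r_def)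
  obtain J where J: "r + l < radius J" using radius_unbounded by blast
  have "radius k < radius J" using r l J by linarith
  then have kJ: "k \<le> J" by simp
  have J': "r + l < radius (Suc J)" using J radius_less_Suc[of J] by linarith
  \<comment> \<open>One path for each edge of generation \<open>J\<close> beyond \<open>e\<close>;
    as \<open>J\<close> lies past \<open>r + l\<close>, all branchings on the way are seen.\<close>
  define S where "S = {f \<in> gen_edges J. ancestor k f = e}"
  define X where "X = ennreal ((norm (\<phi> (Inner e t)))\<^sup>2)"
  have F\<phi>: "(\<lambda>x. ennreal ((norm (\<phi> x))\<^sup>2)) \<in> borel_measurable (tree_measure G)"
    and FD: "(\<lambda>x. ennreal ((norm (D x))\<^sup>2)) \<in> borel_measurable (tree_measure G)"
    using m\<phi> mD by auto
  define U where "U f = (\<integral>\<^sup>+s\<in>{r..r + l}. ennreal (n s) * ennreal ((norm (\<phi> (ray_point (ray f) s)))\<^sup>2) \<partial>lebesgue)" for f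
  define W where "W f = (\<integral>\<^sup>+s\<in>{r..r + l}. ennreal (n s) * ennreal ((norm (D (ray_point (ray f) s)))\<^sup>2) \<partial>lebesgue)" for f
  define IU where "IU = (\<integral>\<^sup>+x. ennreal ((norm (\<phi> x))\<^sup>2) \<partial>tree_measure G)"
  define IW where "IW = (\<integral>\<^sup>+x. ennreal ((norm (D x))\<^sup>2) \<partial>tree_measure G)"
  have S: "(\<Sum>f\<in>S. U f) \<le> of_nat (card S) * IU" "(\<Sum>f\<in>S. W f) \<le> of_nat (card S) * IW" "0 < card S"
    unfolding S_def U_def W_def n_def IU_def IW_def
    using sum_paths_le[OF F\<phi> e kJ less_imp_le[OF r(1)] J'] sum_paths_le[OF FD e kJ less_imp_le[OF r(1)] J']
    by auto
  have X: "X \<le> 2 * P * (ennreal (1 / l\<^sup>2) * U f + W f)" if f: "f \<in> S" for f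
  proof -
    have ray: "is_ray (ray f)" using f by (intro is_ray_ray gen_edges_edges[of _ J]) (simp add: S_def)
    have "ray f k = e" using f kJ by (auto simp: ray_def S_def gen_edges_def)
    then have pt: "ray_point (ray f) r = Inner e t" using ray_point_inner[OF ray r] by (simp add: r_def)
    have "primitive_on {r..r + l} (\<lambda>s. \<phi> (ray_point (ray f) s)) (\<lambda>s. D (ray_point (ray f) s))"
      by (rule primitive_on_subset[OF pr[OF ray]]) (use r radius_nonneg[of k] in auto)
    from primitive_on_pointwise_bound[OF this, of r n]
    have "ennreal ((norm (\<phi> (ray_point (ray f) r)))\<^sup>2) \<le> 2 * P *
        (ennreal (1 / (r + l - r)\<^sup>2) * (\<integral>\<^sup>+s\<in>{r..r + l}. ennreal (n s * (norm (\<phi> (ray_point (ray f) s)))\<^sup>2) \<partial>lebesgue) +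
         (\<integral>\<^sup>+s\<in>{r..r + l}. ennreal (n s * (norm (D (ray_point (ray f) s)))\<^sup>2) \<partial>lebesgue))"
      unfolding P_def n_def using l branching_ratio_pos measurable_card_gen_index
      by (simp add: branching_ratio_def[abs_def])
    then show ?thesis
      unfolding U_def W_def X_def pt
      using branching_ratio_pos[of k] by (simp add: ennreal_mult n_def less_imp_le)
  qed
  have "of_nat (card S) * X = (\<Sum>f\<in>S. X)" by simp
  also have "\<dots> \<le> (\<Sum>f\<in>S. 2 * P * (ennreal (1 / l\<^sup>2) * U f + W f))" by (intro sum_mono X)
  also have "\<dots> = 2 * P * (ennreal (1 / l\<^sup>2) * (\<Sum>f\<in>S. U f) + (\<Sum>f\<in>S. W f))"
    by (simp add: sum_distrib_left sum.distrib distrib_left)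
  also have "\<dots> \<le> 2 * P * (ennreal (1 / l\<^sup>2) * (of_nat (card S) * IU) + of_nat (card S) * IW)"
    by (intro mult_left_mono add_mono S) auto
  also have "\<dots> = of_nat (card S) * (2 * P * (ennreal (1 / l\<^sup>2) * IU + IW))"
    by (simp add: distrib_left ac_simps)
  finally have "X \<le> 2 * P * (ennreal (1 / l\<^sup>2) * IU + IW)"
    using S(3) by (subst (asm) ennreal_mult_le_mult_iff) auto
  then show ?thesis by (simp add: X_def P_def IU_def IW_def n_def)
qed

section \<open>Resistance of the forward tree and the diagonal of the resolvent\<close>

lemma branching_ratio_bound:
  assumes c: "0 < c" "\<And>r. 0 \<le> r \<Longrightarrow> c * (1 + r) powr (d - 1) \<le> real (g0 G r)"
    and C: "0 < C" "\<And>r. 0 \<le> r \<Longrightarrow> real (g0 G r) \<le> C * (1 + r) powr (d - 1)"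
    and r: "radius k < r" "r < radius (Suc k)" and s: "0 \<le> s" "\<forall>j. s \<noteq> radius j"
  shows "1 / branching_ratio k s \<le> C / c * ((1 + r) / (1 + s)) powr (d - 1)"
proof -
  have r0: "0 \<le> r" using r radius_nonneg[of k] by linarith
  have gi: "radius (gen_index s) < s" "s < radius (Suc (gen_index s))"
    using gen_index[OF s(1)] s(2)[rule_format, of "gen_index s"] by linarith+
  have "real (card (gen_edges k)) \<le> C * (1 + r) powr (d - 1)"
    using C(2)[OF r0] g0_interior[OF r] by simp
  moreover have "c * (1 + s) powr (d - 1) \<le> real (card (gen_edges (gen_index s)))"
    using c(2)[OF s(1)] g0_interior[OF gi] by simp
  moreover have "0 < c * (1 + s) powr (d - 1)" using c s by simp
  ultimately have "real (card (gen_edges k)) / real (card (gen_edges (gen_index s))) \<le> (C * (1 + r) powr (d - 1)) / (c * (1 + s) powr (d - 1))"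
    by (intro frac_le) auto
  then show ?thesis
    using r0 s by (simp add: branching_ratio_def powr_divide)
qed

text \<open>If \<delta> < 1, then (1 + r) / (1 + s) \<le> 1 allows the exponent d - 1 to be lowered
  to \<delta>, and 1 + s \<ge> s - r leaves an explicit integral. For \<delta> = 1 that would leave
  a logarithm; there the exponent d - 1 > 1 is kept, and the integral up to infinity is finite
  whatever \<open>l\<close> is.\<close>

lemma resistance_bound:
  assumes c: "0 < c" "\<And>r. 0 \<le> r \<Longrightarrow> c * (1 + r) powr (d - 1) \<le> real (g0 G r)"
    and C: "0 < C" "\<And>r. 0 \<le> r \<Longrightarrow> real (g0 G r) \<le> C * (1 + r) powr (d - 1)"
    and \<delta>: "(0 \<le> \<delta> \<and> \<delta> < 1 \<and> \<delta> \<le> d - 1) \<or> (\<delta> = 1 \<and> 2 < d)"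
  shows "\<exists>K>0. \<forall>k r l. radius k < r \<and> r < radius (Suc k) \<and> 0 < l \<longrightarrow>
    (\<integral>\<^sup>+s\<in>{r..r + l}. ennreal (1 / branching_ratio k s) \<partial>lebesgue) \<le> ennreal (K * ((1 + r) powr \<delta> * l powr (1 - \<delta>)))"
  using \<delta>
proof
  assume \<delta>: "0 \<le> \<delta> \<and> \<delta> < 1 \<and> \<delta> \<le> d - 1"
  define K where "K = C / c / (1 - \<delta>)"
  have K: "0 < K" using c C \<delta> by (simp add: K_def)
  show ?thesis
  proof (rule exI[of _ K], intro conjI K allI impI)
    fix k and r l :: real assume rl: "radius k < r \<and> r < radius (Suc k) \<and> 0 < l"
    then have r: "radius k < r" "r < radius (Suc k)" and l: "0 < l" by auto
    have r0: "0 \<le> r" using r radius_nonneg[of k] by linarith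
    have "(\<integral>\<^sup>+s\<in>{r..r + l}. ennreal (1 / branching_ratio k s) \<partial>lebesgue)
        \<le> (\<integral>\<^sup>+s. ennreal (C / c * (1 + r) powr \<delta>) * (ennreal ((s - r) powr (- \<delta>)) * indicator {r + 0..r + l} s) \<partial>lebesgue)"
    proof (rule nn_integral_mono_AE)
      show "AE s in lebesgue. ennreal (1 / branching_ratio k s) * indicator {r..r + l} s
          \<le> ennreal (C / c * (1 + r) powr \<delta>) * (ennreal ((s - r) powr (- \<delta>)) * indicator {r + 0..r + l} s)"
        using AE_neq_radius AE_lebesgue_neq[of r]
      proof eventually_elim
        case (elim s)
        show ?case
        proof (cases "s \<in> {r..r + l}")
          case True
          then have s: "r < s" using elim by auto
          have "1 / branching_ratio k s \<le> C / c * ((1 + r) / (1 + s)) powr (d - 1)"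
            using elim s r0 by (intro branching_ratio_bound[OF c C r]) auto
          moreover have "((1 + r) / (1 + s)) powr (d - 1) \<le> (1 + r) powr \<delta> * (s - r) powr (- \<delta>)"
          proof -
            have "((1 + r) / (1 + s)) powr (d - 1) \<le> ((1 + r) / (1 + s)) powr \<delta>"
              using \<delta> s r0 by (intro powr_mono') auto
            also have "((1 + r) / (1 + s)) powr \<delta> = (1 + r) powr \<delta> * (1 + s) powr (- \<delta>)"
              using s r0 powr_divide[of "1 + r" "1 + s" \<delta>] by (simp add: powr_minus_divide)
            also have "(1 + s) powr (- \<delta>) \<le> (s - r) powr (- \<delta>)"
              using \<delta> s r0 by (intro powr_mono2') auto
            finally show ?thesis by (simp add: mult_left_mono)
          qed
          then have "C / c * ((1 + r) / (1 + s)) powr (d - 1) \<le> C / c * ((1 + r) powr \<delta> * (s - r) powr (- \<delta>))"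
            using c(1) C(1) by (intro mult_left_mono) auto
          ultimately have "1 / branching_ratio k s \<le> C / c * (1 + r) powr \<delta> * (s - r) powr (- \<delta>)"
            unfolding mult.assoc by (rule order_trans)
          then have "ennreal (1 / branching_ratio k s) \<le> ennreal (C / c * (1 + r) powr \<delta> * (s - r) powr (- \<delta>))"
            by (rule ennreal_leI)
          also have "\<dots> = ennreal (C / c * (1 + r) powr \<delta>) * ennreal ((s - r) powr (- \<delta>))"
            using c C by (intro ennreal_mult) auto
          finally show ?thesis using True by simp
        qed simp
      qed
    qed
    also have "\<dots> = ennreal (C / c * (1 + r) powr \<delta>) * (\<integral>\<^sup>+s\<in>{r + 0..r + l}. ennreal ((s - r) powr (- \<delta>)) \<partial>lebesgue)"
      by (rule nn_integral_cmult, rule borel_measurable_lebesgueI) measurable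
    also have "(\<integral>\<^sup>+s\<in>{r + 0..r + l}. ennreal ((s - r) powr (- \<delta>)) \<partial>lebesgue) = (\<integral>\<^sup>+s\<in>{0..l}. ennreal (s powr (- \<delta>)) \<partial>lebesgue)"
      by (rule nn_integral_lebesgue_Icc_shift, rule borel_measurable_lebesgueI) measurable
    also have "\<dots> = (\<integral>\<^sup>+s\<in>{0..l}. ennreal (s powr ((1 - \<delta>) - 1)) \<partial>lborel)"
      by (simp add: nn_integral_completion)
    also have "\<dots> = ennreal (l powr (1 - \<delta>) / (1 - \<delta>))"
      using \<delta> l by (intro nn_integral_powr_Icc) auto
    also have "ennreal (C / c * (1 + r) powr \<delta>) * ennreal (l powr (1 - \<delta>) / (1 - \<delta>))
        = ennreal (C / c * (1 + r) powr \<delta> * (l powr (1 - \<delta>) / (1 - \<delta>)))"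
      using c C \<delta> by (intro ennreal_mult[symmetric]) auto
    also have "C / c * (1 + r) powr \<delta> * (l powr (1 - \<delta>) / (1 - \<delta>)) = K * ((1 + r) powr \<delta> * l powr (1 - \<delta>))"
      by (simp add: K_def)
    finally show "(\<integral>\<^sup>+s\<in>{r..r + l}. ennreal (1 / branching_ratio k s) \<partial>lebesgue) \<le> ennreal (K * ((1 + r) powr \<delta> * l powr (1 - \<delta>)))" .
  qed
next
  assume \<delta>: "\<delta> = 1 \<and> 2 < d"
  define K where "K = C / c / (d - 2)"
  have K: "0 < K" using c C \<delta> by (simp add: K_def)
  show ?thesis
  proof (rule exI[of _ K], intro conjI K allI impI)
    fix k and r l :: real assume rl: "radius k < r \<and> r < radius (Suc k) \<and> 0 < l"
    then have r: "radius k < r" "r < radius (Suc k)" and l: "0 < l" by auto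
    have r0: "0 \<le> r" using r radius_nonneg[of k] by linarith
    define f where "f y = ennreal (y powr (- (d - 2) - 1))" for y :: real
    have fm[measurable]: "f \<in> borel_measurable lebesgue"
      unfolding f_def[abs_def] by (rule borel_measurable_lebesgueI) measurable
    have "(\<integral>\<^sup>+s\<in>{r..r + l}. ennreal (1 / branching_ratio k s) \<partial>lebesgue)
        \<le> (\<integral>\<^sup>+s. ennreal (C / c * (1 + r) powr (d - 1)) * (f (s - (- 1)) * indicator {- 1 + (1 + r)..- 1 + (1 + r + l)} s) \<partial>lebesgue)"
    proof (rule nn_integral_mono_AE)
      show "AE s in lebesgue. ennreal (1 / branching_ratio k s) * indicator {r..r + l} s
          \<le> ennreal (C / c * (1 + r) powr (d - 1)) * (f (s - (- 1)) * indicator {- 1 + (1 + r)..- 1 + (1 + r + l)} s)"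
        using AE_neq_radius
      proof eventually_elim
        case (elim s)
        show ?case
        proof (cases "s \<in> {r..r + l}")
          case True
          then have s: "r \<le> s" by auto
          have "1 / branching_ratio k s \<le> C / c * ((1 + r) / (1 + s)) powr (d - 1)"
            using elim s r0 by (intro branching_ratio_bound[OF c C r]) auto
          also have "((1 + r) / (1 + s)) powr (d - 1) = (1 + r) powr (d - 1) * (1 + s) powr (- (d - 1))"
            using s r0 powr_divide[of "1 + r" "1 + s" "d - 1"] powr_minus_divide[of "1 + s" "d - 1"]
            by (simp del: minus_diff_eq)
          finally have "ennreal (1 / branching_ratio k s) \<le> ennreal (C / c * (1 + r) powr (d - 1) * (1 + s) powr (- (d - 1)))"
            by (intro ennreal_leI) (simp add: mult.assoc)
          also have "\<dots> = ennreal (C / c * (1 + r) powr (d - 1)) * ennreal ((1 + s) powr (- (d - 1)))"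
            using c C by (intro ennreal_mult) auto
          finally show ?thesis using True by (simp add: f_def add.commute)
        qed simp
      qed
    qed
    also have "\<dots> = ennreal (C / c * (1 + r) powr (d - 1)) * (\<integral>\<^sup>+s\<in>{- 1 + (1 + r)..- 1 + (1 + r + l)}. f (s - (- 1)) \<partial>lebesgue)"
      unfolding f_def by (rule nn_integral_cmult, rule borel_measurable_lebesgueI) measurable
    also have "(\<integral>\<^sup>+s\<in>{- 1 + (1 + r)..- 1 + (1 + r + l)}. f (s - (- 1)) \<partial>lebesgue) = (\<integral>\<^sup>+s\<in>{1 + r..1 + r + l}. f s \<partial>lebesgue)"
      by (rule nn_integral_lebesgue_Icc_shift) (intro borel_measurable_times_ennreal fm borel_measurable_indicator, simp)
    also have "\<dots> \<le> (\<integral>\<^sup>+s\<in>{1 + r..}. f s \<partial>lebesgue)"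
      by (intro nn_integral_mono) (auto split: split_indicator)
    also have "\<dots> = (\<integral>\<^sup>+s\<in>{1 + r..}. ennreal (s powr (- (d - 2) - 1)) \<partial>lborel)"
      by (simp add: nn_integral_completion f_def)
    also have "\<dots> = ennreal ((1 + r) powr (- (d - 2)) / (d - 2))"
      using \<delta> r0 by (intro nn_integral_powr_atLeast) auto
    also have "ennreal (C / c * (1 + r) powr (d - 1)) * ennreal ((1 + r) powr (- (d - 2)) / (d - 2))
        = ennreal (C / c * (1 + r) powr (d - 1) * ((1 + r) powr (- (d - 2)) / (d - 2)))"
      using c C \<delta> by (intro ennreal_mult[symmetric]) auto
    also have "C / c * (1 + r) powr (d - 1) * ((1 + r) powr (- (d - 2)) / (d - 2)) = K * ((1 + r) powr \<delta> * l powr (1 - \<delta>))"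
    proof -
      have "(1 + r) powr (d - 1) * (1 + r) powr (- (d - 2)) = (1 + r) powr 1"
        unfolding powr_add[symmetric] by simp
      then show ?thesis using l \<delta> by (simp add: K_def field_simps)
    qed
    finally show "(\<integral>\<^sup>+s\<in>{r..r + l}. ennreal (1 / branching_ratio k s) \<partial>lebesgue) \<le> ennreal (K * ((1 + r) powr \<delta> * l powr (1 - \<delta>)))"
      by (simp add: mult_left_mono)
  qed
qed

text \<open>An upper bound for the diagonal of the resolvent kernel at energy \<open>- E\<close>.\<close>

definition resolvent_bound :: "real \<Rightarrow> real \<Rightarrow> bool" where
  "resolvent_bound \<delta> K \<longleftrightarrow> 0 < K \<and> (\<forall>\<phi> D E. tree_primitive \<phi> D \<and> 0 < E \<longrightarrow>
    (\<forall>x\<in>points G - Vertex ` verts G. ennreal ((norm (\<phi> x))\<^sup>2) \<le>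
      ennreal (K * ((1 + root_dist G x) powr \<delta> * E powr (- (1 - \<delta>) / 2))) *
      ((\<integral>\<^sup>+x. ennreal ((norm (D x))\<^sup>2) \<partial>tree_measure G) + ennreal E * (\<integral>\<^sup>+x. ennreal ((norm (\<phi> x))\<^sup>2) \<partial>tree_measure G))))"

lemma resolvent_bound_exists:
  assumes gd: "global_dimension G d"
    and \<delta>: "(0 \<le> \<delta> \<and> \<delta> < 1 \<and> \<delta> \<le> d - 1) \<or> (\<delta> = 1 \<and> 2 < d)"
  shows "\<exists>K. resolvent_bound \<delta> K"
proof -
  obtain c C where c: "0 < c" "\<And>r. 0 \<le> r \<Longrightarrow> c * (1 + r) powr (d - 1) \<le> real (g0 G r)"
    and C: "0 < C" "\<And>r. 0 \<le> r \<Longrightarrow> real (g0 G r) \<le> C * (1 + r) powr (d - 1)"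
    by (rule global_dimension_bounds[OF gd]) (rule that)
  obtain K where K: "K > 0" and P: "\<And>k r l. radius k < r \<Longrightarrow> r < radius (Suc k) \<Longrightarrow> 0 < l \<Longrightarrow>
    (\<integral>\<^sup>+s\<in>{r..r + l}. ennreal (1 / branching_ratio k s) \<partial>lebesgue) \<le> ennreal (K * ((1 + r) powr \<delta> * l powr (1 - \<delta>)))"
    using resistance_bound[OF c C \<delta>] by blast
  have "resolvent_bound \<delta> (2 * K)"
    unfolding resolvent_bound_def
  proof (intro conjI allI impI)
    show "0 < 2 * K" using K by simp
    fix \<phi> D and E :: real
    assume "tree_primitive \<phi> D \<and> 0 < E"
    then have \<phi>: "tree_primitive \<phi> D" and E: "0 < E" by auto
    \<comment> \<open>With this length the weight \<open>1 / l\<^sup>2\<close> of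
      \<open>pointwise_bound\<close> is \<open>E\<close>, and the resistance contributes
      \<open>E powr (- (1 - \<delta>) / 2)\<close>.\<close>
    define l where "l = E powr (- 1 / 2)"
    have l: "0 < l" using E by (simp add: l_def)
    have l2: "1 / l\<^sup>2 = E"
    proof -
      have "l\<^sup>2 = E powr (-1)" using E by (simp add: l_def powr_powr[symmetric] powr_half_sqrt powr_power)
      then show ?thesis using E by (simp add: powr_minus divide_inverse)
    qed
    have l\<delta>: "l powr (1 - \<delta>) = E powr (- (1 - \<delta>) / 2)"
      unfolding l_def powr_powr by (rule arg_cong[of _ _ "\<lambda>y. E powr y"]) (simp add: field_simps)
    define A where "A = (\<integral>\<^sup>+x. ennreal ((norm (D x))\<^sup>2) \<partial>tree_measure G) + ennreal E * (\<integral>\<^sup>+x. ennreal ((norm (\<phi> x))\<^sup>2) \<partial>tree_measure G)"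
    show "\<forall>x\<in>points G - Vertex ` verts G. ennreal ((norm (\<phi> x))\<^sup>2) \<le>
        ennreal (2 * K * ((1 + root_dist G x) powr \<delta> * E powr (- (1 - \<delta>) / 2))) *
        ((\<integral>\<^sup>+x. ennreal ((norm (D x))\<^sup>2) \<partial>tree_measure G) + ennreal E * (\<integral>\<^sup>+x. ennreal ((norm (\<phi> x))\<^sup>2) \<partial>tree_measure G))"
    proof
      fix x :: "('v, 'e) point" assume "x \<in> points G - Vertex ` verts G"
      then obtain e t where et: "x = Inner e t" "e \<in> edges G" "0 < t" "ereal t < len G e"
        by (auto simp: points_def)
      then obtain k where k: "e \<in> gen_edges k" using edges_eq_UN by blast
      then have x: "x = Inner e t" "e \<in> gen_edges k" "0 < t" "t < radius (Suc k) - radius k"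
        using et len_gen[OF k] by simp_all
      define r where "r = radius k + t"
      have rd: "root_dist G x = r" using x root_dist_Inner by (simp add: r_def)
      have r: "radius k < r" "r < radius (Suc k)" using x by (auto simp: r_def)
      have "ennreal ((norm (\<phi> x))\<^sup>2) \<le> 2 * (\<integral>\<^sup>+s\<in>{r..r + l}. ennreal (1 / branching_ratio k s) \<partial>lebesgue) * A"
        using pointwise_bound[OF \<phi> x(2-4) l] by (simp add: x(1) r_def l2 A_def add.commute)
      also have "\<dots> \<le> 2 * ennreal (K * ((1 + r) powr \<delta> * l powr (1 - \<delta>))) * A"
        by (intro mult_right_mono mult_left_mono P r l) auto
      also have "2 * ennreal (K * ((1 + r) powr \<delta> * l powr (1 - \<delta>))) = ennreal (2 * K * ((1 + r) powr \<delta> * l powr (1 - \<delta>)))"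
        using K by (simp add: ennreal_mult' mult.assoc)
      finally show "ennreal ((norm (\<phi> x))\<^sup>2) \<le>
        ennreal (2 * K * ((1 + root_dist G x) powr \<delta> * E powr (- (1 - \<delta>) / 2))) *
        ((\<integral>\<^sup>+x. ennreal ((norm (D x))\<^sup>2) \<partial>tree_measure G) + ennreal E * (\<integral>\<^sup>+x. ennreal ((norm (\<phi> x))\<^sup>2) \<partial>tree_measure G))"
        by (simp add: A_def rd l\<delta>)
    qed
  qed
  then show ?thesis by blast
qed

end

section \<open>Finite families of eigenfunctions\<close>

text \<open>One equation eliminates one unknown. In place of a min-max principle, this supplies
  combinations of eigenfunctions subject to fewer linear conditions than there are
  functions.\<close>

lemma homogeneous_system_nontrivial_solution:
  fixes a :: "'k \<Rightarrow> 'i \<Rightarrow> 'a::field"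
  assumes "finite K" "finite I" "card K < card I"
  shows "\<exists>c. (\<exists>i\<in>I. c i \<noteq> 0) \<and> (\<forall>k\<in>K. (\<Sum>i\<in>I. c i * a k i) = 0)"
  using assms
proof (induction K arbitrary: I a rule: finite_induct)
  case empty
  then have "I \<noteq> {}" by auto
  then show ?case by (intro exI[of _ "\<lambda>_. 1"]) auto
next
  case (insert k K)
  show ?case
  proof (cases "\<forall>i\<in>I. a k i = 0")
    case True
    have "card K < card I" using insert by auto
    from insert.IH[OF insert.prems(1) this, of a] obtain c where
      "\<exists>i\<in>I. c i \<noteq> 0" "\<forall>k\<in>K. (\<Sum>i\<in>I. c i * a k i) = 0" by blast
    then show ?thesis using True by (intro exI[of _ c]) auto
  next
    case False
    then obtain p where p: "p \<in> I" "a k p \<noteq> 0" by blast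
    let ?J = "I - {p}"
    have "card K < card ?J" using insert p by auto
    moreover have "finite ?J" using insert by auto
    ultimately obtain c where c: "\<exists>i\<in>?J. c i \<noteq> 0"
      "\<forall>l\<in>K. (\<Sum>i\<in>?J. c i * (a l i - a l p * a k i / a k p)) = 0"
      using insert.IH[of ?J "\<lambda>l i. a l i - a l p * a k i / a k p"] by blast
    define s where "s = (\<Sum>i\<in>?J. c i * a k i)"
    define c' where "c' = c(p := - s / a k p)"
    have split: "(\<Sum>i\<in>I. c' i * a l i) = - s / a k p * a l p + (\<Sum>i\<in>?J. c i * a l i)" for l
    proof -
      have "(\<Sum>i\<in>I. c' i * a l i) = c' p * a l p + (\<Sum>i\<in>?J. c' i * a l i)"
        using p(1) insert.prems(1) by (rule sum.remove[rotated])
      also have "(\<Sum>i\<in>?J. c' i * a l i) = (\<Sum>i\<in>?J. c i * a l i)"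
        by (intro sum.cong) (auto simp: c'_def)
      finally show ?thesis by (simp add: c'_def)
    qed
    have "(\<Sum>i\<in>I. c' i * a l i) = 0" if "l \<in> K" for l
    proof -
      have "0 = (\<Sum>i\<in>?J. c i * (a l i - a l p * a k i / a k p))" using c(2) that by simp
      also have "\<dots> = (\<Sum>i\<in>?J. c i * a l i) - (a l p / a k p) * s"
        unfolding s_def sum_distrib_left sum_subtractf[symmetric]
        by (intro sum.cong) (auto simp: algebra_simps)
      finally show ?thesis unfolding split by (simp add: algebra_simps)
    qed
    moreover have "(\<Sum>i\<in>I. c' i * a k i) = 0"
      unfolding split using p(2) by (simp add: s_def)
    moreover have "\<exists>i\<in>I. c' i \<noteq> 0" using c(1) by (auto simp: c'_def)
    ultimately show ?thesis by (intro exI[of _ c']) auto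
  qed
qed

section \<open>Quadratic forms on the span of finitely many eigenfunctions\<close>

lemma integrable_mult_cnj:
  fixes f g :: "'x \<Rightarrow> complex"
  assumes [measurable]: "f \<in> borel_measurable M" "g \<in> borel_measurable M"
    and "integrable M (\<lambda>x. (norm (f x))\<^sup>2)" "integrable M (\<lambda>x. (norm (g x))\<^sup>2)"
  shows "integrable M (\<lambda>x. f x * cnj (g x))"
proof (rule Bochner_Integration.integrable_bound)
  show "integrable M (\<lambda>x. (norm (f x))\<^sup>2 + (norm (g x))\<^sup>2)" using assms(3,4) by simp
  have "norm (f x * cnj (g x)) \<le> norm ((norm (f x))\<^sup>2 + (norm (g x))\<^sup>2)" for x
  proof -
    have "2 * norm (f x) * norm (g x) \<le> (norm (f x))\<^sup>2 + (norm (g x))\<^sup>2" by (rule sum_squares_bound)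
    moreover have "0 \<le> norm (f x) * norm (g x)" by simp
    ultimately have "norm (f x) * norm (g x) \<le> (norm (f x))\<^sup>2 + (norm (g x))\<^sup>2" by linarith
    then show ?thesis by (simp add: norm_mult)
  qed
  then show "AE x in M. norm (f x * cnj (g x)) \<le> norm ((norm (f x))\<^sup>2 + (norm (g x))\<^sup>2)" by simp
  show "(\<lambda>x. f x * cnj (g x)) \<in> borel_measurable M"
    using assms(1,2) by (intro borel_measurable_times borel_measurable_continuous_on[OF continuous_on_cnj[OF continuous_on_id]]) auto
qed

lemma L2_integrable_mult_cnj: "f \<in> L2 M \<Longrightarrow> g \<in> L2 M \<Longrightarrow> integrable M (\<lambda>x. f x * cnj (g x))"
  unfolding L2_def by (intro integrable_mult_cnj) auto

lemma L2_inner_commute: "L2_inner M f g = cnj (L2_inner M g f)"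
  unfolding L2_inner_def by (subst Bochner_Integration.integral_cnj[symmetric]) (simp add: mult.commute)

lemma L2_inner_self: "L2_inner M f f = of_real (\<integral>x. (norm (f x))\<^sup>2 \<partial>M)"
  unfolding L2_inner_def by (simp add: complex_norm_square[symmetric] flip: of_real_power)

definition lincomb :: "'i set \<Rightarrow> ('i \<Rightarrow> 'x \<Rightarrow> complex) \<Rightarrow> ('i \<Rightarrow> complex) \<Rightarrow> 'x \<Rightarrow> complex" where
  "lincomb I f c x = (\<Sum>i\<in>I. c i * f i x)"

lemma L2_inner_lincomb:
  assumes "\<And>i. i \<in> I \<Longrightarrow> f i \<in> L2 M"
  shows "L2_inner M (lincomb I f c) (lincomb I f c') = (\<Sum>i\<in>I. \<Sum>j\<in>I. c i * cnj (c' j) * L2_inner M (f i) (f j))"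
proof -
  have "L2_inner M (lincomb I f c) (lincomb I f c') = (\<integral>x. (\<Sum>i\<in>I. \<Sum>j\<in>I. c i * cnj (c' j) * (f i x * cnj (f j x))) \<partial>M)"
    unfolding L2_inner_def lincomb_def
    by (intro Bochner_Integration.integral_cong) (auto simp: sum_product algebra_simps intro!: sum.cong)
  also have "\<dots> = (\<Sum>i\<in>I. \<Sum>j\<in>I. \<integral>x. c i * cnj (c' j) * (f i x * cnj (f j x)) \<partial>M)"
    using L2_integrable_mult_cnj[OF assms assms]
    by (subst Bochner_Integration.integral_sum; (intro sum.cong refl Bochner_Integration.integral_sum)?)
      (auto intro!: Bochner_Integration.integrable_sum)
  finally show ?thesis by (simp add: L2_inner_def)
qed

lemma lincomb_L2:
  assumes "finite I" "\<And>i. i \<in> I \<Longrightarrow> f i \<in> L2 M"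
  shows "lincomb I f c \<in> L2 M"
proof -
  have m: "lincomb I f c \<in> borel_measurable M"
    unfolding lincomb_def[abs_def] using assms(2)
    by (intro borel_measurable_sum borel_measurable_times) (auto simp: L2_def)
  have eq: "(\<lambda>x. complex_of_real ((norm (lincomb I f c x))\<^sup>2)) = (\<lambda>x. \<Sum>i\<in>I. \<Sum>j\<in>I. c i * cnj (c j) * (f i x * cnj (f j x)))"
    by (rule ext) (simp add: complex_norm_square lincomb_def sum_product algebra_simps del: of_real_power)
  have "integrable M (\<lambda>x. complex_of_real ((norm (lincomb I f c x))\<^sup>2))"
    unfolding eq using L2_integrable_mult_cnj[OF assms(2) assms(2)]
    by (intro Bochner_Integration.integrable_sum integrable_mult_right) auto
  then have "integrable M (\<lambda>x. (norm (lincomb I f c x))\<^sup>2)" by (simp only: complex_of_real_integrable_eq)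
  with m show ?thesis by (simp add: L2_def)
qed

lemma integral_norm2_lincomb:
  assumes "\<And>i. i \<in> I \<Longrightarrow> f i \<in> L2 M"
  shows "complex_of_real (\<integral>x. (norm (lincomb I f c x))\<^sup>2 \<partial>M) = (\<Sum>i\<in>I. \<Sum>j\<in>I. c i * cnj (c j) * L2_inner M (f i) (f j))"
  unfolding L2_inner_self[symmetric] by (rule L2_inner_lincomb[OF assms])

text \<open>Of the operator only the weak eigenvalue equation tested within the family is recorded,
  with the derivatives as separate data \<open>d\<close>. All counting takes place in the finite
  span.\<close>

locale form_family =
  fixes M :: "'x measure" and V :: "'x \<Rightarrow> real" and I :: "'i set"
    and f d :: "'i \<Rightarrow> 'x \<Rightarrow> complex" and \<mu> :: "'i \<Rightarrow> real"
  assumes fin: "finite I"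
    and fL2: "i \<in> I \<Longrightarrow> f i \<in> L2 M" and dL2: "i \<in> I \<Longrightarrow> d i \<in> L2 M"
    and V_meas [measurable]: "V \<in> borel_measurable M" and V_nonneg: "x \<in> space M \<Longrightarrow> 0 \<le> V x"
    and V_int: "i \<in> I \<Longrightarrow> integrable M (\<lambda>x. V x * (norm (f i x))\<^sup>2)"
    and form_eq: "i \<in> I \<Longrightarrow> j \<in> I \<Longrightarrow>
      L2_inner M (d i) (d j) - (\<integral>x. of_real (V x) * f i x * cnj (f j x) \<partial>M) = of_real (\<mu> i) * L2_inner M (f i) (f j)"
begin

text \<open>Absorbing the square root of the potential makes the potential energy another
  \<open>L2_inner\<close>, to which the bilinear expansions apply.\<close>

definition g where "g i x = of_real (sqrt (V x)) * f i x"

lemma gL2: "i \<in> I \<Longrightarrow> g i \<in> L2 M"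
proof -
  assume i: "i \<in> I"
  have [measurable]: "f i \<in> borel_measurable M" using fL2[OF i] by (simp add: L2_def)
  have "g i \<in> borel_measurable M" unfolding g_def[abs_def] by measurable
  moreover have "integrable M (\<lambda>x. (norm (g i x))\<^sup>2) \<longleftrightarrow> integrable M (\<lambda>x. V x * (norm (f i x))\<^sup>2)"
    using V_nonneg by (intro Bochner_Integration.integrable_cong) (auto simp: g_def norm_mult power_mult_distrib)
  ultimately show "g i \<in> L2 M" using V_int[OF i] by (simp add: L2_def)
qed

lemma g_inner: "L2_inner M (g i) (g j) = (\<integral>x. of_real (V x) * f i x * cnj (f j x) \<partial>M)"
  unfolding L2_inner_def g_def using V_nonneg
  by (intro Bochner_Integration.integral_cong) (auto simp: of_real_mult[symmetric] algebra_simps simp del: of_real_mult)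

lemma lincomb_g: "x \<in> space M \<Longrightarrow> (norm (lincomb I g c x))\<^sup>2 = V x * (norm (lincomb I f c x))\<^sup>2"
proof -
  assume "x \<in> space M"
  have "lincomb I g c x = of_real (sqrt (V x)) * lincomb I f c x"
    by (simp add: lincomb_def g_def sum_distrib_left algebra_simps)
  then show ?thesis using V_nonneg[OF \<open>x \<in> space M\<close>] by (simp add: norm_mult power_mult_distrib)
qed

text \<open>The form is Hermitian, so its value at a pair of eigenfunctions can be computed with
  either eigenvalue.\<close>

lemma orthogonal:
  assumes "i \<in> I" "j \<in> I" "\<mu> i \<noteq> \<mu> j"
  shows "L2_inner M (f i) (f j) = 0"
proof -
  have "of_real (\<mu> i) * L2_inner M (f i) (f j) = L2_inner M (d i) (d j) - L2_inner M (g i) (g j)"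
    using form_eq[OF assms(1,2)] g_inner by simp
  also have "\<dots> = cnj (L2_inner M (d j) (d i) - L2_inner M (g j) (g i))"
    by (simp add: L2_inner_commute[of M "d i"] L2_inner_commute[of M "g i"])
  also have "\<dots> = cnj (of_real (\<mu> j) * L2_inner M (f j) (f i))"
    using form_eq[OF assms(2,1)] g_inner by simp
  also have "\<dots> = of_real (\<mu> j) * L2_inner M (f i) (f j)"
    by (simp add: L2_inner_commute[of M "f i"])
  finally show ?thesis using assms(3) by simp
qed

text \<open>Members with different eigenvalues are orthogonal, so the difference of the two sides is
  the double sum of the products of \<open>f i\<close> and \<open>f j\<close> with the factor
  \<open>- \<mu> i - E\<close>. Splitting this factor into two equal square roots, one for each
  coefficient, exhibits a squared norm.\<close>

lemma energy_bound:
  assumes E: "\<And>i. i \<in> I \<Longrightarrow> \<mu> i \<le> - E"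
  shows "(\<integral>x. (norm (lincomb I d c x))\<^sup>2 \<partial>M) + E * (\<integral>x. (norm (lincomb I f c x))\<^sup>2 \<partial>M)
    \<le> (\<integral>x. V x * (norm (lincomb I f c x))\<^sup>2 \<partial>M)"
proof -
  define c' where "c' i = of_real (sqrt (- \<mu> i - E)) * c i" for i
  define Q where "Q h c = (\<integral>x. (norm (lincomb I h c x))\<^sup>2 \<partial>M)" for h :: "'i \<Rightarrow> 'x \<Rightarrow> complex" and c
  have "complex_of_real (Q f c') = (\<Sum>i\<in>I. \<Sum>j\<in>I. c' i * cnj (c' j) * L2_inner M (f i) (f j))"
    unfolding Q_def by (rule integral_norm2_lincomb[OF fL2])
  also have "\<dots> = (\<Sum>i\<in>I. \<Sum>j\<in>I. c i * cnj (c j) * (L2_inner M (g i) (g j) - L2_inner M (d i) (d j) - of_real E * L2_inner M (f i) (f j)))"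
  proof (intro sum.cong refl)
    fix i j assume ij: "i \<in> I" "j \<in> I"
    have eq: "L2_inner M (g i) (g j) - L2_inner M (d i) (d j) = - of_real (\<mu> i) * L2_inner M (f i) (f j)"
      using form_eq[OF ij] g_inner by (simp add: algebra_simps)
    show "c' i * cnj (c' j) * L2_inner M (f i) (f j) =
      c i * cnj (c j) * (L2_inner M (g i) (g j) - L2_inner M (d i) (d j) - of_real E * L2_inner M (f i) (f j))"
    proof (cases "\<mu> i = \<mu> j")
      case True
      have sq: "complex_of_real (sqrt (- \<mu> i - E)) * complex_of_real (sqrt (- \<mu> i - E)) = of_real (- \<mu> i - E)"
        using E[OF ij(1)] by (simp add: of_real_mult[symmetric] del: of_real_mult)
      have "c' i * cnj (c' j) = c i * cnj (c j) * (complex_of_real (sqrt (- \<mu> i - E)) * complex_of_real (sqrt (- \<mu> i - E)))"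
        by (simp add: c'_def True ac_simps)
      then have cc: "c' i * cnj (c' j) = c i * cnj (c j) * of_real (- \<mu> i - E)"
        unfolding sq .
      have "L2_inner M (g i) (g j) - L2_inner M (d i) (d j) - of_real E * L2_inner M (f i) (f j)
          = of_real (- \<mu> i - E) * L2_inner M (f i) (f j)"
        unfolding eq by (simp add: left_diff_distrib)
      then show ?thesis unfolding cc by (simp only: mult.assoc)
    next
      case False
      then show ?thesis unfolding eq using orthogonal[OF ij] by simp
    qed
  qed
  also have "\<dots> = (\<Sum>i\<in>I. \<Sum>j\<in>I. c i * cnj (c j) * L2_inner M (g i) (g j))
      - (\<Sum>i\<in>I. \<Sum>j\<in>I. c i * cnj (c j) * L2_inner M (d i) (d j))
      - of_real E * (\<Sum>i\<in>I. \<Sum>j\<in>I. c i * cnj (c j) * L2_inner M (f i) (f j))"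
    by (simp add: sum_subtractf sum.distrib sum_distrib_left algebra_simps)
  also have "\<dots> = complex_of_real (Q g c - Q d c - E * Q f c)"
  proof -
    have "(\<Sum>i\<in>I. \<Sum>j\<in>I. c i * cnj (c j) * L2_inner M (h i) (h j)) = complex_of_real (Q h c)"
      if "h = f \<or> h = g \<or> h = d" for h
      unfolding Q_def by (rule integral_norm2_lincomb[symmetric]) (use that fL2 gL2 dL2 in auto)
    then show ?thesis by simp
  qed
  finally have "Q f c' = Q g c - Q d c - E * Q f c" by (simp only: of_real_eq_iff)
  moreover have "0 \<le> Q f c'" by (simp add: Q_def)
  moreover have "Q g c = (\<integral>x. V x * (norm (lincomb I f c x))\<^sup>2 \<partial>M)"
    unfolding Q_def by (intro Bochner_Integration.integral_cong refl lincomb_g)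
  ultimately show ?thesis by (simp add: Q_def)
qed

lemma integrable_lincomb:
  "integrable M (\<lambda>x. (norm (lincomb I f c x))\<^sup>2)" "integrable M (\<lambda>x. (norm (lincomb I d c x))\<^sup>2)"
  "integrable M (\<lambda>x. V x * (norm (lincomb I f c x))\<^sup>2)"
proof -
  show "integrable M (\<lambda>x. (norm (lincomb I f c x))\<^sup>2)" "integrable M (\<lambda>x. (norm (lincomb I d c x))\<^sup>2)"
    using lincomb_L2[OF fin fL2] lincomb_L2[OF fin dL2] by (auto simp: L2_def)
  have "integrable M (\<lambda>x. (norm (lincomb I g c x))\<^sup>2)"
    using lincomb_L2[OF fin gL2] by (auto simp: L2_def)
  then show "integrable M (\<lambda>x. V x * (norm (lincomb I f c x))\<^sup>2)"
    by (rule iffD1[OF Bochner_Integration.integrable_cong[OF refl], rotated]) (simp add: lincomb_g)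
qed

end

text \<open>Independence is expressed through the norm: linear independence of the functions by
  itself would not exclude a nontrivial combination that vanishes almost everywhere.\<close>

locale eigenfamily = form_family M V I f d \<mu>
  for M :: "'x measure" and V :: "'x \<Rightarrow> real" and I :: "'i set"
    and f d :: "'i \<Rightarrow> 'x \<Rightarrow> complex" and \<mu> :: "'i \<Rightarrow> real" +
  assumes indep: "\<exists>i\<in>I. c i \<noteq> 0 \<Longrightarrow> 0 < (\<integral>x. (norm (lincomb I f c x))\<^sup>2 \<partial>M)"
begin

text \<open>Gram-Schmidt for the energy form, which is positive definite by \<open>indep\<close> and
  \<open>0 < E\<close>. Each new vector is a nontrivial solution of n equations in
  \<open>card I\<close> unknowns, so no projection is computed.\<close>

lemma orthonormal_coefficients:
  assumes E: "0 < E" and n: "n \<le> card I"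
  shows "\<exists>w :: nat \<Rightarrow> _ \<Rightarrow> complex. \<forall>p<n. \<forall>q<n.
    L2_inner M (lincomb I d (w p)) (lincomb I d (w q)) + of_real E * L2_inner M (lincomb I f (w p)) (lincomb I f (w q))
      = (if p = q then 1 else 0)"
  using n
proof (induction n)
  case (Suc n)
  define a where "a c c' = L2_inner M (lincomb I d c) (lincomb I d c') + of_real E * L2_inner M (lincomb I f c) (lincomb I f c')" for c c'
  have a_eq: "a c c' = (\<Sum>i\<in>I. c i * (\<Sum>j\<in>I. cnj (c' j) * (L2_inner M (d i) (d j) + of_real E * L2_inner M (f i) (f j))))" for c c'
  proof -
    have "L2_inner M (lincomb I h c) (lincomb I h c') = (\<Sum>i\<in>I. \<Sum>j\<in>I. c i * cnj (c' j) * L2_inner M (h i) (h j))"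
      if "h = d \<or> h = f" for h
      by (rule L2_inner_lincomb) (use that dL2 fL2 in auto)
    then show ?thesis
      unfolding a_def by (simp add: sum_distrib_left sum.distrib[symmetric] algebra_simps)
  qed
  have a_commute: "a c c' = cnj (a c' c)" for c c'
    unfolding a_def by (simp add: L2_inner_commute[of M "lincomb I d c"] L2_inner_commute[of M "lincomb I f c"])
  obtain w where w: "\<And>p q. p < n \<Longrightarrow> q < n \<Longrightarrow> a (w p) (w q) = (if p = q then 1 else 0)"
    using Suc unfolding a_def by (auto simp: less_imp_le)
  obtain c where c: "\<exists>i\<in>I. c i \<noteq> 0" and orth: "\<And>q. q < n \<Longrightarrow> a c (w q) = 0"
    using homogeneous_system_nontrivial_solution[of "{..<n}" I "\<lambda>q i. \<Sum>j\<in>I. cnj (w q j) * (L2_inner M (d i) (d j) + of_real E * L2_inner M (f i) (f j))"]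
      fin Suc.prems unfolding a_eq by auto
  define A where "A = (\<integral>x. (norm (lincomb I d c x))\<^sup>2 \<partial>M) + E * (\<integral>x. (norm (lincomb I f c x))\<^sup>2 \<partial>M)"
  have acc: "a c c = of_real A" unfolding a_def A_def L2_inner_self by simp
  have "0 \<le> (\<integral>x. (norm (lincomb I d c x))\<^sup>2 \<partial>M)" by simp
  then have A: "0 < A" unfolding A_def using mult_pos_pos[OF E indep[OF c]] by linarith
  define v where "v i = of_real (1 / sqrt A) * c i" for i
  have av: "a v c' = of_real (1 / sqrt A) * a c c'" for c'
    unfolding a_eq v_def by (simp add: sum_distrib_left mult.assoc)
  have avv: "a v v = 1"
  proof -
    have "a v c = of_real (1 / sqrt A * A)" unfolding av acc by (simp only: of_real_mult)
    then have "a c v = of_real (1 / sqrt A * A)" using a_commute[of c v] by (simp only: complex_cnj_complex_of_real)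
    then have "a v v = of_real (1 / sqrt A * (1 / sqrt A * A))" unfolding av[of v] by (simp only: of_real_mult)
    also have "1 / sqrt A * (1 / sqrt A * A) = 1" using A by simp
    finally show ?thesis by simp
  qed
  have avw: "a v (w q) = 0" "a (w q) v = 0" if "q < n" for q
    using av[of "w q"] orth[OF that] a_commute[of "w q" v] by auto
  have "\<forall>p<Suc n. \<forall>q<Suc n. a ((w(n := v)) p) ((w(n := v)) q) = (if p = q then 1 else 0)"
    using w avv avw by (auto simp: less_Suc_eq)
  then show ?case unfolding a_def by blast
qed simp

text \<open>For combinations u_p that are orthonormal in the energy form, the sum of |u_p(x)|^2 is
  at most \<open>H x\<close>, as for the diagonal of a reproducing kernel, while 1 is at most the
  integral of (V - E)_+ |u_p|^2 for each p. Adding the latter over p and inserting the former bounds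
  the number of functions.\<close>

lemma Birman_Schwinger:
  assumes E: "0 < E" "\<And>i. i \<in> I \<Longrightarrow> \<mu> i \<le> - (2 * E)"
    and X: "AE x in M. x \<in> X" and H: "\<And>x. x \<in> X \<Longrightarrow> 0 \<le> H x"
    and bound: "\<And>c x. x \<in> X \<Longrightarrow> (norm (lincomb I f c x))\<^sup>2 \<le>
      H x * ((\<integral>x. (norm (lincomb I d c x))\<^sup>2 \<partial>M) + E * (\<integral>x. (norm (lincomb I f c x))\<^sup>2 \<partial>M))"
  shows "of_nat (card I) \<le> (\<integral>\<^sup>+x. ennreal (max 0 (V x - E) * H x) \<partial>M)"
proof -
  define N where "N = card I"
  define A where "A c = (\<integral>x. (norm (lincomb I d c x))\<^sup>2 \<partial>M) + E * (\<integral>x. (norm (lincomb I f c x))\<^sup>2 \<partial>M)" for c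
  define a where "a c c' = L2_inner M (lincomb I d c) (lincomb I d c') + of_real E * L2_inner M (lincomb I f c) (lincomb I f c')" for c c'
  obtain w where w: "\<And>p q. p < N \<Longrightarrow> q < N \<Longrightarrow> a (w p) (w q) = (if p = q then 1 else 0)"
    using orthonormal_coefficients[OF E(1), of N] unfolding a_def N_def by auto
  have aA: "a c c = of_real (A c)" for c unfolding a_def A_def L2_inner_self by simp
  have wm: "lincomb I f c \<in> borel_measurable M" for c using lincomb_L2[OF fin fL2] by (auto simp: L2_def)
  have diag: "(\<Sum>p<N. (norm (lincomb I f (w p) x))\<^sup>2) \<le> H x" if x: "x \<in> X" for x
  proof -
    define S where "S = (\<Sum>p<N. (norm (lincomb I f (w p) x))\<^sup>2)"
    \<comment> \<open>The combination with these coefficients has value \<open>S\<close> at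
      \<open>x\<close> and energy \<open>S\<close>, so the bound becomes
      \<open>S\<^sup>2 \<le> H x * S\<close>.\<close>
    define b where "b p = cnj (lincomb I f (w p) x)" for p
    define c where "c i = (\<Sum>p<N. b p * w p i)" for i
    have lin: "lincomb I h c y = lincomb {..<N} (\<lambda>p. lincomb I h (w p)) b y" for h :: "'i \<Rightarrow> 'x \<Rightarrow> complex" and y
      unfolding lincomb_def c_def sum_distrib_left sum_distrib_right by (subst sum.swap) (simp add: mult.assoc)
    then have lin': "lincomb I h c = lincomb {..<N} (\<lambda>p. lincomb I h (w p)) b" for h :: "'i \<Rightarrow> 'x \<Rightarrow> complex" by blast
    have "lincomb I f c x = of_real S"
      unfolding lin S_def lincomb_def[of "{..<N}"] b_def
      by (simp add: complex_norm_square mult.commute del: of_real_power)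
    moreover have "a c c = (\<Sum>p<N. \<Sum>q<N. b p * cnj (b q) * a (w p) (w q))"
    proof -
      have "L2_inner M (lincomb I h c) (lincomb I h c) =
          (\<Sum>p<N. \<Sum>q<N. b p * cnj (b q) * L2_inner M (lincomb I h (w p)) (lincomb I h (w q)))"
        if "h = d \<or> h = f" for h
        unfolding lin' by (rule L2_inner_lincomb) (use that lincomb_L2[OF fin dL2] lincomb_L2[OF fin fL2] in auto)
      then show ?thesis
        unfolding a_def by (simp add: sum_distrib_left sum.distrib[symmetric] algebra_simps)
    qed
    then have "a c c = (\<Sum>p<N. b p * cnj (b p))"
      using w by (simp add: if_distrib if_distribR sum.delta cong: if_cong)
    then have "A c = S"
      unfolding aA S_def b_def
      by (subst of_real_eq_iff[symmetric, where 'a = complex]) (simp add: complex_norm_square mult.commute del: of_real_power)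
    ultimately have "S\<^sup>2 \<le> H x * S" using bound[OF x, of c] by (simp add: A_def)
    moreover have "0 \<le> S" by (simp add: S_def sum_nonneg)
    ultimately have "S \<le> H x" using H[OF x]
      by (cases "S = 0") (auto simp: power2_eq_square mult.commute)
    then show ?thesis by (simp add: S_def)
  qed
  have A_le: "ennreal (A c) \<le> (\<integral>\<^sup>+x. ennreal (max 0 (V x - E) * (norm (lincomb I f c x))\<^sup>2) \<partial>M)" for c
  proof -
    \<comment> \<open>The energy bound at level \<open>2 * E\<close> leaves a spare
      \<open>E\<close>, which is subtracted from the potential.\<close>
    have "A c \<le> (\<integral>x. V x * (norm (lincomb I f c x))\<^sup>2 \<partial>M) - E * (\<integral>x. (norm (lincomb I f c x))\<^sup>2 \<partial>M)"
      using energy_bound[of "2 * E" c] E(2) by (simp add: A_def)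
    also have "\<dots> = (\<integral>x. (V x - E) * (norm (lincomb I f c x))\<^sup>2 \<partial>M)"
      using integrable_lincomb[of c] by (simp add: left_diff_distrib)
    finally have "ennreal (A c) \<le> ennreal (\<integral>x. (V x - E) * (norm (lincomb I f c x))\<^sup>2 \<partial>M)" by (rule ennreal_leI)
    also have "\<dots> \<le> (\<integral>\<^sup>+x. ennreal ((V x - E) * (norm (lincomb I f c x))\<^sup>2) \<partial>M)"
    proof -
      have int: "integrable M (\<lambda>x. (V x - E) * (norm (lincomb I f c x))\<^sup>2)"
        using integrable_lincomb[of c] by (simp add: left_diff_distrib)
      have "(\<integral>x. (V x - E) * (norm (lincomb I f c x))\<^sup>2 \<partial>M) \<le> (\<integral>x. max 0 ((V x - E) * (norm (lincomb I f c x))\<^sup>2) \<partial>M)"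
        using int by (intro integral_mono) auto
      also have "ennreal \<dots> = (\<integral>\<^sup>+x. ennreal (max 0 ((V x - E) * (norm (lincomb I f c x))\<^sup>2)) \<partial>M)"
        using int by (intro nn_integral_eq_integral[symmetric]) auto
      finally have "ennreal (\<integral>x. (V x - E) * (norm (lincomb I f c x))\<^sup>2 \<partial>M)
          \<le> (\<integral>\<^sup>+x. ennreal (max 0 ((V x - E) * (norm (lincomb I f c x))\<^sup>2)) \<partial>M)" by (simp add: ennreal_leI)
      moreover have "ennreal (max 0 y) = ennreal y" for y :: real
        by (cases "0 \<le> y") (auto simp: ennreal_neg max_def)
      ultimately show ?thesis by simp
    qed
    also have "\<dots> \<le> (\<integral>\<^sup>+x. ennreal (max 0 (V x - E) * (norm (lincomb I f c x))\<^sup>2) \<partial>M)"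
      by (intro nn_integral_mono ennreal_leI mult_right_mono) auto
    finally show ?thesis .
  qed
  have "of_nat N = (\<Sum>p<N. ennreal (A (w p)))"
  proof -
    have "A (w p) = 1" if "p < N" for p
      using w[OF that that] aA[of "w p"] by (metis of_real_eq_1_iff)
    then show ?thesis by simp
  qed
  also have "\<dots> \<le> (\<Sum>p<N. \<integral>\<^sup>+x. ennreal (max 0 (V x - E) * (norm (lincomb I f (w p) x))\<^sup>2) \<partial>M)"
    by (intro sum_mono A_le)
  also have "\<dots> = (\<integral>\<^sup>+x. (\<Sum>p<N. ennreal (max 0 (V x - E) * (norm (lincomb I f (w p) x))\<^sup>2)) \<partial>M)"
    using wm by (intro nn_integral_sum[symmetric]) measurable
  also have "\<dots> \<le> (\<integral>\<^sup>+x. ennreal (max 0 (V x - E) * H x) \<partial>M)"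
  proof (rule nn_integral_mono_AE)
    show "AE x in M. (\<Sum>p<N. ennreal (max 0 (V x - E) * (norm (lincomb I f (w p) x))\<^sup>2)) \<le> ennreal (max 0 (V x - E) * H x)"
      using X
    proof eventually_elim
      case (elim x)
      have "(\<Sum>p<N. ennreal (max 0 (V x - E) * (norm (lincomb I f (w p) x))\<^sup>2))
          = ennreal (max 0 (V x - E) * (\<Sum>p<N. (norm (lincomb I f (w p) x))\<^sup>2))"
        by (simp add: sum_ennreal sum_distrib_left)
      also have "\<dots> \<le> ennreal (max 0 (V x - E) * H x)"
        using diag[OF elim] by (intro ennreal_leI mult_left_mono) auto
      finally show ?case .
    qed
  qed
  finally show ?thesis by (simp add: N_def)
qed

end

section \<open>From eigenspaces of the Schroedinger operator to finite families\<close>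

lemma sum_fun_apply: "(\<Sum>i\<in>I. F i) x = (\<Sum>i\<in>I. F i x)" for F :: "'i \<Rightarrow> 'x \<Rightarrow> complex"
  by (induction I rule: infinite_finite_induct) auto

text \<open>The sum over all negative reals is reduced to finite sets \<open>F\<close>, and each
  multiplicity to finite independent sets \<open>B m\<close>. Pairs of an eigenvalue and an
  eigenfunction serve as indices of the resulting family.\<close>

lemma trace_neg_le:
  assumes "\<And>F B. finite F \<Longrightarrow> F \<subseteq> {..<0} \<Longrightarrow>
    (\<And>m. m \<in> F \<Longrightarrow> finite (B m) \<and> B m \<subseteq> eigenspace H m \<and> cfun.independent (B m)) \<Longrightarrow>
    (\<Sum>i\<in>Sigma F B. ennreal ((- fst i) powr \<gamma>)) \<le> X"
  shows "trace_neg H \<gamma> \<le> X"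
  unfolding trace_neg_def
proof (rule nn_integral_count_space_le)
  fix F :: "real set" assume F: "finite F" "F \<subseteq> {..<0}"
  define S where "S m = {B. finite B \<and> B \<subseteq> eigenspace H m \<and> cfun.independent B}" for m
  define p where "p m B = of_nat (card B) * ennreal (\<bar>m\<bar> powr \<gamma>)" for m :: real and B :: "('a \<Rightarrow> complex) set"
  have S0: "{} \<in> S m" for m by (simp add: S_def cfun.independent_empty)
  have "(\<Sum>m\<in>F. multiplicity_of H m * ennreal (\<bar>m\<bar> powr \<gamma>)) = 0 + (\<Sum>m\<in>F. SUP B\<in>S m. p m B)"
    unfolding multiplicity_of_def S_def p_def by (simp add: SUP_mult_right_ennreal)
  also have "\<dots> \<le> X"
  proof (rule sum_SUP_le_ennreal[OF F(1)])
    show "S m \<noteq> {}" for m using S0 by blast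
    fix B assume B: "\<And>m. m \<in> F \<Longrightarrow> B m \<in> S m"
    have "(\<Sum>i\<in>Sigma F B. ennreal ((- fst i) powr \<gamma>)) = (\<Sum>m\<in>F. \<Sum>b\<in>B m. ennreal ((- m) powr \<gamma>))"
    proof -
      have "(\<Sum>i\<in>Sigma F B. ennreal ((- fst i) powr \<gamma>)) = (\<Sum>(m, b)\<in>Sigma F B. ennreal ((- m) powr \<gamma>))"
        by (intro sum.cong) auto
      also have "\<dots> = (\<Sum>m\<in>F. \<Sum>b\<in>B m. ennreal ((- m) powr \<gamma>))"
        by (rule sum.Sigma[symmetric]) (use F(1) B in \<open>auto simp: S_def\<close>)
      finally show ?thesis .
    qed
    also have "\<dots> = (\<Sum>m\<in>F. p m (B m))"
      using F(2) by (intro sum.cong) (auto simp: p_def)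
    finally show "0 + (\<Sum>m\<in>F. p m (B m)) \<le> X"
      using assms[OF F, of B] B by (simp add: S_def)
  qed
  finally show "(\<Sum>m\<in>F. multiplicity_of H m * ennreal (\<bar>m\<bar> powr \<gamma>)) \<le> X" .
qed

lemma tree_derivative:
  assumes "\<phi> \<in> H1 G"
  shows "tree_derivative G \<phi> \<in> L2 (tree_measure G)" "is_tree_derivative G \<phi> (tree_derivative G \<phi>)"
proof -
  have "\<exists>\<phi>'. \<phi>' \<in> L2 (tree_measure G) \<and> is_tree_derivative G \<phi> \<phi>'" using assms by (auto simp: H1_def)
  then have "tree_derivative G \<phi> \<in> L2 (tree_measure G) \<and> is_tree_derivative G \<phi> (tree_derivative G \<phi>)"
    unfolding tree_derivative_def by (rule someI_ex)
  then show "tree_derivative G \<phi> \<in> L2 (tree_measure G)" "is_tree_derivative G \<phi> (tree_derivative G \<phi>)" by auto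
qed

lemma continuous_on_tree_sum:
  assumes "\<And>i. i \<in> I \<Longrightarrow> continuous_on_tree G (f i)"
  shows "continuous_on_tree G (\<lambda>x. \<Sum>i\<in>I. c i * f i x)"
  using assms unfolding continuous_on_tree_def by (auto intro!: continuous_intros)

lemma nn_integral_norm2:
  "f \<in> L2 M \<Longrightarrow> (\<integral>\<^sup>+x. ennreal ((norm (f x))\<^sup>2) \<partial>M) = ennreal (\<integral>x. (norm (f x))\<^sup>2 \<partial>M)"
  unfolding L2_def by (intro nn_integral_eq_integral) auto

context finite_length_tree
begin

lemma H1_tree_primitive:
  assumes "\<phi> \<in> H1 G"
  shows "tree_primitive \<phi> (tree_derivative G \<phi>)"
  using assms tree_derivative[OF assms] primitive_on_ray[of \<phi> "tree_derivative G \<phi>"]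
  by (auto simp: tree_primitive_def H1_def L2_def)

text \<open>Every vertex is the source of an edge, and its value is the limit along that
  edge.\<close>

lemma zero_if_zero_inside:
  assumes cont: "continuous_on_tree G \<phi>" and out: "\<And>x. x \<notin> points G \<Longrightarrow> \<phi> x = 0"
    and ins: "\<And>x. x \<in> points G - Vertex ` verts G \<Longrightarrow> \<phi> x = 0"
  shows "\<phi> x = 0"
proof -
  consider "x \<notin> points G" | "x \<in> points G - Vertex ` verts G" | v where "x = Vertex v" "v \<in> verts G" by blast
  then show ?thesis
  proof cases
    case (3 v)
    obtain k e where e: "e \<in> gen_edges k" "src G e = v" using vertex_src[OF 3(2)] by blast
    define L where "L = radius (Suc k) - radius k"
    have L: "0 < L" using radius_less_Suc[of k] by (simp add: L_def)
    have lenL: "len G e = ereal L" using len_gen[OF e(1)] by (simp add: L_def)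
    have "{t. 0 \<le> t \<and> ereal t \<le> len G e} = {0..L}" using lenL by auto
    then have c: "continuous_on (closure {0<..<L}) (\<lambda>t. \<phi> (edge_point G e t))"
      using cont gen_edges_edges[OF e(1)] L unfolding continuous_on_tree_def by (metis closure_greaterThanLessThan)
    have "\<phi> (edge_point G e t) = 0" if "t \<in> {0<..<L}" for t
      using that ins[of "Inner e t"] gen_edges_edges[OF e(1)] by (auto simp: edge_point_def lenL points_def)
    from continuous_constant_on_closure[OF c this, of 0] have "\<phi> (edge_point G e 0) = 0"
      using L by simp
    then show ?thesis using e(2) 3(1) by (simp add: edge_point_def)
  qed (use out ins in auto)
qed

text \<open>The point is independence in norm. If a combination has norm zero, then by orthogonality
  so has its part for a single eigenvalue; \<open>energy_bound\<close> makes the derivative of this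
  part vanish too, and \<open>resolvent_bound\<close> with continuity makes it the zero function,
  against the independence of \<open>B m\<close>.\<close>

lemma eigenfamily_schroedinger:
  assumes gd: "global_dimension G d" "1 < d"
    and V: "V \<in> borel_measurable (tree_measure G)" "\<And>x. x \<in> points G \<Longrightarrow> 0 \<le> V x"
    and F: "finite F" "F \<subseteq> {..<0}"
    and B: "\<And>m. m \<in> F \<Longrightarrow> finite (B m) \<and> B m \<subseteq> eigenspace (schroedinger_operator G V) m \<and> cfun.independent (B m)"
    and I: "I \<subseteq> Sigma F B"
  shows "eigenfamily (tree_measure G) V I snd (\<lambda>i. tree_derivative G (snd i)) fst"
    and "i \<in> I \<Longrightarrow> tree_primitive (snd i) (tree_derivative G (snd i))"
proof -
  have finI: "finite I" using I F(1) B by (meson finite_SigmaI finite_subset)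
  have eig: "snd i \<in> schroedinger_domain G V"
    "v \<in> schroedinger_domain G V \<Longrightarrow> schroedinger_form G V (snd i) v = L2_inner (tree_measure G) (\<lambda>x. of_real (fst i) * snd i x) v"
    if "i \<in> I" for i v
  proof -
    have "fst i \<in> F" "snd i \<in> B (fst i)" using subsetD[OF I that(1)] by (cases i; simp)+
    then have "snd i \<in> eigenspace (schroedinger_operator G V) (fst i)" using B by blast
    then show "snd i \<in> schroedinger_domain G V"
      "v \<in> schroedinger_domain G V \<Longrightarrow> schroedinger_form G V (snd i) v = L2_inner (tree_measure G) (\<lambda>x. of_real (fst i) * snd i x) v"
      by (auto simp: eigenspace_def schroedinger_operator_def form_operator_def)
  qed
  have H1: "snd i \<in> H1 G" if "i \<in> I" for i using eig(1)[OF that] by (simp add: schroedinger_domain_def)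
  show prim: "i \<in> I \<Longrightarrow> tree_primitive (snd i) (tree_derivative G (snd i))" for i
    by (rule H1_tree_primitive[OF H1])
  interpret form_family "tree_measure G" V I snd "\<lambda>i. tree_derivative G (snd i)" fst
  proof
    show "finite I" by (rule finI)
    show "snd i \<in> L2 (tree_measure G)" if "i \<in> I" for i using H1[OF that] by (simp add: H1_def)
    show "tree_derivative G (snd i) \<in> L2 (tree_measure G)" if "i \<in> I" for i by (rule tree_derivative(1)[OF H1[OF that]])
    show "V \<in> borel_measurable (tree_measure G)" by (rule V(1))
    show "0 \<le> V x" if "x \<in> space (tree_measure G)" for x using that V(2) by (simp add: space_tree_measure)
    show "integrable (tree_measure G) (\<lambda>x. V x * (norm (snd i x))\<^sup>2)" if "i \<in> I" for i
      using eig(1)[OF that] by (simp add: schroedinger_domain_def)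
    fix i j assume ij: "i \<in> I" "j \<in> I"
    have "L2_inner (tree_measure G) (\<lambda>x. of_real (fst i) * snd i x) (snd j) = of_real (fst i) * L2_inner (tree_measure G) (snd i) (snd j)"
      unfolding L2_inner_def by (simp add: mult.assoc)
    then show "L2_inner (tree_measure G) (tree_derivative G (snd i)) (tree_derivative G (snd j)) -
        (\<integral>x. of_real (V x) * snd i x * cnj (snd j x) \<partial>tree_measure G) = of_real (fst i) * L2_inner (tree_measure G) (snd i) (snd j)"
      using eig(2)[OF ij(1) eig(1)[OF ij(2)]] by (simp add: schroedinger_form_def L2_inner_def)
  qed
  show "eigenfamily (tree_measure G) V I snd (\<lambda>i. tree_derivative G (snd i)) fst"
  proof
    fix c :: "real \<times> (('v, 'e) point \<Rightarrow> complex) \<Rightarrow> complex"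
    assume "\<exists>i\<in>I. c i \<noteq> 0"
    then obtain i0 where i0: "i0 \<in> I" "c i0 \<noteq> 0" by blast
    define m where "m = fst i0"
    have "m \<in> F" using subsetD[OF I i0(1)] by (cases i0) (simp add: m_def)
    then have m: "m \<in> F" "m < 0" using F(2) by auto
    have "(\<integral>x. (norm (lincomb I snd c x))\<^sup>2 \<partial>tree_measure G) \<noteq> 0"
    proof
      assume "(\<integral>x. (norm (lincomb I snd c x))\<^sup>2 \<partial>tree_measure G) = 0"
      then have "AE x in tree_measure G. (norm (lincomb I snd c x))\<^sup>2 = 0"
        by (subst (asm) integral_nonneg_eq_0_iff_AE[OF integrable_lincomb(1)]) auto
      then have AE0: "AE x in tree_measure G. lincomb I snd c x = 0" by simp
      \<comment> \<open>Each \<open>B m\<close> is independent by itself, so the terms of one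
        eigenvalue are isolated first.\<close>
      define c0 where "c0 i = (if fst i = m then c i else 0)" for i
      define u where "u = lincomb I snd c0"
      define Du where "Du = lincomb I (\<lambda>i. tree_derivative G (snd i)) c0"
      have "complex_of_real (\<integral>x. (norm (u x))\<^sup>2 \<partial>tree_measure G) = (\<Sum>i\<in>I. \<Sum>j\<in>I. c0 i * cnj (c0 j) * L2_inner (tree_measure G) (snd i) (snd j))"
        unfolding u_def by (rule integral_norm2_lincomb) (rule fL2)
      also have "\<dots> = (\<Sum>i\<in>I. \<Sum>j\<in>I. c i * cnj (c0 j) * L2_inner (tree_measure G) (snd i) (snd j))"
      proof (intro sum.cong refl)
        fix i j assume ij: "i \<in> I" "j \<in> I"
        show "c0 i * cnj (c0 j) * L2_inner (tree_measure G) (snd i) (snd j) = c i * cnj (c0 j) * L2_inner (tree_measure G) (snd i) (snd j)"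
          using orthogonal[OF ij] by (auto simp: c0_def)
      qed
      also have "\<dots> = L2_inner (tree_measure G) (lincomb I snd c) u"
        unfolding u_def by (rule L2_inner_lincomb[symmetric]) (rule fL2)
      also have "\<dots> = 0"
        unfolding L2_inner_def by (rule integral_eq_zero_AE) (use AE0 in \<open>eventually_elim, simp\<close>)
      finally have u0: "(\<integral>x. (norm (u x))\<^sup>2 \<partial>tree_measure G) = 0" by simp
      then have "AE x in tree_measure G. (norm (u x))\<^sup>2 = 0"
        unfolding u_def by (subst (asm) integral_nonneg_eq_0_iff_AE[OF integrable_lincomb(1)]) auto
      then have "AE x in tree_measure G. V x * (norm (u x))\<^sup>2 = 0"
        by eventually_elim simp
      then have Vu0: "(\<integral>x. V x * (norm (u x))\<^sup>2 \<partial>tree_measure G) = 0"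
        by (rule integral_eq_zero_AE)
      \<comment> \<open>The eigenvalue in \<open>F\<close> nearest to zero supplies a positive
        \<open>E\<close> for the whole family.\<close>
      define E where "E = - Max F"
      have "Max F \<in> F" using m(1) by (intro Max_in F(1)) auto
      then have "Max F < 0" using F(2) by auto
      then have "0 < E" by (simp add: E_def)
      moreover have "fst i \<le> - E" if "i \<in> I" for i
        using subsetD[OF I that] Max_ge[OF F(1), of "fst i"] by (cases i) (simp add: E_def)
      ultimately have E: "0 < E" "\<And>i. i \<in> I \<Longrightarrow> fst i \<le> - E" by blast+
      have "(\<integral>x. (norm (Du x))\<^sup>2 \<partial>tree_measure G) \<le> 0"
        using energy_bound[OF E(2), of c0] u0 Vu0 by (simp add: u_def Du_def)
      moreover have "0 \<le> (\<integral>x. (norm (Du x))\<^sup>2 \<partial>tree_measure G)" by simp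
      ultimately have Du0: "(\<integral>x. (norm (Du x))\<^sup>2 \<partial>tree_measure G) = 0" by simp
      have L2: "u \<in> L2 (tree_measure G)" "Du \<in> L2 (tree_measure G)"
        unfolding u_def Du_def by (rule lincomb_L2[OF finI]; use fL2 dL2 in auto)+
      obtain K where K: "resolvent_bound 0 K" using resolvent_bound_exists[OF gd(1), of 0] gd(2) by auto
      have uD: "tree_primitive u Du"
        unfolding u_def Du_def lincomb_def[abs_def] by (rule tree_primitive_sum) (rule prim)
      have inside: "u x = 0" if "x \<in> points G - Vertex ` verts G" for x
        using K[unfolded resolvent_bound_def, THEN conjunct2, rule_format, OF conjI[OF uD E(1)] that] u0 Du0
        by (simp add: nn_integral_norm2[OF L2(1)] nn_integral_norm2[OF L2(2)])
      have cont: "continuous_on_tree G u"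
        unfolding u_def lincomb_def[abs_def] using H1 by (intro continuous_on_tree_sum) (auto simp: H1_def)
      have outside: "u x = 0" if "x \<notin> points G" for x
        unfolding u_def lincomb_def using H1 that by (intro sum.neutral) (auto simp: H1_def)
      have zero: "u x = 0" for x using zero_if_zero_inside[OF cont outside inside] .
      define J where "J = {b. (m, b) \<in> I}"
      have J: "J \<subseteq> B m" using I by (auto simp: J_def)
      have "u x = (\<Sum>b\<in>J. c (m, b) * b x)" for x
      proof -
        have "u x = (\<Sum>i\<in>{i\<in>I. fst i = m}. c i * snd i x)"
          unfolding u_def lincomb_def c0_def
          by (intro sum.mono_neutral_cong_right) (use finI in auto)
        also have "{i\<in>I. fst i = m} = Pair m ` J" by (force simp: J_def)
        also have "(\<Sum>i\<in>Pair m ` J. c i * snd i x) = (\<Sum>b\<in>J. c (m, b) * b x)"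
          by (subst sum.reindex) (auto simp: inj_on_def)
        finally show ?thesis .
      qed
      then have "(\<Sum>b\<in>J. (\<lambda>x. c (m, b) * b x)) = 0"
        using zero by (intro ext) (simp add: sum_fun_apply)
      moreover have "snd i0 \<in> J" using i0 by (simp add: J_def m_def)
      moreover have "finite J" using J B[OF m(1)] finite_subset by blast
      ultimately have "c (m, snd i0) = 0"
        using cfun.independentD[of "B m" J "\<lambda>b. c (m, b)" "snd i0"] J B[OF m(1)] by simp
      then show False using i0(2) by (simp add: m_def)
    qed
    moreover have "0 \<le> (\<integral>x. (norm (lincomb I snd c x))\<^sup>2 \<partial>tree_measure G)" by simp
    ultimately show "0 < (\<integral>x. (norm (lincomb I snd c x))\<^sup>2 \<partial>tree_measure G)" by linarith
  qed
qed

end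

section \<open>Partition of the tree into rays\<close>

text \<open>With more functions than points, some nontrivial combination vanishes on
  \<open>Z\<close>. The energy bound at level \<open>2 * E\<close> and the assumed inequality then
  force \<open>E\<close> times its squared norm to be at most 0.\<close>

lemma (in eigenfamily) card_le_constraints:
  assumes E: "0 < E" "\<And>i. i \<in> I \<Longrightarrow> \<mu> i \<le> - (2 * E)" and Z: "finite Z"
    and le: "\<And>c. (\<And>z. z \<in> Z \<Longrightarrow> lincomb I f c z = 0) \<Longrightarrow>
      (\<integral>x. V x * (norm (lincomb I f c x))\<^sup>2 \<partial>M) \<le>
      (\<integral>x. (norm (lincomb I d c x))\<^sup>2 \<partial>M) + E * (\<integral>x. (norm (lincomb I f c x))\<^sup>2 \<partial>M)"
  shows "card I \<le> card Z"
proof (rule ccontr)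
  assume "\<not> card I \<le> card Z"
  then obtain c where c: "\<exists>i\<in>I. c i \<noteq> 0" "\<forall>z\<in>Z. (\<Sum>i\<in>I. c i * f i z) = 0"
    using homogeneous_system_nontrivial_solution[of Z I "\<lambda>z i. f i z"] Z fin by auto
  have "E * (\<integral>x. (norm (lincomb I f c x))\<^sup>2 \<partial>M) \<le> 0"
    using energy_bound[of "2 * E" c] E(2) le[of c] c(2) by (simp add: lincomb_def)
  then show False using indep[OF c(1)] E(1) by (simp add: mult_le_0_iff)
qed

section \<open>Weidl's partition on the rays of the tree\<close>

context finite_length_tree
begin

text \<open>The pieces over single generations are measurable; the second claim recombines them,
  almost everywhere, to the function on the whole ray, the radii being the exception.\<close>

lemma ray_integral:
  fixes F :: "('v, 'e) point \<Rightarrow> ennreal"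
  assumes \<rho>: "is_ray \<rho>" and F: "F \<in> borel_measurable (tree_measure G)"
  shows "(\<integral>\<^sup>+s\<in>{radius k..}. F (ray_point \<rho> s) \<partial>lebesgue) = (\<Sum>i. edge_integral G F (\<rho> (k + i)))"
    and "AE s in lebesgue. (\<Sum>i. F (ray_point \<rho> s) * indicator {radius (k + i)<..<radius (Suc (k + i))} s)
      = F (ray_point \<rho> s) * indicator {radius k..} s"
proof -
  define I where "I i = {radius (k + i)<..<radius (Suc (k + i))}" for i
  show AE: "AE s in lebesgue. (\<Sum>i. F (ray_point \<rho> s) * indicator {radius (k + i)<..<radius (Suc (k + i))} s)
      = F (ray_point \<rho> s) * indicator {radius k..} s"
    using AE_neq_radius
  proof eventually_elim
    case (elim s)
    show ?case
    proof (cases "radius k \<le> s")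
      case True
      define j where "j = gen_index s"
      have s: "0 \<le> s" using True radius_nonneg[of k] by linarith
      have j: "radius j < s" "s < radius (Suc j)"
        using gen_index[OF s] elim[rule_format, of j] by (auto simp: j_def)
      have "radius k < radius (Suc j)" using True j by linarith
      then have kj: "k \<le> j" by simp
      have other: "s \<notin> I i" if "i \<noteq> j - k" for i
      proof
        assume "s \<in> I i"
        then have "gen_index s = k + i" by (intro gen_index_eqI) (auto simp: I_def)
        then show False using that by (simp add: j_def)
      qed
      have "(\<Sum>i. F (ray_point \<rho> s) * indicator (I i) s) = (\<Sum>i\<in>{j - k}. F (ray_point \<rho> s) * indicator (I i) s)"
        using other by (intro suminf_finite) auto
      also have "\<dots> = F (ray_point \<rho> s)" using j kj by (simp add: I_def)
      finally show ?thesis using True by (simp add: I_def)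
    next
      case False
      have "s \<notin> I i" for i
      proof
        assume "s \<in> I i"
        moreover have "radius k \<le> radius (k + i)" by simp
        ultimately show False using False by (auto simp: I_def simp del: radius_le_iff)
      qed
      then show ?thesis using False by (simp add: I_def)
    qed
  qed
  have "(\<integral>\<^sup>+s\<in>{radius k..}. F (ray_point \<rho> s) \<partial>lebesgue) = (\<integral>\<^sup>+s. (\<Sum>i. F (ray_point \<rho> s) * indicator {radius (k + i)<..<radius (Suc (k + i))} s) \<partial>lebesgue)"
    by (rule nn_integral_cong_AE) (use AE in \<open>eventually_elim, simp\<close>)
  also have "\<dots> = (\<Sum>i. \<integral>\<^sup>+s\<in>{radius (k + i)<..<radius (Suc (k + i))}. F (ray_point \<rho> s) \<partial>lebesgue)"
    by (rule nn_integral_suminf) (rule ray_measurable[OF \<rho> F])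
  also have "\<dots> = (\<Sum>i. edge_integral G F (\<rho> (k + i)))"
  proof (rule suminf_cong)
    fix i
    have "AE s in lebesgue. s \<noteq> radius (k + i) \<and> s \<noteq> radius (Suc (k + i))"
      by (intro AE_conjI AE_lebesgue_neq)
    then have "AE s in lebesgue. F (ray_point \<rho> s) * indicator {radius (k + i)<..<radius (Suc (k + i))} s
        = F (ray_point \<rho> s) * indicator {radius (k + i)..radius (Suc (k + i))} s"
      by eventually_elim (auto split: split_indicator)
    then have "(\<integral>\<^sup>+s\<in>{radius (k + i)<..<radius (Suc (k + i))}. F (ray_point \<rho> s) \<partial>lebesgue)
        = (\<integral>\<^sup>+s\<in>{radius (k + i)..radius (Suc (k + i))}. F (ray_point \<rho> s) \<partial>lebesgue)"
      by (rule nn_integral_cong_AE)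
    then show "(\<integral>\<^sup>+s\<in>{radius (k + i)<..<radius (Suc (k + i))}. F (ray_point \<rho> s) \<partial>lebesgue) = edge_integral G F (\<rho> (k + i))"
      unfolding ray_edge_integral[OF \<rho> F] .
  qed
  finally show "(\<integral>\<^sup>+s\<in>{radius k..}. F (ray_point \<rho> s) \<partial>lebesgue) = (\<Sum>i. edge_integral G F (\<rho> (k + i)))" .
qed

text \<open>\<open>Weidl_partition\<close> on the part of a ray from generation \<open>k\<close> on.
  Integrals over the half-line become sums of edge integrals, the form in which different rays can
  be added.\<close>

lemma ray_Weidl:
  assumes \<rho>: "is_ray \<rho>" and V: "V \<in> borel_measurable (tree_measure G)" "\<And>x. x \<in> points G \<Longrightarrow> 0 \<le> V x"
    and fin: "(\<Sum>i. edge_integral G (\<lambda>x. ennreal (V x)) (\<rho> (k + i))) < \<infinity>"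
  shows "\<exists>(z::nat \<Rightarrow> real) (v::nat \<Rightarrow> real). (\<forall>i. 0 \<le> v i) \<and>
    (\<Sum>i. ennreal (v i)) = (\<Sum>i. edge_integral G (\<lambda>x. ennreal (V x)) (\<rho> (k + i))) \<and>
    (\<forall>E \<phi> D. 0 \<le> E \<and> tree_primitive \<phi> D \<and> (\<forall>i. E < 4 * (v i)\<^sup>2 \<longrightarrow> \<phi> (ray_point \<rho> (z i)) = 0) \<longrightarrow>
      (\<Sum>i. edge_integral G (\<lambda>x. ennreal (V x * (norm (\<phi> x))\<^sup>2)) (\<rho> (k + i))) \<le>
      (\<Sum>i. edge_integral G (\<lambda>x. ennreal ((norm (D x))\<^sup>2)) (\<rho> (k + i))) +
      ennreal E * (\<Sum>i. edge_integral G (\<lambda>x. ennreal ((norm (\<phi> x))\<^sup>2)) (\<rho> (k + i))))"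
proof -
  have VF: "(\<lambda>x. ennreal (V x)) \<in> borel_measurable (tree_measure G)" using V(1) by simp
  \<comment> \<open>A version of V along the ray that is a sum of measurable pieces omitting the
    vertices, and that is nonnegative everywhere, as \<open>Weidl_partition\<close> demands.\<close>
  define W where "W s = enn2real (\<Sum>i. ennreal (V (ray_point \<rho> s)) * indicator {radius (k + i)<..<radius (Suc (k + i))} s)" for s
  have Wm: "W \<in> borel_measurable lebesgue"
    unfolding W_def[abs_def]
    by (intro borel_measurable_enn2real borel_measurable_suminf_order ray_measurable[OF \<rho> VF])
  have W0: "0 \<le> W s" for s by (simp add: W_def)
  have AEW: "AE s in lebesgue. s \<in> {radius k..} \<longrightarrow> W s = V (ray_point \<rho> s)"
    using ray_integral(2)[OF \<rho> VF, of k] AE_neq_radius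
  proof eventually_elim
    case (elim s)
    show ?case
    proof
      assume sk: "s \<in> {radius k..}"
      then have s: "0 \<le> s" using radius_nonneg[of k] by simp
      define j where "j = gen_index s"
      have j: "radius j < s" "s < radius (Suc j)"
        using gen_index[OF s] elim(2)[rule_format, of j] by (auto simp: j_def)
      have "ray_point \<rho> s \<in> points G"
        using ray_point_inner[OF \<rho> j] j len_gen[OF is_ray_gen[OF \<rho>], of j] gen_edges_edges[OF is_ray_gen[OF \<rho>], of j]
        by (auto simp: points_def)
      then show "W s = V (ray_point \<rho> s)" using elim(1) sk V(2) by (simp add: W_def)
    qed
  qed
  have int_eq: "(\<integral>\<^sup>+s\<in>{radius k..}. ennreal (W s * h s) \<partial>lebesgue) = (\<integral>\<^sup>+s\<in>{radius k..}. ennreal (V (ray_point \<rho> s) * h s) \<partial>lebesgue)" for h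
    by (rule nn_integral_cong_AE) (use AEW in \<open>eventually_elim, auto split: split_indicator\<close>)
  have intV: "(\<integral>\<^sup>+s\<in>{radius k..}. ennreal (W s) \<partial>lebesgue) = (\<Sum>i. edge_integral G (\<lambda>x. ennreal (V x)) (\<rho> (k + i)))"
    using int_eq[of "\<lambda>_. 1"] ray_integral(1)[OF \<rho> VF, of k] by simp
  have finW: "(\<integral>\<^sup>+s\<in>{radius k..}. ennreal (W s) \<partial>lebesgue) < \<infinity>" unfolding intV by (rule fin)
  from Weidl_partition[OF Wm W0 finW] obtain z v :: "nat \<Rightarrow> real"
    where zv: "\<forall>i. radius k \<le> z i \<and> 0 \<le> v i"
    and sum: "(\<Sum>i. ennreal (v i)) = (\<integral>\<^sup>+s\<in>{radius k..}. ennreal (W s) \<partial>lebesgue)"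
    and ineq: "\<forall>E u g. 0 \<le> E \<and> primitive_on {radius k..} u g \<and> (\<forall>i. E < 4 * (v i)\<^sup>2 \<longrightarrow> u (z i) = 0) \<longrightarrow>
      (\<integral>\<^sup>+x\<in>{radius k..}. ennreal (W x * (norm (u x))\<^sup>2) \<partial>lebesgue) \<le>
      (\<integral>\<^sup>+x\<in>{radius k..}. ennreal ((norm (g x))\<^sup>2) \<partial>lebesgue) +
      ennreal E * (\<integral>\<^sup>+x\<in>{radius k..}. ennreal ((norm (u x))\<^sup>2) \<partial>lebesgue)"
    by (elim exE conjE) (rule that)
  show ?thesis
  proof (rule exI[of _ z], rule exI[of _ v], intro conjI allI impI)
    show "0 \<le> v i" for i using zv by blast
    show "(\<Sum>i. ennreal (v i)) = (\<Sum>i. edge_integral G (\<lambda>x. ennreal (V x)) (\<rho> (k + i)))"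
      unfolding sum intV ..
    fix E \<phi> D
    assume *: "0 \<le> E \<and> tree_primitive \<phi> D \<and> (\<forall>i. E < 4 * (v i)\<^sup>2 \<longrightarrow> \<phi> (ray_point \<rho> (z i)) = 0)"
    then have m: "\<phi> \<in> borel_measurable (tree_measure G)" "D \<in> borel_measurable (tree_measure G)"
      and pr: "primitive_on {0..} (\<lambda>s. \<phi> (ray_point \<rho> s)) (\<lambda>s. D (ray_point \<rho> s))"
      using \<rho> by (auto simp: tree_primitive_def)
    have pr': "primitive_on {radius k..} (\<lambda>s. \<phi> (ray_point \<rho> s)) (\<lambda>s. D (ray_point \<rho> s))"
      by (rule primitive_on_subset[OF pr]) (use radius_nonneg[of k] in auto)
    have mF: "(\<lambda>x. ennreal ((norm (\<phi> x))\<^sup>2)) \<in> borel_measurable (tree_measure G)"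
      "(\<lambda>x. ennreal ((norm (D x))\<^sup>2)) \<in> borel_measurable (tree_measure G)"
      "(\<lambda>x. ennreal (V x * (norm (\<phi> x))\<^sup>2)) \<in> borel_measurable (tree_measure G)"
      using m V(1) by measurable
    show "(\<Sum>i. edge_integral G (\<lambda>x. ennreal (V x * (norm (\<phi> x))\<^sup>2)) (\<rho> (k + i))) \<le>
      (\<Sum>i. edge_integral G (\<lambda>x. ennreal ((norm (D x))\<^sup>2)) (\<rho> (k + i))) +
      ennreal E * (\<Sum>i. edge_integral G (\<lambda>x. ennreal ((norm (\<phi> x))\<^sup>2)) (\<rho> (k + i)))"
      using ineq[THEN spec, THEN spec, THEN spec, of E "\<lambda>s. \<phi> (ray_point \<rho> s)" "\<lambda>s. D (ray_point \<rho> s)"] * pr'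
      unfolding int_eq ray_integral(1)[OF \<rho> mF(1), symmetric] ray_integral(1)[OF \<rho> mF(2), symmetric] ray_integral(1)[OF \<rho> mF(3), symmetric]
      by blast
  qed
qed

text \<open>At each vertex other than the root the arriving ray continues into the chosen child, and
  the other outgoing edges start new rays; the root edge starts one as well.\<close>

definition ray_starts :: "'e set" where
  "ray_starts = {f \<in> edges G. \<forall>e\<in>edges G. child e \<noteq> f}"

lemma child_edges: "e \<in> edges G \<Longrightarrow> child e \<in> edges G"
  using child by (auto simp: out_edges_def)

lemma child_funpow_edges: "e \<in> edges G \<Longrightarrow> (child ^^ i) e \<in> edges G"
  by (induction i) (auto intro: child_edges)

lemma child_inj: "inj_on child (edges G)"
proof (rule inj_onI)
  fix e e' assume e: "e \<in> edges G" "e' \<in> edges G" "child e = child e'"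
  then show "e = e'" using out_edges_tgt_disjoint[of e e'] child[of e] child[of e'] by auto
qed

lemma ray_from_start: "f \<in> edges G \<Longrightarrow> ray f (edge_gen f + i) = (child ^^ i) f"
  using ancestor_self[of f "edge_gen f"] by (cases i) (auto simp: ray_def gen_edges_def)

text \<open>Going back from a chosen child to the edge before it lowers the generation and so ends
  at a start; \<open>child_inj\<close> makes the way back unique.\<close>

lemma ray_starts_bij: "bij_betw (\<lambda>(f, i). (child ^^ i) f) (ray_starts \<times> UNIV) (edges G)"
  unfolding bij_betw_def
proof
  have *: "i = j \<and> f = g" if "f \<in> ray_starts" "g \<in> ray_starts" "(child ^^ i) f = (child ^^ j) g" "i \<le> j" for f g i j
    using that
  proof (induction i arbitrary: j)
    case 0
    show ?case
    proof (cases j)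
      case (Suc l)
      then have "child ((child ^^ l) g) = f" using 0 by simp
      then show ?thesis using 0(1,2) child_funpow_edges[of g l] by (auto simp: ray_starts_def)
    qed (use 0 in auto)
  next
    case (Suc i)
    then obtain l where l: "j = Suc l" by (cases j) auto
    have "(child ^^ i) f = (child ^^ l) g"
      using Suc.prems l child_funpow_edges[of f i] child_funpow_edges[of g l] inj_onD[OF child_inj, of "(child ^^ i) f" "(child ^^ l) g"]
      by (auto simp: ray_starts_def)
    then show ?case using Suc.IH[of l] Suc.prems l by auto
  qed
  show "inj_on (\<lambda>(f, i). (child ^^ i) f) (ray_starts \<times> UNIV)"
  proof (rule inj_onI, clarify)
    fix f i g j assume fg: "f \<in> ray_starts" "g \<in> ray_starts" "(child ^^ i) f = (child ^^ j) g"
    show "f = g \<and> i = j"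
      using *[OF fg] *[OF fg(2,1) fg(3)[symmetric]] by (cases "i \<le> j") auto
  qed
  have "e \<in> (\<lambda>(f, i). (child ^^ i) f) ` (ray_starts \<times> UNIV)" if "e \<in> gen_edges k" for e k
    using that
  proof (induction k arbitrary: e rule: less_induct)
    case (less k)
    note ed = gen_edges_edges[OF less.prems]
    show ?case
    proof (cases "e \<in> ray_starts")
      case True
      then show ?thesis by (intro image_eqI[of _ _ "(e, 0)"]) auto
    next
      case False
      then obtain e' where e': "e' \<in> edges G" "child e' = e" using ed by (auto simp: ray_starts_def)
      have g: "e' \<in> gen_edges (edge_gen e')" using e'(1) by (simp add: gen_edges_def)
      then have "edge_gen e' < k" using child_gen[OF g] e'(2) less.prems by (simp add: gen_edges_def)
      then obtain f i where "f \<in> ray_starts" "e' = (child ^^ i) f" using less.IH[OF _ g] by auto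
      then show ?thesis using e'(2) by (intro image_eqI[of _ _ "(f, Suc i)"]) auto
    qed
  qed
  then show "(\<lambda>(f, i). (child ^^ i) f) ` (ray_starts \<times> UNIV) = edges G"
    using child_funpow_edges by (auto simp: edges_eq_UN[symmetric] ray_starts_def) (auto simp: edges_eq_UN)
qed

lemma nn_integral_count_space_Times_nat:
  fixes h :: "'e \<times> nat \<Rightarrow> ennreal"
  shows "(\<integral>\<^sup>+p. h p \<partial>count_space (A \<times> UNIV)) = (\<integral>\<^sup>+f. (\<Sum>i. h (f, i)) \<partial>count_space A)"
proof -
  have "(\<integral>\<^sup>+p. h p \<partial>count_space (A \<times> UNIV)) = (\<integral>\<^sup>+p. h p * indicator (A \<times> UNIV) p \<partial>count_space UNIV)"
    by (simp add: nn_integral_count_space_indicator)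
  also have "\<dots> = (\<integral>\<^sup>+f. (\<integral>\<^sup>+i. h (f, i) * indicator (A \<times> UNIV) (f, i) \<partial>count_space UNIV) \<partial>count_space UNIV)"
    by (rule nn_integral_fst_count_space[symmetric])
  also have "\<dots> = (\<integral>\<^sup>+f. (\<Sum>i. h (f, i)) * indicator A f \<partial>count_space UNIV)"
    by (intro nn_integral_cong) (auto simp: nn_integral_count_space_nat split: split_indicator)
  also have "\<dots> = (\<integral>\<^sup>+f. (\<Sum>i. h (f, i)) \<partial>count_space A)"
    by (simp add: nn_integral_count_space_indicator)
  finally show ?thesis .
qed

text \<open>\<open>ray f\<close> begins at the root, but only its part from \<open>f\<close> on
  belongs to the decomposition, hence the offset \<open>edge_gen f\<close>.\<close>

lemma nn_integral_rays:
  assumes F: "F \<in> borel_measurable (tree_measure G)"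
  shows "(\<integral>\<^sup>+x. F x \<partial>tree_measure G) =
    (\<integral>\<^sup>+f. (\<Sum>i. edge_integral G F (ray f (edge_gen f + i))) \<partial>count_space ray_starts)"
proof -
  have "(\<integral>\<^sup>+x. F x \<partial>tree_measure G) = (\<integral>\<^sup>+p. edge_integral G F ((\<lambda>(f, i). (child ^^ i) f) p) \<partial>count_space (ray_starts \<times> UNIV))"
    unfolding nn_integral_tree_measure[OF F] by (rule nn_integral_bij_count_space[OF ray_starts_bij, symmetric])
  also have "\<dots> = (\<integral>\<^sup>+f. (\<Sum>i. edge_integral G F ((child ^^ i) f)) \<partial>count_space ray_starts)"
    by (subst nn_integral_count_space_Times_nat) simp
  also have "\<dots> = (\<integral>\<^sup>+f. (\<Sum>i. edge_integral G F (ray f (edge_gen f + i))) \<partial>count_space ray_starts)"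
    by (intro nn_integral_cong suminf_cong) (auto simp: ray_from_start ray_starts_def)
  finally show ?thesis .
qed

text \<open>A function on the tree restricts to the rays with no matching condition left at the
  cuts, so the inequalities on the single rays add up. Each interval contributes one point, its left
  end, and its mass.\<close>

lemma tree_Weidl:
  assumes V: "V \<in> borel_measurable (tree_measure G)" "\<And>x. x \<in> points G \<Longrightarrow> 0 \<le> V x"
    and fin: "(\<integral>\<^sup>+x. ennreal (V x) \<partial>tree_measure G) < \<infinity>"
  shows "\<exists>(z::'e \<times> nat \<Rightarrow> ('v, 'e) point) (v::'e \<times> nat \<Rightarrow> real). (\<forall>p\<in>ray_starts \<times> UNIV. 0 \<le> v p) \<and>
    (\<integral>\<^sup>+p. ennreal (v p) \<partial>count_space (ray_starts \<times> UNIV)) = (\<integral>\<^sup>+x. ennreal (V x) \<partial>tree_measure G) \<and>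
    (\<forall>E \<phi> D. 0 \<le> E \<and> tree_primitive \<phi> D \<and> (\<forall>p\<in>ray_starts \<times> UNIV. E < 4 * (v p)\<^sup>2 \<longrightarrow> \<phi> (z p) = 0) \<longrightarrow>
      (\<integral>\<^sup>+x. ennreal (V x * (norm (\<phi> x))\<^sup>2) \<partial>tree_measure G) \<le>
      (\<integral>\<^sup>+x. ennreal ((norm (D x))\<^sup>2) \<partial>tree_measure G) + ennreal E * (\<integral>\<^sup>+x. ennreal ((norm (\<phi> x))\<^sup>2) \<partial>tree_measure G))"
proof -
  have VF: "(\<lambda>x. ennreal (V x)) \<in> borel_measurable (tree_measure G)" using V(1) by simp
  define \<Sigma> where "\<Sigma> F f = (\<Sum>i. edge_integral G F (ray f (edge_gen f + i)))" for F f
  have ray: "is_ray (ray f)" if "f \<in> ray_starts" for f using that by (intro is_ray_ray) (simp add: ray_starts_def)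
  have finf: "\<Sigma> (\<lambda>x. ennreal (V x)) f < \<infinity>" if f: "f \<in> ray_starts" for f
  proof -
    have "\<Sigma> (\<lambda>x. ennreal (V x)) f = (\<integral>\<^sup>+g. \<Sigma> (\<lambda>x. ennreal (V x)) g * indicator {f} g \<partial>count_space ray_starts)"
      using f by simp
    also have "\<dots> \<le> (\<integral>\<^sup>+g. \<Sigma> (\<lambda>x. ennreal (V x)) g \<partial>count_space ray_starts)"
      by (intro nn_integral_mono) (auto split: split_indicator)
    also have "\<dots> < \<infinity>" using fin unfolding nn_integral_rays[OF VF] \<Sigma>_def .
    finally show ?thesis .
  qed
  define P where "P f z v \<longleftrightarrow> (\<forall>i. 0 \<le> v i) \<and> (\<Sum>i. ennreal (v i)) = \<Sigma> (\<lambda>x. ennreal (V x)) f \<and>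
    (\<forall>E \<phi> D. 0 \<le> E \<and> tree_primitive \<phi> D \<and> (\<forall>i. E < 4 * (v i)\<^sup>2 \<longrightarrow> \<phi> (ray_point (ray f) (z i)) = 0) \<longrightarrow>
      \<Sigma> (\<lambda>x. ennreal (V x * (norm (\<phi> x))\<^sup>2)) f \<le> \<Sigma> (\<lambda>x. ennreal ((norm (D x))\<^sup>2)) f + ennreal E * \<Sigma> (\<lambda>x. ennreal ((norm (\<phi> x))\<^sup>2)) f)"
    for f and z v :: "nat \<Rightarrow> real"
  have "\<forall>f\<in>ray_starts. \<exists>z v. P f z v"
    unfolding P_def \<Sigma>_def using ray_Weidl[OF ray V] finf unfolding \<Sigma>_def by blast
  then obtain z v where zv: "\<And>f. f \<in> ray_starts \<Longrightarrow> P f (z f) (v f)" by metis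
  define z' where "z' p = ray_point (ray (fst p)) (z (fst p) (snd p))" for p
  define v' where "v' p = v (fst p) (snd p)" for p
  show ?thesis
  proof (rule exI[of _ z'], rule exI[of _ v'], intro conjI allI impI)
    show "\<forall>p\<in>ray_starts \<times> UNIV. 0 \<le> v' p" using zv by (auto simp: P_def v'_def)
    show "(\<integral>\<^sup>+p. ennreal (v' p) \<partial>count_space (ray_starts \<times> UNIV)) = (\<integral>\<^sup>+x. ennreal (V x) \<partial>tree_measure G)"
      unfolding nn_integral_rays[OF VF] nn_integral_count_space_Times_nat v'_def
      using zv by (intro nn_integral_cong) (auto simp: P_def \<Sigma>_def)
    fix E \<phi> D
    assume *: "0 \<le> E \<and> tree_primitive \<phi> D \<and> (\<forall>p\<in>ray_starts \<times> UNIV. E < 4 * (v' p)\<^sup>2 \<longrightarrow> \<phi> (z' p) = 0)"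
    then have m: "\<phi> \<in> borel_measurable (tree_measure G)" "D \<in> borel_measurable (tree_measure G)"
      by (auto simp: tree_primitive_def)
    have mF: "(\<lambda>x. ennreal ((norm (\<phi> x))\<^sup>2)) \<in> borel_measurable (tree_measure G)"
      "(\<lambda>x. ennreal ((norm (D x))\<^sup>2)) \<in> borel_measurable (tree_measure G)"
      "(\<lambda>x. ennreal (V x * (norm (\<phi> x))\<^sup>2)) \<in> borel_measurable (tree_measure G)"
      using m V(1) by measurable
    have "(\<integral>\<^sup>+x. ennreal (V x * (norm (\<phi> x))\<^sup>2) \<partial>tree_measure G)
        \<le> (\<integral>\<^sup>+f. \<Sigma> (\<lambda>x. ennreal ((norm (D x))\<^sup>2)) f + ennreal E * \<Sigma> (\<lambda>x. ennreal ((norm (\<phi> x))\<^sup>2)) f \<partial>count_space ray_starts)"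
      unfolding nn_integral_rays[OF mF(3)] \<Sigma>_def[symmetric]
    proof (rule nn_integral_mono)
      fix f assume "f \<in> space (count_space ray_starts)"
      then have f: "f \<in> ray_starts" by simp
      have "\<forall>i. E < 4 * (v f i)\<^sup>2 \<longrightarrow> \<phi> (ray_point (ray f) (z f i)) = 0"
        using * f by (auto simp: v'_def z'_def)
      then show "\<Sigma> (\<lambda>x. ennreal (V x * (norm (\<phi> x))\<^sup>2)) f \<le> \<Sigma> (\<lambda>x. ennreal ((norm (D x))\<^sup>2)) f + ennreal E * \<Sigma> (\<lambda>x. ennreal ((norm (\<phi> x))\<^sup>2)) f"
        using zv[OF f] * unfolding P_def by blast
    qed
    also have "\<dots> = (\<integral>\<^sup>+x. ennreal ((norm (D x))\<^sup>2) \<partial>tree_measure G) + ennreal E * (\<integral>\<^sup>+x. ennreal ((norm (\<phi> x))\<^sup>2) \<partial>tree_measure G)"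
      unfolding nn_integral_rays[OF mF(1)] nn_integral_rays[OF mF(2)] \<Sigma>_def[symmetric]
      by (subst nn_integral_add) (auto simp: nn_integral_cmult)
    finally show "(\<integral>\<^sup>+x. ennreal (V x * (norm (\<phi> x))\<^sup>2) \<partial>tree_measure G) \<le>
      (\<integral>\<^sup>+x. ennreal ((norm (D x))\<^sup>2) \<partial>tree_measure G) + ennreal E * (\<integral>\<^sup>+x. ennreal ((norm (\<phi> x))\<^sup>2) \<partial>tree_measure G)" .
  qed
qed

end

section \<open>Trace inequalities\<close>

lemma (in rooted_metric_tree) root_dist_measurable: "root_dist G \<in> borel_measurable (tree_measure G)"
proof (rule measurableI)
  fix A :: "real set" assume A: "A \<in> sets borel"
  have "edge_slice G e (root_dist G -` A \<inter> space (tree_measure G)) \<in> sets lebesgue" if e: "e \<in> edges G" for e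
  proof -
    have eq: "edge_slice G e (root_dist G -` A \<inter> space (tree_measure G))
        = {t. 0 < t \<and> ereal t < len G e} \<inter> (\<lambda>t. vertex_dist G (src G e) + t) -` A"
      using e by (auto simp: edge_slice_def space_tree_measure points_def)
    have "(\<lambda>t. vertex_dist G (src G e) + t) -` A \<inter> space borel \<in> sets borel"
      by (rule measurable_sets[OF _ A]) measurable
    then have "(\<lambda>t. vertex_dist G (src G e) + t) -` A \<in> sets lebesgue"
      by (simp add: sets_completionI_sets)
    then show ?thesis unfolding eq by (rule sets.Int[OF interval_lebesgue])
  qed
  then show "root_dist G -` A \<inter> space (tree_measure G) \<in> sets (tree_measure G)"
    by (auto simp: sets_tree_measure space_tree_measure)
qed simp

context finite_length_tree
begin

lemma root_dist_nonneg: "x \<in> points G \<Longrightarrow> 0 \<le> root_dist G x"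
proof (cases x)
  case (Vertex v)
  assume "x \<in> points G"
  then have "v \<in> verts G" using Vertex by (auto simp: points_def)
  then obtain k e where "e \<in> gen_edges k" "src G e = v" by (rule vertex_src)
  then show ?thesis using vertex_dist_src_gen radius_nonneg[of k] Vertex by auto
next
  case (Inner e t)
  assume "x \<in> points G"
  then have "e \<in> gen_edges (edge_gen e)" "0 < t" using Inner by (auto simp: points_def gen_edges_def)
  then show ?thesis using vertex_dist_src_gen[of e "edge_gen e"] radius_nonneg[of "edge_gen e"] Inner by simp
qed

text \<open>\<open>Birman_Schwinger\<close> on the tree. The kernel bound is known only off the
  vertices, which suffices by \<open>AE_not_vertex\<close>.\<close>

lemma count_le_resolvent:
  assumes gd: "global_dimension G d" "1 < d"
    and V: "V \<in> borel_measurable (tree_measure G)" "\<And>x. x \<in> points G \<Longrightarrow> 0 \<le> V x"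
    and F: "finite F" "F \<subseteq> {..<0}"
    and B: "\<And>m. m \<in> F \<Longrightarrow> finite (B m) \<and> B m \<subseteq> eigenspace (schroedinger_operator G V) m \<and> cfun.independent (B m)"
    and I: "I \<subseteq> Sigma F B" and E: "0 < E" "\<And>i. i \<in> I \<Longrightarrow> fst i \<le> - (2 * E)"
    and H: "\<And>x. x \<in> points G \<Longrightarrow> 0 \<le> H x"
    and bound: "\<And>\<phi> D x. tree_primitive \<phi> D \<Longrightarrow> x \<in> points G - Vertex ` verts G \<Longrightarrow> ennreal ((norm (\<phi> x))\<^sup>2) \<le> ennreal (H x) *
      ((\<integral>\<^sup>+x. ennreal ((norm (D x))\<^sup>2) \<partial>tree_measure G) + ennreal E * (\<integral>\<^sup>+x. ennreal ((norm (\<phi> x))\<^sup>2) \<partial>tree_measure G))"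
  shows "of_nat (card I) \<le> (\<integral>\<^sup>+x. ennreal (max 0 (V x - E) * H x) \<partial>tree_measure G)"
proof -
  interpret eigenfamily "tree_measure G" V I snd "\<lambda>i. tree_derivative G (snd i)" fst
    by (rule eigenfamily_schroedinger(1)[OF gd V F B I])
  show ?thesis
  proof (rule Birman_Schwinger[OF E AE_not_vertex])
    show "0 \<le> H x" if "x \<in> points G - Vertex ` verts G" for x using H that by simp
    fix c x assume x: "x \<in> points G - Vertex ` verts G"
    define u where "u = lincomb I snd c"
    define D where "D = lincomb I (\<lambda>i. tree_derivative G (snd i)) c"
    have "tree_primitive u D"
      unfolding u_def D_def lincomb_def[abs_def]
      by (rule tree_primitive_sum) (rule eigenfamily_schroedinger(2)[OF gd V F B I])
    from bound[OF this x]
    have "ennreal ((norm (u x))\<^sup>2) \<le> ennreal (H x) * (ennreal (\<integral>x. (norm (D x))\<^sup>2 \<partial>tree_measure G) + ennreal E * ennreal (\<integral>x. (norm (u x))\<^sup>2 \<partial>tree_measure G))"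
      unfolding u_def D_def using nn_integral_norm2[OF lincomb_L2[OF fin fL2]] nn_integral_norm2[OF lincomb_L2[OF fin dL2]] by simp
    also have "\<dots> = ennreal (H x * ((\<integral>x. (norm (D x))\<^sup>2 \<partial>tree_measure G) + E * (\<integral>x. (norm (u x))\<^sup>2 \<partial>tree_measure G)))"
      using H[of x] x E(1) by (simp add: ennreal_mult ennreal_plus)
    finally have "(norm (u x))\<^sup>2 \<le> H x * ((\<integral>x. (norm (D x))\<^sup>2 \<partial>tree_measure G) + E * (\<integral>x. (norm (u x))\<^sup>2 \<partial>tree_measure G))"
      using H[of x] x E(1) by (subst (asm) ennreal_le_iff) auto
    then show "(norm (lincomb I snd c x))\<^sup>2 \<le> H x * ((\<integral>x. (norm (lincomb I (\<lambda>i. tree_derivative G (snd i)) c x))\<^sup>2 \<partial>tree_measure G) +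
        E * (\<integral>x. (norm (lincomb I snd c x))\<^sup>2 \<partial>tree_measure G))"
      by (simp add: u_def D_def)
  qed
qed

text \<open>The weight \<open>(1 + root_dist G x) powr a\<close> stands for the power a/(d - 1) of
  \<open>g0\<close>, comparable to it by the definition of global dimension, and it is the form in
  which the resolvent bounds arrive. The constant is fixed before the potential.\<close>

definition trace_bound :: "real \<Rightarrow> real \<Rightarrow> bool" where
  "trace_bound a \<gamma> \<longleftrightarrow> (\<exists>C>0. \<forall>V. V \<in> borel_measurable (tree_measure G) \<and> (\<forall>x\<in>points G. 0 \<le> V x) \<longrightarrow>
    trace_neg (schroedinger_operator G V) \<gamma> \<le>
      ennreal C * (\<integral>\<^sup>+x. ennreal (V x powr (\<gamma> + (a + 1) / 2) * (1 + root_dist G x) powr a) \<partial>tree_measure G))"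

text \<open>After the exchange of integrals everything happens at one point x with y = V x, so a
  single integral in \<open>E\<close> remains to be estimated. The kernel bound \<open>H\<close> is
  left general so that a minimum of two bounds can be inserted.\<close>

lemma trace_bound_layer_cake:
  fixes H :: "real \<Rightarrow> ('v, 'e) point \<Rightarrow> real"
  assumes gd: "global_dimension G d" "1 < d" and \<gamma>: "0 < \<gamma>" and C: "0 < C"
    and H: "\<And>E x. 0 < E \<Longrightarrow> x \<in> points G \<Longrightarrow> 0 \<le> H E x"
    and Hm: "(\<lambda>(E, x). H E x) \<in> borel_measurable (lborel \<Otimes>\<^sub>M tree_measure G)"
    and bound: "\<And>E \<phi> D x. 0 < E \<Longrightarrow> tree_primitive \<phi> D \<Longrightarrow> x \<in> points G - Vertex ` verts G \<Longrightarrow> ennreal ((norm (\<phi> x))\<^sup>2) \<le> ennreal (H E x) *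
      ((\<integral>\<^sup>+x. ennreal ((norm (D x))\<^sup>2) \<partial>tree_measure G) + ennreal E * (\<integral>\<^sup>+x. ennreal ((norm (\<phi> x))\<^sup>2) \<partial>tree_measure G))"
    and inner: "\<And>y x. 0 \<le> y \<Longrightarrow> x \<in> points G \<Longrightarrow>
      (\<integral>\<^sup>+E\<in>{0<..}. ennreal (E powr (\<gamma> - 1)) * ennreal (max 0 (y - E) * H E x) \<partial>lborel)
        \<le> ennreal (C * (y powr (\<gamma> + (a + 1) / 2) * (1 + root_dist G x) powr a))"
  shows "trace_bound a \<gamma>"
proof -
  define C' where "C' = 2 powr \<gamma> * \<gamma> * C"
  have "0 < C'" using \<gamma> C by (simp add: C'_def)
  moreover have "trace_neg (schroedinger_operator G V) \<gamma> \<le>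
      ennreal C' * (\<integral>\<^sup>+x. ennreal (V x powr (\<gamma> + (a + 1) / 2) * (1 + root_dist G x) powr a) \<partial>tree_measure G)"
    if V: "V \<in> borel_measurable (tree_measure G) \<and> (\<forall>x\<in>points G. 0 \<le> V x)" for V
  proof (rule trace_neg_le)
    fix F B
    assume F: "finite F" "F \<subseteq> {..<0::real}"
      and B: "\<And>m. m \<in> F \<Longrightarrow> finite (B m) \<and> B m \<subseteq> eigenspace (schroedinger_operator G V) m \<and> cfun.independent (B m)"
    note Vm = V[THEN conjunct1] and V0 = V[THEN conjunct2, rule_format]
    note [measurable] = Vm Hm root_dist_measurable
    have fin: "finite (Sigma F B)" using F B by auto
    have neg: "0 < - fst i" if "i \<in> Sigma F B" for i using that F by auto
    have "(\<Sum>i\<in>Sigma F B. ennreal ((- fst i) powr \<gamma>)) \<le> ennreal (2 powr \<gamma> * \<gamma>) *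
      (\<integral>\<^sup>+x. (\<integral>\<^sup>+E\<in>{0<..}. ennreal (E powr (\<gamma> - 1)) * ennreal (max 0 (V x - E) * H E x) \<partial>lborel) \<partial>tree_measure G)"
    proof (rule layer_cake_sum[OF sigma_finite_tree_measure fin neg \<gamma>])
      have "(\<lambda>p. case p of (E, x) \<Rightarrow> ennreal (max 0 (V x - E) * H E x)) = (\<lambda>p. ennreal (max 0 (V (snd p) - fst p) * (case p of (E, x) \<Rightarrow> H E x)))"
        by (auto simp: fun_eq_iff)
      also have "\<dots> \<in> borel_measurable (lborel \<Otimes>\<^sub>M tree_measure G)" by measurable
      finally show "(\<lambda>(E, x). ennreal (max 0 (V x - E) * H E x)) \<in> borel_measurable (lborel \<Otimes>\<^sub>M tree_measure G)" .
      fix E :: real assume E: "0 < E"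
      show "of_nat (card {i \<in> Sigma F B. 2 * E < - fst i}) \<le> (\<integral>\<^sup>+x. ennreal (max 0 (V x - E) * H E x) \<partial>tree_measure G)"
        by (rule count_le_resolvent[OF gd Vm V0 F B _ E _ H[OF E] bound[OF E]]) auto
    qed
    also have "\<dots> \<le> ennreal (2 powr \<gamma> * \<gamma>) *
      (\<integral>\<^sup>+x. ennreal C * ennreal (V x powr (\<gamma> + (a + 1) / 2) * (1 + root_dist G x) powr a) \<partial>tree_measure G)"
      using inner V0 C by (intro mult_left_mono nn_integral_mono) (auto simp: space_tree_measure ennreal_mult'[symmetric])
    also have "\<dots> = ennreal (2 powr \<gamma> * \<gamma>) * (ennreal C *
      (\<integral>\<^sup>+x. ennreal (V x powr (\<gamma> + (a + 1) / 2) * (1 + root_dist G x) powr a) \<partial>tree_measure G))"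
      by (subst nn_integral_cmult) auto
    also have "\<dots> = ennreal C' * (\<integral>\<^sup>+x. ennreal (V x powr (\<gamma> + (a + 1) / 2) * (1 + root_dist G x) powr a) \<partial>tree_measure G)"
      using \<gamma> C by (simp add: C'_def ennreal_mult mult.assoc)
    finally show "(\<Sum>i\<in>Sigma F B. ennreal ((- fst i) powr \<gamma>)) \<le>
      ennreal C' * (\<integral>\<^sup>+x. ennreal (V x powr (\<gamma> + (a + 1) / 2) * (1 + root_dist G x) powr a) \<partial>tree_measure G)" .
  qed
  ultimately show ?thesis unfolding trace_bound_def by blast
qed

text \<open>The resolvent bound with \<delta> = a leaves \<open>E powr (s - 1)\<close>, where
  \<open>s = \<gamma> - (1 - a) / 2\<close> is positive above the critical exponent. The factor
  \<open>max 0 (y - E)\<close> ends the integral at y, and y times \<open>y powr s\<close> is the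
  required power of V.\<close>

lemma trace_bound_noncritical:
  assumes gd: "global_dimension G d" "1 < d"
    and a: "(0 \<le> a \<and> a < 1 \<and> a \<le> d - 1) \<or> (a = 1 \<and> 2 < d)" and \<gamma>: "(1 - a) / 2 < \<gamma>"
  shows "trace_bound a \<gamma>"
proof -
  obtain K where K: "resolvent_bound a K" using resolvent_bound_exists[OF gd(1) a] by blast
  then have K0: "0 < K" by (simp add: resolvent_bound_def)
  define s where "s = \<gamma> - (1 - a) / 2"
  have s: "0 < s" using \<gamma> by (simp add: s_def)
  have \<gamma>0: "0 < \<gamma>" using \<gamma> a by auto
  define H where "H E x = K * ((1 + root_dist G x) powr a * E powr (- (1 - a) / 2))" for E x
  show ?thesis
  proof (rule trace_bound_layer_cake[OF gd \<gamma>0, of "K / s" H])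
    show "0 < K / s" using K0 s by simp
    show "0 \<le> H E x" for E x using K0 by (simp add: H_def)
    note [measurable] = root_dist_measurable
    show "(\<lambda>(E, x). H E x) \<in> borel_measurable (lborel \<Otimes>\<^sub>M tree_measure G)"
      unfolding H_def by measurable
    show "ennreal ((norm (\<phi> x))\<^sup>2) \<le> ennreal (H E x) *
      ((\<integral>\<^sup>+x. ennreal ((norm (D x))\<^sup>2) \<partial>tree_measure G) + ennreal E * (\<integral>\<^sup>+x. ennreal ((norm (\<phi> x))\<^sup>2) \<partial>tree_measure G))"
      if "0 < E" "tree_primitive \<phi> D" "x \<in> points G - Vertex ` verts G" for E \<phi> D x
      using K that unfolding resolvent_bound_def H_def by blast
    fix y :: real and x assume y: "0 \<le> y" and "x \<in> points G"
    define w where "w = (1 + root_dist G x) powr a"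
    have "(\<integral>\<^sup>+E\<in>{0<..}. ennreal (E powr (\<gamma> - 1)) * ennreal (max 0 (y - E) * H E x) \<partial>lborel)
        \<le> (\<integral>\<^sup>+E. ennreal (K * w * y) * (ennreal (E powr (s - 1)) * indicator {0..y} E) \<partial>lborel)"
    proof (rule nn_integral_mono)
      fix E :: real
      show "ennreal (E powr (\<gamma> - 1)) * ennreal (max 0 (y - E) * H E x) * indicator {0<..} E
          \<le> ennreal (K * w * y) * (ennreal (E powr (s - 1)) * indicator {0..y} E)"
      proof (cases "0 < E \<and> E \<le> y")
        case True
        have "E powr (\<gamma> - 1) * E powr (- (1 - a) / 2) = E powr (s - 1)"
          unfolding powr_add[symmetric] by (rule arg_cong[of _ _ "\<lambda>p. E powr p"]) (simp add: s_def field_simps)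
        then have "E powr (\<gamma> - 1) * (max 0 (y - E) * H E x) = K * w * max 0 (y - E) * E powr (s - 1)"
          by (simp add: H_def w_def algebra_simps)
        also have "\<dots> \<le> K * w * y * E powr (s - 1)"
          using True K0 by (intro mult_right_mono mult_left_mono) (auto simp: w_def)
        finally have "ennreal (E powr (\<gamma> - 1) * (max 0 (y - E) * H E x)) \<le> ennreal (K * w * y * E powr (s - 1))"
          by (rule ennreal_leI)
        then show ?thesis using True K0 y by (simp add: ennreal_mult' ennreal_mult'' w_def)
      next
        case False
        then have "max 0 (y - E) = 0 \<or> E \<le> 0" by auto
        then show ?thesis by (auto split: split_indicator)
      qed
    qed
    also have "\<dots> = ennreal (K * w * y) * (\<integral>\<^sup>+E\<in>{0..y}. ennreal (E powr (s - 1)) \<partial>lborel)"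
      by (rule nn_integral_cmult) measurable
    also have "\<dots> = ennreal (K * w * y) * ennreal (y powr s / s)"
      using nn_integral_powr_Icc[OF s y] by simp
    also have "\<dots> = ennreal (K * w * y * (y powr s / s))"
      using K0 y s by (intro ennreal_mult[symmetric]) (auto simp: w_def)
    also have "K * w * y * (y powr s / s) = K / s * (y powr (\<gamma> + (a + 1) / 2) * w)"
    proof -
      have "y powr (\<gamma> + (a + 1) / 2) = y powr (1 + s)"
        by (rule arg_cong[of _ _ "\<lambda>p. y powr p"]) (simp add: s_def field_simps)
      also have "\<dots> = y * y powr s" using y by (simp add: powr_add)
      finally show ?thesis by simp
    qed
    finally show "(\<integral>\<^sup>+E\<in>{0<..}. ennreal (E powr (\<gamma> - 1)) * ennreal (max 0 (y - E) * H E x) \<partial>lborel)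
        \<le> ennreal (K / s * (y powr (\<gamma> + (a + 1) / 2) * (1 + root_dist G x) powr a))"
      by (simp add: w_def)
  qed
qed

text \<open>At the critical exponent the layer cake integral diverges at one end for each single
  resolvent bound; combining the bounds for \<open>\<delta> = 0\<close> and some \<open>\<delta> > a\<close> makes it converge.\<close>

lemma trace_bound_critical:
  assumes gd: "global_dimension G d" "1 < d" and a: "0 < a" "a < 1" "a < d - 1"
  shows "trace_bound a ((1 - a) / 2)"
proof -
  define \<gamma> where "\<gamma> = (1 - a) / 2"
  have \<gamma>: "0 < \<gamma>" using a by (simp add: \<gamma>_def)
  \<comment> \<open>\<open>a < \<delta>\<close> gives integrability at E = 0, and the upper limit
    makes \<open>resolvent_bound_exists\<close> applicable.\<close>
  obtain \<delta> where \<delta>: "a < \<delta>" "\<delta> < min 1 (d - 1)" using dense[of a "min 1 (d - 1)"] a by auto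
  obtain K0 where K0: "resolvent_bound 0 K0" using resolvent_bound_exists[OF gd(1), of 0] gd(2) by auto
  obtain K1 where K1: "resolvent_bound \<delta> K1" using resolvent_bound_exists[OF gd(1), of \<delta>] \<delta> a by auto
  have pos: "0 < K0" "0 < K1" using K0 K1 by (auto simp: resolvent_bound_def)
  define s where "s = (\<delta> - a) / 2"
  have s: "0 < s" using \<delta> by (simp add: s_def)
  define H0 where "H0 E x = K0 * ((1 + root_dist G x) powr 0 * E powr (- (1 - 0) / 2))" for E x
  define H1 where "H1 E x = K1 * ((1 + root_dist G x) powr \<delta> * E powr (- (1 - \<delta>) / 2))" for E x
  define C where "C = K1 / s + K0 / (a / 2)"
  have "trace_bound a \<gamma>"
  proof (rule trace_bound_layer_cake[OF gd \<gamma>, of C "\<lambda>E x. min (H0 E x) (H1 E x)"])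
    show "0 < C" using pos s a by (simp add: C_def add_pos_pos)
    show "0 \<le> min (H0 E x) (H1 E x)" for E x using pos by (simp add: H0_def H1_def)
    note [measurable] = root_dist_measurable
    show "(\<lambda>(E, x). min (H0 E x) (H1 E x)) \<in> borel_measurable (lborel \<Otimes>\<^sub>M tree_measure G)"
      unfolding H0_def H1_def by measurable
    show "ennreal ((norm (\<phi> x))\<^sup>2) \<le> ennreal (min (H0 E x) (H1 E x)) *
      ((\<integral>\<^sup>+x. ennreal ((norm (D x))\<^sup>2) \<partial>tree_measure G) + ennreal E * (\<integral>\<^sup>+x. ennreal ((norm (\<phi> x))\<^sup>2) \<partial>tree_measure G))"
      if "0 < E" "tree_primitive \<phi> D" "x \<in> points G - Vertex ` verts G" for E \<phi> D x
    proof -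
      have "ennreal ((norm (\<phi> x))\<^sup>2) \<le> ennreal (h E x) *
        ((\<integral>\<^sup>+x. ennreal ((norm (D x))\<^sup>2) \<partial>tree_measure G) + ennreal E * (\<integral>\<^sup>+x. ennreal ((norm (\<phi> x))\<^sup>2) \<partial>tree_measure G))"
        if "h = H0 \<or> h = H1" for h
        using that K0 K1 \<open>0 < E\<close> \<open>tree_primitive \<phi> D\<close> \<open>x \<in> points G - Vertex ` verts G\<close>
        unfolding resolvent_bound_def H0_def[abs_def] H1_def[abs_def] by blast
      from this[of H0] this[of H1] show ?thesis by (simp add: min_def)
    qed
    fix y :: real and x assume y: "0 \<le> y" and x: "x \<in> points G"
    define w where "w = 1 + root_dist G x"
    have w: "1 \<le> w" using root_dist_nonneg[OF x] by (simp add: w_def)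
    \<comment> \<open>At this energy the two bounds agree up to constants, since w^\<delta>
      E^(\<delta>/2) = 1 there. Below it the bound with \<delta> is used, above it the one with
      0.\<close>
    define c where "c = w powr (- 2)"
    have c: "0 < c" using w by (simp add: c_def)
    have e1: "E powr (\<gamma> - 1) * E powr (- (1 - \<delta>) / 2) = E powr (s - 1)" for E :: real
      unfolding powr_add[symmetric] by (rule arg_cong[of _ _ "\<lambda>p. E powr p"]) (simp add: s_def \<gamma>_def field_simps)
    have e0: "E powr (\<gamma> - 1) * E powr (- (1 - 0) / 2) = E powr (- (a / 2) - 1)" for E :: real
      unfolding powr_add[symmetric] by (rule arg_cong[of _ _ "\<lambda>p. E powr p"]) (simp add: \<gamma>_def field_simps)
    have "(\<integral>\<^sup>+E\<in>{0<..}. ennreal (E powr (\<gamma> - 1)) * ennreal (max 0 (y - E) * min (H0 E x) (H1 E x)) \<partial>lborel)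
        \<le> (\<integral>\<^sup>+E. ennreal (y * K1 * w powr \<delta>) * (ennreal (E powr (s - 1)) * indicator {0..c} E) +
              ennreal (y * K0) * (ennreal (E powr (- (a / 2) - 1)) * indicator {c..} E) \<partial>lborel)"
    proof (rule nn_integral_mono)
      fix E :: real
      show "ennreal (E powr (\<gamma> - 1)) * ennreal (max 0 (y - E) * min (H0 E x) (H1 E x)) * indicator {0<..} E
        \<le> ennreal (y * K1 * w powr \<delta>) * (ennreal (E powr (s - 1)) * indicator {0..c} E) +
              ennreal (y * K0) * (ennreal (E powr (- (a / 2) - 1)) * indicator {c..} E)"
      proof (cases "0 < E")
        case True
        have m: "max 0 (y - E) \<le> y" "0 \<le> max 0 (y - E)" using True y by auto
        show ?thesis
        proof (cases "E \<le> c")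
          case Ec: True
          have "E powr (\<gamma> - 1) * (max 0 (y - E) * min (H0 E x) (H1 E x)) \<le> E powr (\<gamma> - 1) * (y * H1 E x)"
            using m y pos by (intro mult_left_mono mult_mono) (auto simp: H0_def H1_def)
          also have "\<dots> = y * K1 * w powr \<delta> * (E powr (\<gamma> - 1) * E powr (- (1 - \<delta>) / 2))"
            by (simp add: H1_def w_def mult_ac)
          finally have "ennreal (E powr (\<gamma> - 1) * (max 0 (y - E) * min (H0 E x) (H1 E x))) \<le> ennreal (y * K1 * w powr \<delta> * E powr (s - 1))"
            unfolding e1 by (rule ennreal_leI)
          then have "ennreal (E powr (\<gamma> - 1)) * ennreal (max 0 (y - E) * min (H0 E x) (H1 E x)) \<le> ennreal (y * K1 * w powr \<delta>) * ennreal (E powr (s - 1))"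
            by (simp only: ennreal_mult'[symmetric] ennreal_mult''[symmetric] powr_ge_zero)
          then show ?thesis using True Ec by (simp add: add_increasing2)
        next
          case Ec: False
          have "E powr (\<gamma> - 1) * (max 0 (y - E) * min (H0 E x) (H1 E x)) \<le> E powr (\<gamma> - 1) * (y * H0 E x)"
            using m y pos by (intro mult_left_mono mult_mono) (auto simp: H0_def H1_def)
          also have "\<dots> = y * K0 * (E powr (\<gamma> - 1) * E powr (- (1 - 0) / 2))"
            using w by (simp add: H0_def w_def mult_ac)
          finally have "ennreal (E powr (\<gamma> - 1) * (max 0 (y - E) * min (H0 E x) (H1 E x))) \<le> ennreal (y * K0 * E powr (- (a / 2) - 1))"
            unfolding e0 by (rule ennreal_leI)
          then have "ennreal (E powr (\<gamma> - 1)) * ennreal (max 0 (y - E) * min (H0 E x) (H1 E x)) \<le> ennreal (y * K0) * ennreal (E powr (- (a / 2) - 1))"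
            by (simp only: ennreal_mult'[symmetric] ennreal_mult''[symmetric] powr_ge_zero)
          then show ?thesis using True Ec by simp
        qed
      qed simp
    qed
    also have "\<dots> = ennreal (y * K1 * w powr \<delta>) * (\<integral>\<^sup>+E\<in>{0..c}. ennreal (E powr (s - 1)) \<partial>lborel) +
        ennreal (y * K0) * (\<integral>\<^sup>+E\<in>{c..}. ennreal (E powr (- (a / 2) - 1)) \<partial>lborel)"
    proof -
      have "(\<integral>\<^sup>+E. k * (ennreal (E powr r) * indicator S E) \<partial>lborel) = k * (\<integral>\<^sup>+E\<in>S. ennreal (E powr r) \<partial>lborel)"
        if "S \<in> sets borel" for k r and S :: "real set"
        using that by (intro nn_integral_cmult) auto
      then show ?thesis by (subst nn_integral_add) auto
    qed
    also have "\<dots> = ennreal (y * K1 * w powr \<delta>) * ennreal (c powr s / s) + ennreal (y * K0) * ennreal (c powr (- (a / 2)) / (a / 2))"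
      using nn_integral_powr_Icc[OF s less_imp_le[OF c]] nn_integral_powr_atLeast[of "a / 2" c] a c by simp
    also have "\<dots> = ennreal (y * K1 * w powr \<delta> * (c powr s / s) + y * K0 * (c powr (- (a / 2)) / (a / 2)))"
      using y pos s a by (subst ennreal_plus) (auto simp: ennreal_mult'[symmetric] ennreal_mult''[symmetric])
    also have "y * K1 * w powr \<delta> * (c powr s / s) + y * K0 * (c powr (- (a / 2)) / (a / 2)) = C * (y powr (\<gamma> + (a + 1) / 2) * (1 + root_dist G x) powr a)"
    proof -
      have "w powr \<delta> * c powr s = w powr a"
        unfolding c_def powr_powr powr_add[symmetric] by (rule arg_cong[of _ _ "\<lambda>p. w powr p"]) (simp add: s_def field_simps)
      then have 1: "y * K1 * w powr \<delta> * (c powr s / s) = y * w powr a * (K1 / s)" by (simp add: field_simps)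
      have "c powr (- (a / 2)) = w powr a" by (simp add: c_def powr_powr)
      then have 2: "y * K0 * (c powr (- (a / 2)) / (a / 2)) = y * w powr a * (K0 / (a / 2))" by (simp add: field_simps)
      have "\<gamma> + (a + 1) / 2 = 1" by (simp add: \<gamma>_def field_simps)
      then have 3: "y powr (\<gamma> + (a + 1) / 2) = y" using y by simp
      show ?thesis unfolding 1 2 3 C_def w_def[symmetric] by (simp add: distrib_left distrib_right mult_ac)
    qed
    finally show "(\<integral>\<^sup>+E\<in>{0<..}. ennreal (E powr (\<gamma> - 1)) * ennreal (max 0 (y - E) * min (H0 E x) (H1 E x)) \<partial>lborel)
        \<le> ennreal (C * (y powr (\<gamma> + (a + 1) / 2) * (1 + root_dist G x) powr a))" .
  qed
  then show ?thesis by (simp add: \<gamma>_def)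
qed

text \<open>For \<delta> = 1 the resolvent bound does not depend on \<open>E\<close>, so all
  eigenvalues of a finite family are counted at once, without integrating over
  \<open>E\<close>.\<close>

lemma trace_bound_number:
  assumes gd: "global_dimension G d" "2 < d"
  shows "trace_bound 1 0"
proof -
  obtain K where K: "resolvent_bound 1 K" using resolvent_bound_exists[OF gd(1), of 1] gd(2) by auto
  then have K0: "0 < K" by (simp add: resolvent_bound_def)
  have d: "1 < d" using gd(2) by simp
  have "trace_neg (schroedinger_operator G V) 0 \<le>
      ennreal K * (\<integral>\<^sup>+x. ennreal (V x powr (0 + (1 + 1) / 2) * (1 + root_dist G x) powr 1) \<partial>tree_measure G)"
    if V: "V \<in> borel_measurable (tree_measure G) \<and> (\<forall>x\<in>points G. 0 \<le> V x)" for V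
  proof (rule trace_neg_le)
    fix F B
    assume F: "finite F" "F \<subseteq> {..<0::real}"
      and B: "\<And>m. m \<in> F \<Longrightarrow> finite (B m) \<and> B m \<subseteq> eigenspace (schroedinger_operator G V) m \<and> cfun.independent (B m)"
    note Vm = V[THEN conjunct1] and V0 = V[THEN conjunct2, rule_format]
    note [measurable] = Vm root_dist_measurable
    show "(\<Sum>i\<in>Sigma F B. ennreal ((- fst i) powr 0)) \<le>
      ennreal K * (\<integral>\<^sup>+x. ennreal (V x powr (0 + (1 + 1) / 2) * (1 + root_dist G x) powr 1) \<partial>tree_measure G)"
    proof (cases "F = {}")
      case False
      \<comment> \<open>Half the smallest modulus of the eigenvalues in \<open>F\<close>; it
        disappears from the final bound.\<close>
      define E where "E = - Max F / 2"
      have "Max F \<in> F" using False by (intro Max_in F(1))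
      then have E: "0 < E" using F(2) by (auto simp: E_def)
      define H where "H x = K * ((1 + root_dist G x) powr 1 * E powr (- (1 - 1) / 2))" for x
      have "(\<Sum>i\<in>Sigma F B. ennreal ((- fst i) powr 0)) = (\<Sum>i\<in>Sigma F B. 1)"
        using F(2) by (intro sum.cong) auto
      also have "\<dots> = of_nat (card (Sigma F B))" by simp
      also have "\<dots> \<le> (\<integral>\<^sup>+x. ennreal (max 0 (V x - E) * H x) \<partial>tree_measure G)"
      proof (rule count_le_resolvent[OF gd(1) d Vm V0 F B order_refl E])
        show "fst i \<le> - (2 * E)" if "i \<in> Sigma F B" for i
          using that Max_ge[OF F(1), of "fst i"] by (cases i) (simp add: E_def)
        show "0 \<le> H x" for x using K0 by (simp add: H_def)
        show "ennreal ((norm (\<phi> x))\<^sup>2) \<le> ennreal (H x) *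
          ((\<integral>\<^sup>+x. ennreal ((norm (D x))\<^sup>2) \<partial>tree_measure G) + ennreal E * (\<integral>\<^sup>+x. ennreal ((norm (\<phi> x))\<^sup>2) \<partial>tree_measure G))"
          if "tree_primitive \<phi> D" "x \<in> points G - Vertex ` verts G" for \<phi> D x
          using K that E unfolding resolvent_bound_def H_def by blast
      qed
      also have "\<dots> \<le> (\<integral>\<^sup>+x. ennreal K * ennreal (V x powr (0 + (1 + 1) / 2) * (1 + root_dist G x) powr 1) \<partial>tree_measure G)"
      proof (rule nn_integral_mono)
        fix x assume "x \<in> space (tree_measure G)"
        then have x: "x \<in> points G" by (simp add: space_tree_measure)
        have "max 0 (V x - E) * H x \<le> V x * H x"
          using V0[OF x] E K0 by (intro mult_right_mono) (auto simp: H_def)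
        also have "\<dots> = K * (V x powr (0 + (1 + 1) / 2) * (1 + root_dist G x) powr 1)"
          using V0[OF x] E by (simp add: H_def)
        finally show "ennreal (max 0 (V x - E) * H x) \<le> ennreal K * ennreal (V x powr (0 + (1 + 1) / 2) * (1 + root_dist G x) powr 1)"
          using K0 by (simp add: ennreal_mult'[symmetric] ennreal_leI del: powr_one)
      qed
      also have "\<dots> = ennreal K * (\<integral>\<^sup>+x. ennreal (V x powr (0 + (1 + 1) / 2) * (1 + root_dist G x) powr 1) \<partial>tree_measure G)"
        by (subst nn_integral_cmult) auto
      finally show ?thesis .
    qed simp
  qed
  then show ?thesis unfolding trace_bound_def using K0 by blast
qed

text \<open>The layer cake formula runs over the set of intervals: one of mass v counts as long as E
  < 4 v^2, and E^(-1/2) integrates to 4 v up to there. The masses add up to the integral of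
  V.\<close>

lemma trace_bound_half:
  assumes gd: "global_dimension G d" "1 < d"
  shows "trace_bound 0 (1 / 2)"
proof -
  \<comment> \<open>The first two factors are those of \<open>layer_cake_sum\<close> at \<gamma> =
    1/2; the 4 is the one in 4 v.\<close>
  define C where "C = 2 powr (1 / 2) * (1 / 2) * (4::real)"
  have C: "0 < C" by (simp add: C_def)
  have "trace_neg (schroedinger_operator G V) (1 / 2) \<le> ennreal C * (\<integral>\<^sup>+x. ennreal (V x) \<partial>tree_measure G)"
    if V: "V \<in> borel_measurable (tree_measure G)" "\<forall>x\<in>points G. 0 \<le> V x" for V
  proof (cases "(\<integral>\<^sup>+x. ennreal (V x) \<partial>tree_measure G) < \<infinity>")
    case False
    then show ?thesis using C by (simp add: not_less top_unique ennreal_mult_top)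
  next
    case fin: True
    note V0 = V(2)[rule_format]
    obtain z :: "'e \<times> nat \<Rightarrow> ('v, 'e) point" and v :: "'e \<times> nat \<Rightarrow> real"
      where v0: "\<forall>p\<in>ray_starts \<times> UNIV. 0 \<le> v p"
      and sum: "(\<integral>\<^sup>+p. ennreal (v p) \<partial>count_space (ray_starts \<times> UNIV)) = (\<integral>\<^sup>+x. ennreal (V x) \<partial>tree_measure G)"
      and ineq: "\<forall>E \<phi> D. 0 \<le> E \<and> tree_primitive \<phi> D \<and> (\<forall>p\<in>ray_starts \<times> UNIV. E < 4 * (v p)\<^sup>2 \<longrightarrow> \<phi> (z p) = 0) \<longrightarrow>
      (\<integral>\<^sup>+x. ennreal (V x * (norm (\<phi> x))\<^sup>2) \<partial>tree_measure G) \<le>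
      (\<integral>\<^sup>+x. ennreal ((norm (D x))\<^sup>2) \<partial>tree_measure G) + ennreal E * (\<integral>\<^sup>+x. ennreal ((norm (\<phi> x))\<^sup>2) \<partial>tree_measure G)"
      by (rule exE[OF tree_Weidl[OF V(1) _ fin]], erule V0, elim exE conjE) (rule that; assumption)
    define P where "P = ray_starts \<times> (UNIV :: nat set)"
    have countP: "countable P"
      unfolding P_def using countable_edges by (intro countable_SIGMA) (auto intro: countable_subset simp: ray_starts_def)
    have sf: "sigma_finite_measure (count_space P)"
      using countP by (rule sigma_finite_measure_count_space_countable)
    show ?thesis
    proof (rule trace_neg_le)
      fix F B
      assume F: "finite F" "F \<subseteq> {..<0::real}"
        and B: "\<And>m. m \<in> F \<Longrightarrow> finite (B m) \<and> B m \<subseteq> eigenspace (schroedinger_operator G V) m \<and> cfun.independent (B m)"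
      have finS: "finite (Sigma F B)" using F B by auto
      have neg: "0 < - fst i" if "i \<in> Sigma F B" for i using that F by auto
      have "(\<Sum>i\<in>Sigma F B. ennreal ((- fst i) powr (1 / 2))) \<le> ennreal (2 powr (1 / 2) * (1 / 2)) *
        (\<integral>\<^sup>+p. (\<integral>\<^sup>+E\<in>{0<..}. ennreal (E powr (1 / 2 - 1)) * indicator {..<4 * (v p)\<^sup>2} E \<partial>lborel) \<partial>count_space P)"
      proof (rule layer_cake_sum[OF sf finS neg half_gt_zero[OF zero_less_one]])
        have "(\<lambda>(p, E). indicator {..<4 * (v p)\<^sup>2} E :: ennreal) \<in> borel_measurable (count_space P \<Otimes>\<^sub>M lborel)"
          by (rule measurable_pair_measure_countable1[OF countP]) simp
        from measurable_pair_swap[OF this]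
        show "(\<lambda>(E, p). indicator {..<4 * (v p)\<^sup>2} E :: ennreal) \<in> borel_measurable (lborel \<Otimes>\<^sub>M count_space P)"
          by (simp add: case_prod_beta)
        fix E :: real assume E: "0 < E"
        define I where "I = {i \<in> Sigma F B. 2 * E < - fst i}"
        \<comment> \<open>The intervals that receive a Dirichlet condition at energy
          \<open>E\<close>.\<close>
        define Z where "Z = {p \<in> P. E < 4 * (v p)\<^sup>2}"
        have IS: "I \<subseteq> Sigma F B" by (auto simp: I_def)
        have "(\<integral>\<^sup>+p. indicator {..<4 * (v p)\<^sup>2} E \<partial>count_space P) = (\<integral>\<^sup>+p. indicator Z p \<partial>count_space P)"
          by (intro nn_integral_cong) (auto simp: Z_def split: split_indicator)
        also have "\<dots> = emeasure (count_space P) Z" by (rule nn_integral_indicator) (auto simp: Z_def)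
        finally have int_eq: "(\<integral>\<^sup>+p. indicator {..<4 * (v p)\<^sup>2} E \<partial>count_space P) = emeasure (count_space P) Z" .
        have "of_nat (card I) \<le> emeasure (count_space P) Z"
        proof (cases "finite Z")
          case True
          interpret eigenfamily "tree_measure G" V I snd "\<lambda>i. tree_derivative G (snd i)" fst
            by (rule eigenfamily_schroedinger(1)[OF gd V(1) V0 F B IS])
          \<comment> \<open>Rays cut at the same vertex share their starting point, so conditions
            may coincide, which only lowers their number.\<close>
          have "card I \<le> card (z ` Z)"
          proof (rule card_le_constraints[OF E])
            show "fst i \<le> - (2 * E)" if "i \<in> I" for i using that by (simp add: I_def)
            show "finite (z ` Z)" using True by simp
            fix c assume c: "\<And>y. y \<in> z ` Z \<Longrightarrow> lincomb I snd c y = 0"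
            define u where "u = lincomb I snd c"
            define D where "D = lincomb I (\<lambda>i. tree_derivative G (snd i)) c"
            have uD: "tree_primitive u D"
              unfolding u_def D_def lincomb_def[abs_def]
              by (rule tree_primitive_sum) (rule eigenfamily_schroedinger(2)[OF gd V(1) V0 F B IS])
            have L2: "u \<in> L2 (tree_measure G)" "D \<in> L2 (tree_measure G)"
              unfolding u_def D_def by (rule lincomb_L2[OF fin]; use fL2 dL2 in auto)+
            have Vu: "(\<integral>\<^sup>+x. ennreal (V x * (norm (u x))\<^sup>2) \<partial>tree_measure G) = ennreal (\<integral>x. V x * (norm (u x))\<^sup>2 \<partial>tree_measure G)"
              unfolding u_def using V0
              by (intro nn_integral_eq_integral integrable_lincomb(3) AE_I2) (simp add: space_tree_measure)
            have "\<forall>p\<in>ray_starts \<times> UNIV. E < 4 * (v p)\<^sup>2 \<longrightarrow> u (z p) = 0"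
              using c by (auto simp: u_def Z_def P_def)
            from ineq[THEN spec, THEN spec, THEN spec, THEN mp, OF conjI[OF less_imp_le[OF E] conjI[OF uD this]]]
            have "ennreal (\<integral>x. V x * (norm (u x))\<^sup>2 \<partial>tree_measure G)
                \<le> ennreal ((\<integral>x. (norm (D x))\<^sup>2 \<partial>tree_measure G) + E * (\<integral>x. (norm (u x))\<^sup>2 \<partial>tree_measure G))"
              unfolding Vu nn_integral_norm2[OF L2(1)] nn_integral_norm2[OF L2(2)] using E by (simp add: ennreal_mult ennreal_plus)
            then show "(\<integral>x. V x * (norm (lincomb I snd c x))\<^sup>2 \<partial>tree_measure G) \<le>
                (\<integral>x. (norm (lincomb I (\<lambda>i. tree_derivative G (snd i)) c x))\<^sup>2 \<partial>tree_measure G) +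
                E * (\<integral>x. (norm (lincomb I snd c x))\<^sup>2 \<partial>tree_measure G)"
              using E by (subst (asm) ennreal_le_iff) (auto simp: u_def D_def)
          qed
          also have "\<dots> \<le> card Z" using True by (rule card_image_le)
          finally show ?thesis using True by (simp add: emeasure_count_space Z_def)
        next
          case False
          then show ?thesis by (simp add: emeasure_count_space Z_def)
        qed
        then show "of_nat (card {i \<in> Sigma F B. 2 * E < - fst i}) \<le> (\<integral>\<^sup>+p. indicator {..<4 * (v p)\<^sup>2} E \<partial>count_space P)"
          unfolding int_eq I_def .
      qed
      also have "\<dots> \<le> ennreal (2 powr (1 / 2) * (1 / 2)) * (\<integral>\<^sup>+p. ennreal 4 * ennreal (v p) \<partial>count_space P)"
      proof (intro mult_left_mono nn_integral_mono)
        fix p assume "p \<in> space (count_space P)"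
        then have vp: "0 \<le> v p" using v0 by (auto simp: P_def)
        have "(\<integral>\<^sup>+E\<in>{0<..}. ennreal (E powr (1 / 2 - 1)) * indicator {..<4 * (v p)\<^sup>2} E \<partial>lborel)
            \<le> (\<integral>\<^sup>+E\<in>{0..4 * (v p)\<^sup>2}. ennreal (E powr (1 / 2 - 1)) \<partial>lborel)"
          by (intro nn_integral_mono) (auto split: split_indicator)
        also have "\<dots> = ennreal ((4 * (v p)\<^sup>2) powr (1 / 2) / (1 / 2))"
          by (rule nn_integral_powr_Icc) auto
        also have "(4 * (v p)\<^sup>2) powr (1 / 2) / (1 / 2) = 4 * v p"
          using vp by (simp add: powr_half_sqrt real_sqrt_mult)
        finally show "(\<integral>\<^sup>+E\<in>{0<..}. ennreal (E powr (1 / 2 - 1)) * indicator {..<4 * (v p)\<^sup>2} E \<partial>lborel) \<le> ennreal 4 * ennreal (v p)"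
          using vp by (simp add: ennreal_mult)
      qed simp
      also have "\<dots> = ennreal (2 powr (1 / 2) * (1 / 2)) * (ennreal 4 * (\<integral>\<^sup>+x. ennreal (V x) \<partial>tree_measure G))"
        unfolding sum[symmetric] P_def by (subst nn_integral_cmult) auto
      also have "\<dots> = ennreal C * (\<integral>\<^sup>+x. ennreal (V x) \<partial>tree_measure G)"
        unfolding C_def mult.assoc[symmetric] by (subst ennreal_mult[symmetric]) auto
      finally show "(\<Sum>i\<in>Sigma F B. ennreal ((- fst i) powr (1 / 2))) \<le> ennreal C * (\<integral>\<^sup>+x. ennreal (V x) \<partial>tree_measure G)" .
    qed
  qed
  moreover have "(\<integral>\<^sup>+x. ennreal (V x powr (1 / 2 + (0 + 1) / 2) * (1 + root_dist G x) powr 0) \<partial>tree_measure G) = (\<integral>\<^sup>+x. ennreal (V x) \<partial>tree_measure G)"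
    if "\<forall>x\<in>points G. 0 \<le> V x" for V
  proof (intro nn_integral_cong)
    fix x assume "x \<in> space (tree_measure G)"
    then have "x \<in> points G" by (simp add: space_tree_measure)
    then show "ennreal (V x powr (1 / 2 + (0 + 1) / 2) * (1 + root_dist G x) powr 0) = ennreal (V x)"
      using that root_dist_nonneg[of x] by simp
  qed
  ultimately show ?thesis unfolding trace_bound_def using C by (intro exI[of _ C]) auto
qed

lemma trace_bound_all:
  assumes gd: "global_dimension G d"
    and ad: "(1 < d \<and> d \<le> 2 \<and> 0 \<le> a \<and> a < d - 1) \<or> (2 < d \<and> 0 \<le> a \<and> a \<le> 1)"
    and \<gamma>: "(1 - a) / 2 \<le> \<gamma>"
  shows "trace_bound a \<gamma>"
proof -
  have d: "1 < d" using ad by auto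
  consider "(1 - a) / 2 < \<gamma>" | "\<gamma> = (1 - a) / 2" "a = 0" | "\<gamma> = (1 - a) / 2" "a = 1" | "\<gamma> = (1 - a) / 2" "0 < a" "a < 1"
    using \<gamma> ad by fastforce
  then show ?thesis
  proof cases
    case 1
    then show ?thesis using ad by (intro trace_bound_noncritical[OF gd d]) auto
  next
    case 2
    then have "\<gamma> = 1 / 2" by simp
    then show ?thesis unfolding 2(2) using trace_bound_half[OF gd d] by (simp only:)
  next
    case 3
    then show ?thesis using trace_bound_number[OF gd] ad by auto
  next
    case 4
    then have "a < d - 1" using ad by auto
    then show ?thesis unfolding 4(1) by (rule trace_bound_critical[OF gd d 4(2,3)])
  qed
qed

end

theorem corollary6p3:
  fixes G :: "('v, 'e) rooted_graph" and a d \<gamma> :: real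
  assumes "symmetric_tree G"
    and "global_dimension G d"
    and "(1 < d \<and> d \<le> 2 \<and> 0 \<le> a \<and> a < d - 1) \<or> (2 < d \<and> 0 \<le> a \<and> a \<le> 1)"
    and "\<gamma> \<ge> (1 - a) / 2"
  shows "\<exists>K::real. 0 < K \<and>
    (\<forall>V :: ('v, 'e) point \<Rightarrow> real.
      V \<in> borel_measurable (tree_measure G) \<and> (\<forall>x\<in>points G. 0 \<le> V x) \<and> decays_at_infinity G V \<longrightarrow>
      trace_neg (schroedinger_operator G V) \<gamma>
        \<le> ennreal K * (\<integral>\<^sup>+x. ennreal (V x powr (\<gamma> + (a + 1) / 2) *
             real (g0 G (root_dist G x)) powr (a / (d - 1))) \<partial>tree_measure G))"
proof -
  interpret symmetric_tree G by fact
  have d: "1 < d" and a: "0 \<le> a" using assms(3) by auto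
  interpret finite_length_tree G
    by standard (rule len_finite[OF assms(2) d])
  obtain C where C: "0 < C" and tr: "\<And>V. V \<in> borel_measurable (tree_measure G) \<Longrightarrow> \<forall>x\<in>points G. 0 \<le> V x \<Longrightarrow>
    trace_neg (schroedinger_operator G V) \<gamma> \<le>
      ennreal C * (\<integral>\<^sup>+x. ennreal (V x powr (\<gamma> + (a + 1) / 2) * (1 + root_dist G x) powr a) \<partial>tree_measure G)"
    using trace_bound_all[OF assms(2-4)] unfolding trace_bound_def by blast
  obtain c where c: "0 < c" and g0: "\<And>r. 0 \<le> r \<Longrightarrow> c * (1 + r) powr (d - 1) \<le> real (g0 G r)"
    by (rule global_dimension_bounds[OF assms(2)]) (rule that)
  define q where "q = a / (d - 1)"
  define c' where "c' = c powr q"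
  have c': "0 < c'" using c by (simp add: c'_def)
  have q: "0 \<le> q" "(d - 1) * q = a" using d a by (auto simp: q_def)
  \<comment> \<open>The lower growth bound raised to the power \<open>q = a / (d - 1)\<close>: it
    passes from the weight in \<open>trace_bound\<close> to the one with \<open>g0\<close>.\<close>
  have w: "c' * (1 + root_dist G x) powr a \<le> real (g0 G (root_dist G x)) powr q" if "x \<in> points G" for x
  proof -
    have r: "0 \<le> root_dist G x" using that by (rule root_dist_nonneg)
    have "c' * (1 + root_dist G x) powr a = (c * (1 + root_dist G x) powr (d - 1)) powr q"
      using c r by (simp add: c'_def powr_mult powr_powr q)
    also have "\<dots> \<le> real (g0 G (root_dist G x)) powr q"
      using g0[OF r] c r q by (intro powr_mono2) auto
    finally show ?thesis .
  qed
  show ?thesis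
  proof (intro exI[of _ "C / c'"] conjI allI impI)
    show "0 < C / c'" using C c' by simp
    fix V :: "('v, 'e) point \<Rightarrow> real"
    assume "V \<in> borel_measurable (tree_measure G) \<and> (\<forall>x\<in>points G. 0 \<le> V x) \<and> decays_at_infinity G V"
    then have Vm: "V \<in> borel_measurable (tree_measure G)" and V0: "\<forall>x\<in>points G. 0 \<le> V x" by auto
    note [measurable] = Vm root_dist_measurable
    define p where "p = \<gamma> + (a + 1) / 2"
    have "trace_neg (schroedinger_operator G V) \<gamma> \<le> ennreal C * (\<integral>\<^sup>+x. ennreal (V x powr p * (1 + root_dist G x) powr a) \<partial>tree_measure G)"
      unfolding p_def by (rule tr[OF Vm V0])
    also have "ennreal C = ennreal (C / c') * ennreal c'"
      using C c' by (simp add: ennreal_mult'[symmetric])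
    also have "ennreal (C / c') * ennreal c' * (\<integral>\<^sup>+x. ennreal (V x powr p * (1 + root_dist G x) powr a) \<partial>tree_measure G)
        = ennreal (C / c') * (\<integral>\<^sup>+x. ennreal c' * ennreal (V x powr p * (1 + root_dist G x) powr a) \<partial>tree_measure G)"
      by (subst nn_integral_cmult) (auto simp: mult.assoc)
    also have "\<dots> \<le> ennreal (C / c') * (\<integral>\<^sup>+x. ennreal (V x powr p * real (g0 G (root_dist G x)) powr q) \<partial>tree_measure G)"
    proof (intro mult_left_mono nn_integral_mono)
      fix x assume "x \<in> space (tree_measure G)"
      then have "V x powr p * (c' * (1 + root_dist G x) powr a) \<le> V x powr p * real (g0 G (root_dist G x)) powr q"
        using w by (intro mult_left_mono) (auto simp: space_tree_measure)
      then show "ennreal c' * ennreal (V x powr p * (1 + root_dist G x) powr a) \<le> ennreal (V x powr p * real (g0 G (root_dist G x)) powr q)"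
        using c' by (simp add: ennreal_mult'[symmetric] ennreal_leI mult.left_commute)
    qed simp
    finally show "trace_neg (schroedinger_operator G V) \<gamma>
        \<le> ennreal (C / c') * (\<integral>\<^sup>+x. ennreal (V x powr (\<gamma> + (a + 1) / 2) *
             real (g0 G (root_dist G x)) powr (a / (d - 1))) \<partial>tree_measure G)"
      by (simp add: p_def q_def)
  qed
qed

end
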